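(* Let $P\subset\mathbb{R}^n$ be a polytope with non-empty interior that is a local maximizer of the isotropic constant $K\mapsto L_K$ in the class of convex bodies in $\mathbb{R}^n$. If every ridge $G \subset P$ is an affine reflector, then $P$ is a simplex.
   Context: A convex body $K\subset\mathbb{R}^n$ is a compact convex set with non-empty interior. Its covariance matrix is $A_K = \mathbb{E}[XX^{\mathsf T}] - \mathbb{E}[X]\mathbb{E}[X]^{\mathsf T}$, where $X$ is uniformly distributed on $K$, and its isotropic constant $L_K>0$ is defined by $L_K^{2n} = \det A_K/(\mathrm{vol}\, K)^2$ (an affine invariant). A polytope is the convex hull of finitely many points. A body $P$ is a local maximizer of the isotropic constant in a class of convex bodies if it belongs to the class and there is a neighbourhood $U$ of $P$ with respect to the Hausdorff metric such that $L_K \le L_P$ for all $K \in U$ in the class. A ridge of an $n$-dimensional polytope $P$ is an $(n-2)$-dimensional face; each ridge $G$ is contained in exactly two facets $F_1,F_2$ and $G=F_1\cap F_2$. Let $c_P$ be the centroid of $P$. The ridge $G$ is called an affine reflector if there exists an affine map $f\colon\mathbb{R}^n\to\mathbb{R}^n$ with $f(c_P)=c_P$, $f(F_1)=F_2$ and $f|_G=\mathrm{id}_G$. *)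

theory Defs
  imports "HOL-Analysis.Analysis"
begin

definition convex_body :: "'a::euclidean_space set \<Rightarrow> bool" where
  "convex_body K \<longleftrightarrow> compact K \<and> convex K \<and> interior K \<noteq> {}"

definition centroid :: "'a::euclidean_space set \<Rightarrow> 'a" where
  "centroid K = (LINT x|uniform_measure lborel K. x)"

definition covariance_matrix :: "(real ^ 'n) set \<Rightarrow> real ^ 'n ^ 'n" where
  "covariance_matrix K =
     (\<chi> i j. (LINT x|uniform_measure lborel K. x $ i * x $ j) - centroid K $ i * centroid K $ j)"

text \<open>
  For a convex body the radicand is positive, so this is the unique positive number \<open>L\<close> with
  \<open>L ^ (2 * n) = det A / vol\<^sup>2\<close>.
\<close>
definition isotropic_constant :: "(real ^ 'n) set \<Rightarrow> real" where
  "isotropic_constant K =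
     root (2 * CARD('n)) (det (covariance_matrix K) / (measure lborel K)\<^sup>2)"

text \<open>Only meaningful for non-empty bounded sets.\<close>
definition hausdorff_dist :: "'a::metric_space set \<Rightarrow> 'a set \<Rightarrow> real" where
  "hausdorff_dist A B = max (SUP x\<in>A. infdist x B) (SUP y\<in>B. infdist y A)"

definition local_maximizer_isotropic :: "(real ^ 'n) set set \<Rightarrow> (real ^ 'n) set \<Rightarrow> bool" where
  "local_maximizer_isotropic \<C> P \<longleftrightarrow>
     P \<in> \<C> \<and>
     (\<exists>\<epsilon>>0. \<forall>K\<in>\<C>. hausdorff_dist K P < \<epsilon> \<longrightarrow> isotropic_constant K \<le> isotropic_constant P)"

text \<open>In dimension 1 the only ridge is the empty face, of affine dimension \<open>-1\<close>.\<close>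
definition ridge_of :: "'a::euclidean_space set \<Rightarrow> 'a set \<Rightarrow> bool" (infix \<open>ridge'_of\<close> 50) where
  "G ridge_of P \<longleftrightarrow> G face_of P \<and> aff_dim G = aff_dim P - 2"

definition affine_map :: "('a::real_vector \<Rightarrow> 'b::real_vector) \<Rightarrow> bool" where
  "affine_map f \<longleftrightarrow> (\<exists>g b. linear g \<and> f = (\<lambda>x. g x + b))"

text \<open>
  The facets \<open>F1\<close>, \<open>F2\<close> are determined by the ridge \<open>G\<close> up to exchange. Exchanging them
  does not matter: \<open>f\<close> is invertible, since its image contains \<open>F2\<close> and the centroid, and its
  inverse serves for the exchanged pair.
\<close>
definition affine_reflector :: "'a::euclidean_space set \<Rightarrow> 'a set \<Rightarrow> bool" where
  "affine_reflector P G \<longleftrightarrow>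
     (\<exists>F1 F2 f. F1 facet_of P \<and> F2 facet_of P \<and> F1 \<noteq> F2 \<and> G = F1 \<inter> F2 \<and>
        affine_map f \<and> f (centroid P) = centroid P \<and> f ` F1 = F2 \<and> (\<forall>x\<in>G. f x = x))"

end

theory Submission
  imports Defs
begin

text \<open>
In dimension one a polytope with interior points is a segment, so let \<open>n \<ge> 2\<close>. Translate the centroid
of \<open>P\<close> to the origin, let \<open>A\<close> be the covariance matrix and let \<open>q x = x \<bullet> A\<^bsup>-1\<^esup> x\<close>; the word reflection refers to the inner product that belongs to \<open>q\<close>.

First order. Tilting the hyperplane of a single facet \<open>F\<close> perturbs \<open>P\<close> in both directions, so the
derivative of the isotropic constant along it vanishes. Over the cone \<open>C\<close> spanned by \<open>F\<close> and the origin
this reads \<open>(n + 3) \<integral>\<^sub>C \<phi> q = (n + 1) (n + 2) \<integral>\<^sub>C \<phi>\<close> for every linear \<open>\<phi>\<close>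
(\<open>first_order_condition\<close>). An affine reflector that carries \<open>F1\<close> to \<open>F2\<close> has the form
\<open>f x = x + (u \<bullet> x) w\<close>. The condition for \<open>F2\<close>, pulled back along \<open>f\<close>, minus the condition for \<open>F1\<close>
says \<open>\<integral> (u \<bullet> x) (z \<bullet> x) (\<psi> \<bullet> x) = 0\<close> over the cone of \<open>F1\<close>, for all \<open>\<psi>\<close> and for a vector \<open>z\<close>
that measures how far \<open>f\<close> is from preserving \<open>q\<close>. Since \<open>u \<bullet> x > 0\<close> inside that cone, \<open>\<psi> = z\<close> gives
\<open>z = 0\<close>, and \<open>f\<close> is a reflection (\<open>reflector_is_reflection\<close>).

Symmetry. A reflection is determined by the ridge that it fixes. So if a reflection \<open>s\<close> carries a facet
\<open>F\<close> to a facet, then it conjugates the reflection in a ridge of \<open>F\<close> into the reflection in the image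
ridge, and carries the neighbour of \<open>F\<close> to a facet too. Facets are connected through ridges
(\<open>facets_connected\<close>), hence \<open>s\<close> maps \<open>P\<close> onto itself (\<open>reflection_preserves_P\<close>).

Second order. In the coordinates \<open>x = x' + r w\<close> adapted to such a reflection, \<open>P\<close> is given by
\<open>\<bar>r\<bar> \<le> g x'\<close> with a concave function \<open>g\<close>. The sets \<open>- (1 - t) g x' \<le> r \<le> (1 + t) g x'\<close> are convex bodies
with the same volume, and their covariance determinant is an explicit quadratic function of \<open>t\<close>.
That it has a maximum at \<open>t = 0\<close> is the inequality \<open>second_order_condition\<close>. As \<open>r\<close> is uniformly distributed
along each chord, the inequality says that the squared distance from \<open>g\<close> to its best affine
approximation is at most zero (\<open>upper_integral_height_profile\<close>). So \<open>g\<close> is affine, which forces every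
facet other than \<open>F1\<close> and \<open>F2\<close> to be parallel to \<open>w\<close> (\<open>adjacent_direction\<close>).

Conclusion. Apply this direction \<open>w\<close> to a linear relation between the facet normals: the coefficients of
\<open>F1\<close> and \<open>F2\<close> agree. By connectedness all coefficients of a relation agree, so there are at most
\<open>n + 1\<close> facets. Each vertex misses at most one of them and is determined by it, so there are at most
\<open>n + 1\<close> vertices.
\<close>

section \<open>Integration along lines and by layers\<close>

lemma nn_integral_translate:
  fixes f :: "'a::euclidean_space \<Rightarrow> ennreal"
  assumes [measurable]: "f \<in> borel_measurable borel"
  shows "(\<integral>\<^sup>+x. f (c + x) \<partial>lborel) = (\<integral>\<^sup>+x. f x \<partial>lborel)"
  by (subst (2) lborel_distr_plus[symmetric, of c]) (simp add: nn_integral_distr)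

lemma nn_integral_lborel_real_affine:
  fixes f :: "real \<Rightarrow> ennreal"
  assumes [measurable]: "f \<in> borel_measurable borel" and "c \<noteq> 0"
  shows "(\<integral>\<^sup>+\<tau>. f \<tau> \<partial>lborel) = ennreal \<bar>c\<bar> * (\<integral>\<^sup>+\<tau>. f (t + c * \<tau>) \<partial>lborel)"
  using nn_integral_real_affine[OF assms, of t] by simp

text \<open>
Fubini for the lines in direction \<open>w\<close>, without splitting the space into coordinates: multiply \<open>h x\<close> by
the indicator of the slab \<open>0 \<le> u \<bullet> x \<le> 1\<close> at \<open>x + \<tau> w\<close>, whose integral over \<open>\<tau>\<close> is one, interchange the
integrals, and use translation invariance.
\<close>
lemma nn_integral_along_lines:
  fixes h :: "'a::euclidean_space \<Rightarrow> ennreal" and u w :: 'a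
  assumes [measurable]: "h \<in> borel_measurable borel" and uw: "u \<bullet> w = 1"
  shows "(\<integral>\<^sup>+x. h x \<partial>lborel) =
    (\<integral>\<^sup>+x. indicator {x. 0 \<le> u \<bullet> x \<and> u \<bullet> x \<le> 1} x * (\<integral>\<^sup>+\<tau>. h (x - \<tau> *\<^sub>R w) \<partial>lborel) \<partial>lborel)"
proof -
  define slab where "slab = (indicator {x. 0 \<le> u \<bullet> x \<and> u \<bullet> x \<le> 1} :: 'a \<Rightarrow> ennreal)"
  have [measurable]: "slab \<in> borel_measurable borel"
    unfolding slab_def by measurable
  have one: "(\<integral>\<^sup>+\<tau>. slab (x + \<tau> *\<^sub>R w) \<partial>lborel) = 1" for x
  proof -
    have "(\<lambda>\<tau>. slab (x + \<tau> *\<^sub>R w)) = indicator {- (u \<bullet> x) .. 1 - u \<bullet> x}"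
      by (auto simp: slab_def fun_eq_iff indicator_def inner_add_right uw)
    then show ?thesis by simp
  qed
  have "(\<integral>\<^sup>+x. h x \<partial>lborel) = (\<integral>\<^sup>+x. (\<integral>\<^sup>+\<tau>. h x * slab (x + \<tau> *\<^sub>R w) \<partial>lborel) \<partial>lborel)"
    by (subst nn_integral_cmult) (auto simp: one)
  also have "\<dots> = (\<integral>\<^sup>+\<tau>. (\<integral>\<^sup>+x. h x * slab (x + \<tau> *\<^sub>R w) \<partial>lborel) \<partial>lborel)"
    by (rule lborel_pair.Fubini'[symmetric]) measurable
  also have "\<dots> = (\<integral>\<^sup>+\<tau>. (\<integral>\<^sup>+x. slab x * h (x - \<tau> *\<^sub>R w) \<partial>lborel) \<partial>lborel)"
  proof (rule nn_integral_cong)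
    fix \<tau>
    show "(\<integral>\<^sup>+x. h x * slab (x + \<tau> *\<^sub>R w) \<partial>lborel) = (\<integral>\<^sup>+x. slab x * h (x - \<tau> *\<^sub>R w) \<partial>lborel)"
      by (subst nn_integral_translate[symmetric, of _ "- \<tau> *\<^sub>R w"]) (auto simp: mult.commute)
  qed
  also have "\<dots> = (\<integral>\<^sup>+x. (\<integral>\<^sup>+\<tau>. slab x * h (x - \<tau> *\<^sub>R w) \<partial>lborel) \<partial>lborel)"
    by (rule lborel_pair.Fubini') measurable
  also have "\<dots> = (\<integral>\<^sup>+x. slab x * (\<integral>\<^sup>+\<tau>. h (x - \<tau> *\<^sub>R w) \<partial>lborel) \<partial>lborel)"
    by (subst nn_integral_cmult) auto
  finally show ?thesis by (simp add: slab_def)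
qed

text \<open>
The map acts on each line in direction \<open>w\<close> as an affine map with slope \<open>1 + u \<bullet> w\<close>, which is also its
determinant. Apart from dilations and translations, every change of variables below has this form.
\<close>
lemma lborel_rank_one_update:
  fixes u w :: "'a::euclidean_space"
  assumes lam: "1 + u \<bullet> w \<noteq> 0"
  shows "lborel = density (distr lborel borel (\<lambda>x. x + (u \<bullet> x) *\<^sub>R w)) (\<lambda>_. ennreal \<bar>1 + u \<bullet> w\<bar>)"
    (is "_ = ?D")
proof (cases "w = 0")
  case True
  then show ?thesis using True by (simp add: density_1 distr_id2)
next
  case False
  define T where "T = (\<lambda>x. x + (u \<bullet> x) *\<^sub>R w)"
  define dil where "dil = 1 + u \<bullet> w"
  have [measurable]: "T \<in> borel_measurable borel" unfolding T_def by measurable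
  define v where "v = w /\<^sub>R (w \<bullet> w)"
  have vw: "v \<bullet> w = 1" using False by (simp add: v_def)
  show ?thesis
  proof (rule measure_eqI)
    fix A :: "'a set" assume "A \<in> sets lborel"
    then have [measurable]: "A \<in> sets borel" by simp
    let ?h = "indicator A :: 'a \<Rightarrow> ennreal"
    have "emeasure ?D A = (\<integral>\<^sup>+x. ennreal \<bar>dil\<bar> * ?h (T x) \<partial>lborel)"
      by (simp add: emeasure_density nn_integral_distr flip: T_def dil_def)
    also have "\<dots> = ennreal \<bar>dil\<bar> * (\<integral>\<^sup>+x. ?h (T x) \<partial>lborel)"
      by (rule nn_integral_cmult) measurable
    also have "(\<integral>\<^sup>+x. ?h (T x) \<partial>lborel) = (\<integral>\<^sup>+x. indicator {x. 0 \<le> v \<bullet> x \<and> v \<bullet> x \<le> 1} x *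
        (\<integral>\<^sup>+\<tau>. ?h (T (x - \<tau> *\<^sub>R w)) \<partial>lborel) \<partial>lborel)"
      by (rule nn_integral_along_lines[OF _ vw]) measurable
    also have "ennreal \<bar>dil\<bar> * \<dots> = (\<integral>\<^sup>+x. indicator {x. 0 \<le> v \<bullet> x \<and> v \<bullet> x \<le> 1} x *
        (ennreal \<bar>dil\<bar> * (\<integral>\<^sup>+\<tau>. ?h (T (x - \<tau> *\<^sub>R w)) \<partial>lborel)) \<partial>lborel)"
      by (subst nn_integral_cmult[symmetric]) (auto simp: mult_ac)
    also have "\<dots> = (\<integral>\<^sup>+x. indicator {x. 0 \<le> v \<bullet> x \<and> v \<bullet> x \<le> 1} x *
        (\<integral>\<^sup>+\<tau>. ?h (x - \<tau> *\<^sub>R w) \<partial>lborel) \<partial>lborel)"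
    proof (intro nn_integral_cong arg_cong2[where f="(*)"] refl)
      fix x
      have "T (x - \<tau> *\<^sub>R w) = x - (- (u \<bullet> x) + dil * \<tau>) *\<^sub>R w" for \<tau>
        by (simp add: T_def dil_def inner_diff_right algebra_simps)
      then show "ennreal \<bar>dil\<bar> * (\<integral>\<^sup>+\<tau>. ?h (T (x - \<tau> *\<^sub>R w)) \<partial>lborel) = (\<integral>\<^sup>+\<tau>. ?h (x - \<tau> *\<^sub>R w) \<partial>lborel)"
        using lam by (subst (2) nn_integral_lborel_real_affine[where c="dil" and t="- (u \<bullet> x)"])
           (auto simp: dil_def)
    qed
    also have "\<dots> = (\<integral>\<^sup>+x. ?h x \<partial>lborel)"
      by (rule nn_integral_along_lines[OF _ vw, symmetric]) measurable
    finally show "emeasure lborel A = emeasure ?D A" by simp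
  qed simp
qed

lemma integral_rank_one_update:
  fixes h :: "'a::euclidean_space \<Rightarrow> real"
  assumes [measurable]: "h \<in> borel_measurable borel" and lam: "1 + u \<bullet> w \<noteq> 0"
  shows "(LINT x|lborel. h x) = \<bar>1 + u \<bullet> w\<bar> * (LINT x|lborel. h (x + (u \<bullet> x) *\<^sub>R w))"
  by (subst lborel_rank_one_update[OF lam])
     (simp add: integral_density integral_distr)

lemma set_integral_rank_one_update:
  fixes h :: "'a::euclidean_space \<Rightarrow> real"
  assumes [measurable]: "h \<in> borel_measurable borel" "S \<in> sets borel" and lam: "1 + u \<bullet> w \<noteq> 0"
    and T: "\<And>x. T x = x + (u \<bullet> x) *\<^sub>R w"
    and im: "\<And>x. T x \<in> S \<longleftrightarrow> x \<in> R"
  shows "(LINT x:S|lborel. h x) = \<bar>1 + u \<bullet> w\<bar> * (LINT x:R|lborel. h (T x))"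
  unfolding set_lebesgue_integral_def
  by (subst integral_rank_one_update[OF _ lam])
     (auto simp: indicator_def im T[symmetric])

lemma set_integral_scaleR_image:
  fixes h :: "'a::euclidean_space \<Rightarrow> real"
  assumes [measurable]: "h \<in> borel_measurable borel" "S \<in> sets borel" and c: "c > 0"
    and im: "\<And>x. c *\<^sub>R x \<in> S \<longleftrightarrow> x \<in> R"
  shows "(LINT x:S|lborel. h x) = c ^ DIM('a) * (LINT x:R|lborel. h (c *\<^sub>R x))"
  unfolding set_lebesgue_integral_def
  using c im by (subst lborel_affine[of c 0])
     (auto simp: integral_density integral_distr indicator_def)

lemma set_integrable_compact_continuous:
  fixes h :: "'a::euclidean_space \<Rightarrow> real"
  assumes "compact S" "continuous_on S h"
  shows "set_integrable lborel S h"
  using borel_integrable_compact[OF assms] by (simp add: set_integrable_def)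

text \<open>
If the sublevel sets of \<open>\<tau>\<close> carry a share \<open>l ^ j\<close> of the integral of \<open>h\<close>, then \<open>\<tau>\<close> is distributed, with
respect to \<open>h\<close>, like a variable on the unit interval with distribution function \<open>l ^ j\<close>. This gives its
moments even if \<open>h\<close> changes sign. The lemma serves twice: with the gauge of a polytope, where \<open>j\<close> is a
degree of homogeneity, and with the relative position on a chord, where \<open>j = 1\<close>.
\<close>
lemma layer_integral:
  fixes h \<tau> :: "'a::euclidean_space \<Rightarrow> real"
  assumes int: "set_integrable lborel S h"
    and [measurable]: "\<tau> \<in> borel_measurable borel" "S \<in> sets borel" "h \<in> borel_measurable borel"
    and \<tau>: "\<And>x. x \<in> S \<Longrightarrow> 0 \<le> \<tau> x \<and> \<tau> x \<le> 1"
    and k: "k > 0"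
    and layer: "\<And>l. 0 < l \<Longrightarrow> l < 1 \<Longrightarrow> (LINT x:S \<inter> {x. \<tau> x \<le> l}|lborel. h x) = l ^ j * (LINT x:S|lborel. h x)"
  shows "(LINT x:S|lborel. h x * (1 - \<tau> x ^ k)) = real k / real (k + j) * (LINT x:S|lborel. h x)"
proof -
  define w where "w = (\<lambda>l::real. indicator {0<..<1} l * (real k * l ^ (k - 1)))"
  define f where "f = (\<lambda>x l. indicator S x * h x * (w l * (indicator {x. \<tau> x \<le> l} x :: real)))"
  have [measurable]: "w \<in> borel_measurable borel" unfolding w_def by measurable
  have fm [measurable]: "(\<lambda>(x, l). f x l) \<in> borel_measurable (lborel \<Otimes>\<^sub>M lborel)"
    unfolding f_def indicator_def by measurable
  have pow: "((\<lambda>l. real k * l ^ (k - 1)) has_integral 1 ^ k - a ^ k) {a..1}" if "a \<le> 1" for a :: real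
    using that by (intro fundamental_theorem_of_calculus)
      (auto intro!: derivative_eq_intros simp flip: has_real_derivative_iff_has_vector_derivative)
  have powj: "((\<lambda>l. real k * l ^ (k - 1) * l ^ j) has_integral real k / real (k + j) * 1 ^ (k + j) - real k / real (k + j) * 0 ^ (k + j)) {0..1::real}"
    using k by (intro fundamental_theorem_of_calculus)
      (auto intro!: derivative_eq_intros simp flip: has_real_derivative_iff_has_vector_derivative power_add)
  have wint: "integrable lborel w"
  proof -
    have "set_integrable lborel {0..1} (\<lambda>l::real. real k * l ^ (k - 1))"
      by (intro set_integrable_compact_continuous continuous_intros) auto
    then have "set_integrable lborel {0<..<1} (\<lambda>l::real. real k * l ^ (k - 1))"
      by (rule set_integrable_subset) auto
    then show ?thesis by (simp add: set_integrable_def w_def)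
  qed
  have inner: "(LINT l|lborel. f x l) = indicator S x * (h x * (1 - \<tau> x ^ k))" for x
  proof (cases "x \<in> S")
    case True
    note t = \<tau>[OF True]
    have "AE l in lborel. w l * indicator {x. \<tau> x \<le> l} x = indicator {\<tau> x..1} l *\<^sub>R (real k * l ^ (k - 1))"
      using AE_lborel_singleton[of 0] AE_lborel_singleton[of 1]
      by eventually_elim (use t in \<open>auto simp: w_def indicator_def\<close>)
    then have "(LINT l|lborel. w l * indicator {x. \<tau> x \<le> l} x) = (LINT l:{\<tau> x..1}|lborel. real k * l ^ (k - 1))"
      unfolding set_lebesgue_integral_def by (intro integral_cong_AE) auto
    also have "\<dots> = integral {\<tau> x..1} (\<lambda>l. real k * l ^ (k - 1))"
      by (intro set_borel_integral_eq_integral set_integrable_compact_continuous continuous_intros) auto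
    also have "\<dots> = 1 - \<tau> x ^ k"
      using integral_unique[OF pow[of "\<tau> x"]] t by simp
    finally show ?thesis using True by (simp add: f_def mult.assoc)
  qed (simp add: f_def)
  have wj: "(LINT l|lborel. w l * l ^ j) = real k / real (k + j)"
  proof -
    have "(LINT l|lborel. w l * l ^ j) = (LINT l:{0..1}|lborel. real k * l ^ (k - 1) * l ^ j)"
      unfolding set_lebesgue_integral_def
    proof (rule integral_cong_AE)
      show "AE l in lborel. w l * l ^ j = indicator {0..1} l *\<^sub>R (real k * l ^ (k - 1) * l ^ j)"
        using AE_lborel_singleton[of 0] AE_lborel_singleton[of 1]
        by eventually_elim (auto simp: w_def indicator_def)
    qed auto
    also have "\<dots> = integral {0..1} (\<lambda>l. real k * l ^ (k - 1) * l ^ j)"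
      by (intro set_borel_integral_eq_integral set_integrable_compact_continuous continuous_intros) auto
    also have "\<dots> = real k / real (k + j)"
      using integral_unique[OF powj] k by simp
    finally show ?thesis .
  qed
  have outer: "(LINT x|lborel. f x l) = (w l * l ^ j) * (LINT x:S|lborel. h x)" for l
  proof (cases "0 < l \<and> l < 1")
    case True
    have "(LINT x|lborel. f x l) = w l * (LINT x:S \<inter> {x. \<tau> x \<le> l}|lborel. h x)"
    proof -
      have "(LINT x|lborel. f x l) = (LINT x|lborel. w l * (indicator (S \<inter> {x. \<tau> x \<le> l}) x *\<^sub>R h x))"
        by (intro Bochner_Integration.integral_cong) (auto simp: f_def indicator_def)
      then show ?thesis by (simp add: set_lebesgue_integral_def)
    qed
    then show ?thesis using layer True by simp
  qed (auto simp: f_def w_def)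
  have hint: "integrable lborel (\<lambda>x. indicator S x * h x)"
    using int by (simp add: set_integrable_def)
  have fint: "integrable (lborel \<Otimes>\<^sub>M lborel) (\<lambda>(x, l). f x l)"
  proof (rule Bochner_Integration.integrable_bound)
    show "integrable (lborel \<Otimes>\<^sub>M lborel) (\<lambda>(x, l). (indicator S x * h x) * w l)"
    proof (rule lborel_pair.Fubini_integrable)
      have "integrable lborel (\<lambda>x. \<bar>indicator S x * h x\<bar> * (LINT l|lborel. \<bar>w l\<bar>))"
        by (intro integrable_mult_left integrable_abs hint)
      then show "integrable lborel (\<lambda>x. LINT l|lborel. norm (case (x, l) of (x, l) \<Rightarrow> indicator S x * h x * w l))"
        by (simp add: abs_mult)
    qed (use wint in auto)
    show "AE p in lborel \<Otimes>\<^sub>M lborel. norm (case p of (x, l) \<Rightarrow> f x l) \<le> norm (case p of (x, l) \<Rightarrow> indicator S x * h x * w l)"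
      by (auto simp: f_def indicator_def)
  qed measurable
  have "(LINT x:S|lborel. h x * (1 - \<tau> x ^ k)) = (LINT x|lborel. LINT l|lborel. f x l)"
    unfolding set_lebesgue_integral_def by (simp add: inner)
  also have "\<dots> = (LINT l|lborel. LINT x|lborel. f x l)"
    by (rule lborel_pair.Fubini_integral[OF fint, symmetric])
  also have "\<dots> = (LINT l|lborel. w l * l ^ j) * (LINT x:S|lborel. h x)"
    unfolding outer by simp
  finally show ?thesis by (simp add: wj)
qed

section \<open>Determinants, moments and the isotropic constant\<close>

definition outer :: "real ^ 'n \<Rightarrow> real ^ 'n \<Rightarrow> real ^ 'n ^ 'n" where
  "outer w z = (\<chi> i j. w $ i * z $ j)"

lemma outer_nth [simp]: "outer w z $ i $ j = w $ i * z $ j"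
  by (simp add: outer_def)

lemma outer_mult_vector: "outer w z *v x = (z \<bullet> x) *\<^sub>R w"
  by (simp add: outer_def matrix_vector_mult_def vec_eq_iff inner_vec_def sum_distrib_left mult_ac)

lemma matrix_mul_outer: "A ** outer w z = outer (A *v w) z"
  by (simp add: outer_def matrix_matrix_mult_def matrix_vector_mult_def vec_eq_iff sum_distrib_left mult_ac)

lemma outer_matrix_mul: "outer w z ** A = outer w (transpose A *v z)"
  by (simp add: outer_def matrix_matrix_mult_def matrix_vector_mult_def transpose_def vec_eq_iff
      sum_distrib_left mult_ac)

lemma matrix_add_rdistrib: "(B + C) ** A = (B ** A) + (C ** A :: real ^ 'n ^ 'n)"
  by (simp add: matrix_matrix_mult_def vec_eq_iff algebra_simps sum.distrib)

lemma outer_add_left: "outer (x + y) z = outer x z + outer y z"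
  by (simp add: vec_eq_iff algebra_simps)

lemma outer_scaleR_left: "outer (c *\<^sub>R w) z = c *\<^sub>R outer w z"
  by (simp add: vec_eq_iff)

lemma outer_scaleR_right: "outer w (c *\<^sub>R z) = c *\<^sub>R outer w z"
  by (simp add: vec_eq_iff)

text \<open>
The matrix determinant lemma. An orthogonal change of basis turns \<open>z\<close> into a multiple of a coordinate
vector; then the matrix differs from the identity in a single column, and Cramer's rule applies.
\<close>
lemma det_mat_1_plus_outer:
  fixes w z :: "real ^ 'n"
  shows "det (mat 1 + outer w z) = 1 + w \<bullet> z"
proof (cases "z = 0")
  case True
  then have "outer w z = 0" by (simp add: vec_eq_iff)
  with True show ?thesis by (simp add: det_I)
next
  case False
  obtain k :: 'n where True by simp
  obtain R :: "real^'n^'n" where R: "orthogonal_matrix R" "R *v axis k 1 = z /\<^sub>R norm z"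
    using orthogonal_matrix_exists_basis[of "z /\<^sub>R norm z" k] False by auto
  have RR: "transpose R ** R = mat 1" "R ** transpose R = mat 1"
    using R(1) by (auto simp: orthogonal_matrix_def)
  define x where "x = transpose R *v w"
  have tz: "transpose R *v z = norm z *\<^sub>R axis k 1"
  proof -
    have "z = norm z *\<^sub>R (R *v axis k 1)" using R(2) False by simp
    then have "transpose R *v z = norm z *\<^sub>R ((transpose R ** R) *v axis k 1)"
      by (metis matrix_vector_mul_assoc matrix_vector_mult_scaleR)
    then show ?thesis by (simp add: RR)
  qed
  have "transpose R ** (mat 1 + outer w z) ** R = mat 1 + outer x (norm z *\<^sub>R axis k 1)"
    using tz by (simp add: matrix_add_ldistrib matrix_add_rdistrib RR matrix_mul_outer outer_matrix_mul x_def)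
  also have "\<dots> = (\<chi> i j. if j = k then (mat 1 *v (axis k 1 + norm z *\<^sub>R x)) $ i else mat 1 $ i $ j)"
    by (simp only: matrix_vector_mul_lid) (simp add: vec_eq_iff mat_def axis_def)
  finally have "det (transpose R ** (mat 1 + outer w z) ** R) = 1 + norm z * x $ k"
    by (simp add: cramer_lemma det_I)
  moreover have "det (transpose R ** (mat 1 + outer w z) ** R) = det (mat 1 + outer w z)"
    using arg_cong[OF RR(1), of det] by (simp add: det_mul det_I mult_ac)
  moreover have "norm z * x $ k = w \<bullet> z"
  proof -
    have "x $ k = x \<bullet> axis k 1" by (simp add: inner_axis)
    also have "\<dots> = w \<bullet> (R *v axis k 1)"
      unfolding x_def by (metis dot_lmul_matrix transpose_transpose vector_transpose_matrix)
    finally show ?thesis using R(2) False by simp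
  qed
  ultimately show ?thesis by simp
qed

text \<open>
Jacobi's formula at the identity: in the Leibniz expansion only the identity permutation contributes,
because every other permutation leaves at least one vanishing factor after differentiation.
\<close>
lemma has_real_derivative_det_at_mat_1:
  fixes C :: "real \<Rightarrow> real ^ 'n ^ 'n"
  assumes D: "\<And>i j. ((\<lambda>t. C t $ i $ j) has_real_derivative D $ i $ j) (at a)"
    and C: "C a = mat 1"
  shows "((\<lambda>t. det (C t)) has_real_derivative (\<Sum>i\<in>UNIV. D $ i $ i)) (at a)"
proof -
  let ?term = "\<lambda>p. of_int (sign p) * (\<Sum>i\<in>UNIV. D $ i $ p i * (\<Prod>j\<in>UNIV - {i}. C a $ j $ p j))"
  have "((\<lambda>t. det (C t)) has_real_derivative (\<Sum>p | p permutes UNIV. ?term p)) (at a)"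
    unfolding det_def
    by (intro DERIV_sum DERIV_cmult has_field_derivative_prod D) 
  also have "(\<Sum>p | p permutes (UNIV :: 'n set). ?term p) = (\<Sum>p\<in>{id}. ?term p)"
  proof (rule sum.mono_neutral_right)
    show "\<forall>p\<in>{p. p permutes UNIV} - {id}. ?term p = 0"
    proof
      fix p assume p: "p \<in> {p. p permutes (UNIV :: 'n set)} - {id}"
      have prod0: "(\<Prod>j\<in>UNIV - {i}. C a $ j $ p j) = 0" for i
      proof -
        \<comment> \<open>a permutation other than the identity moves at least two points\<close>
        have "\<exists>j. j \<noteq> i \<and> p j \<noteq> j"
        proof (rule ccontr)
          assume "\<not> ?thesis"
          then have fix_j: "p j = j" if "j \<noteq> i" for j using that by auto
          have "inj p" using p by (auto intro: permutes_inj)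
          then have "p i = i" using fix_j by (metis injD)
          with fix_j have "p = id" by (metis eq_id_iff)
          with p show False by simp
        qed
        then obtain j where "j \<in> UNIV - {i}" "p j \<noteq> j" by blast
        then show ?thesis by (intro prod_zero) (auto simp: C mat_def intro!: bexI[of _ j])
      qed
      show "?term p = 0" unfolding prod0 by simp
    qed
  qed (auto simp: permutes_id finite_permutations)
  also have "\<dots> = (\<Sum>i\<in>UNIV. D $ i $ i)"
    by (simp add: C mat_def)
  finally show ?thesis .
qed

text \<open>
On the segment from the identity to \<open>A\<close> all matrices are positive definite, hence invertible, so the
determinant keeps its sign.
\<close>
lemma det_pos_of_positive_definite:
  fixes A :: "real ^ 'n ^ 'n"
  assumes pd: "\<And>y. y \<noteq> 0 \<Longrightarrow> y \<bullet> (A *v y) > 0"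
  shows "det A > 0"
proof (rule ccontr)
  assume neg: "\<not> det A > 0"
  define G where "G = (\<lambda>t::real. (1 - t) *\<^sub>R mat 1 + t *\<^sub>R A)"
  have "continuous_on {0..1} (\<lambda>t. det (G t))"
    unfolding G_def det_def by (simp add: mat_def) (intro continuous_intros)
  moreover have "det (G 1) \<le> 0" "0 \<le> det (G 0)"
    using neg by (auto simp: G_def det_I)
  ultimately obtain t where t: "0 \<le> t" "t \<le> 1" "det (G t) = 0"
    using IVT2'[of "\<lambda>t. det (G t)" 1 0 0] by auto
  then obtain y where y: "y \<noteq> 0" "G t *v y = 0"
    by (metis invertible_det_nz invertible_left_inverse matrix_left_invertible_ker)
  have "y \<bullet> (G t *v y) = (1 - t) * (y \<bullet> y) + t * (y \<bullet> (A *v y))"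
    by (simp add: G_def matrix_vector_mult_add_rdistrib scaleR_matrix_vector_assoc[symmetric] inner_add_right)
  also have "\<dots> > 0"
  proof (cases "t = 0")
    case False
    then show ?thesis using t y pd[OF y(1)] by (intro add_nonneg_pos) auto
  qed (use y in auto)
  finally show False using y by simp
qed

definition moment0 :: "(real ^ 'n) set \<Rightarrow> real" where
  "moment0 K = (LINT x:K|lborel. 1)"

definition moment1 :: "(real ^ 'n) set \<Rightarrow> real ^ 'n" where
  "moment1 K = (\<chi> i. LINT x:K|lborel. x $ i)"

definition moment2 :: "(real ^ 'n) set \<Rightarrow> real ^ 'n ^ 'n" where
  "moment2 K = (\<chi> i j. LINT x:K|lborel. x $ i * x $ j)"

lemma convex_body_compact: "convex_body K \<Longrightarrow> compact K"
  by (simp add: convex_body_def)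

lemma convex_body_borel [measurable_dest]: "convex_body K \<Longrightarrow> K \<in> sets borel"
  by (simp add: convex_body_def borel_compact)

lemma convex_body_measure_pos:
  fixes K :: "'a::euclidean_space set"
  assumes "convex_body K"
  shows "measure lborel K > 0"
proof -
  obtain x e where "e > 0" "ball x e \<subseteq> K"
    using assms by (meson convex_body_def mem_interior ex_in_conv)
  have "emeasure lborel (ball x e) > 0"
    using \<open>e > 0\<close> by (simp add: emeasure_ball)
  then have "0 < measure lborel (ball x e)"
    using \<open>e > 0\<close> by (simp add: content_ball_pos)
  also have "\<dots> \<le> measure lborel K"
    using \<open>ball x e \<subseteq> K\<close> assms
    by (intro measure_mono_fmeasurable fmeasurable_compact) (auto simp: convex_body_def)
  finally show ?thesis .
qed

lemma moment0_eq_measure: "moment0 K = measure lborel K"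
  unfolding moment0_def by (simp add: set_lebesgue_integral_def)

lemma uniform_measure_lborel_eq:
  fixes K :: "'a::euclidean_space set"
  assumes "convex_body K"
  shows "uniform_measure lborel K = density lborel (\<lambda>x. ennreal (indicator K x / measure lborel K))"
proof -
  have fin: "emeasure lborel K = ennreal (measure lborel K)"
    using emeasure_compact_finite[of K] assms by (intro emeasure_eq_ennreal_measure) (auto simp: convex_body_def)
  show ?thesis
    unfolding uniform_measure_def fin
    using convex_body_measure_pos[OF assms]
    by (intro arg_cong2[where f=density] refl ext)
       (auto simp: indicator_def divide_ennreal simp flip: ennreal_1)
qed

lemma integral_uniform_measure_lborel:
  fixes K :: "'a::euclidean_space set" and f :: "'a \<Rightarrow> 'b::{banach, second_countable_topology}"
  assumes K: "convex_body K" and [measurable]: "f \<in> borel_measurable borel"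
  shows "(LINT x|uniform_measure lborel K. f x) = (LINT x:K|lborel. f x) /\<^sub>R measure lborel K"
proof -
  note [measurable] = convex_body_borel[OF K]
  have "(LINT x|uniform_measure lborel K. f x) = (LINT x|lborel. (indicator K x / measure lborel K) *\<^sub>R f x)"
    unfolding uniform_measure_lborel_eq[OF K] using convex_body_measure_pos[OF K]
    by (subst integral_density) auto
  also have "\<dots> = (LINT x|lborel. (1 / measure lborel K) *\<^sub>R (indicator K x *\<^sub>R f x))"
    by (intro Bochner_Integration.integral_cong) auto
  finally show ?thesis by (simp only: set_lebesgue_integral_def inverse_eq_divide integral_scaleR_right)
qed

lemma centroid_eq_moment1:
  fixes K :: "(real ^ 'n) set"
  assumes K: "convex_body K"
  shows "centroid K = moment1 K /\<^sub>R moment0 K"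
proof -
  note [measurable] = convex_body_borel[OF K]
  have int: "integrable lborel (\<lambda>x. indicator K x *\<^sub>R x)"
    by (rule borel_integrable_compact) (use K in \<open>auto simp: convex_body_def\<close>)
  have "(LINT x:K|lborel. x) $ i = (LINT x:K|lborel. x $ i)" for i
    unfolding set_lebesgue_integral_def
    using integral_bounded_linear[OF bounded_linear_vec_nth[of i] int] by simp
  then show ?thesis
    unfolding centroid_def
    by (subst integral_uniform_measure_lborel[OF K]) (auto simp: moment0_eq_measure moment1_def vec_eq_iff)
qed

lemma covariance_matrix_eq_moments:
  fixes K :: "(real ^ 'n) set"
  assumes K: "convex_body K"
  shows "covariance_matrix K = moment2 K /\<^sub>R moment0 K - outer (moment1 K /\<^sub>R moment0 K) (moment1 K /\<^sub>R moment0 K)"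
proof -
  have "(LINT x|uniform_measure lborel K. x $ i * x $ j) = (LINT x:K|lborel. x $ i * x $ j) /\<^sub>R measure lborel K" for i j
    by (rule integral_uniform_measure_lborel[OF K]) simp
  then show ?thesis
    unfolding covariance_matrix_def centroid_eq_moment1[OF K]
    by (simp add: vec_eq_iff moment2_def moment0_eq_measure)
qed

text \<open>
For convex bodies this is the \<open>2 n\<close>-th power of the isotropic constant, written in moments that are plain
integrals and can be differentiated along families of bodies.
\<close>
definition iso_ratio :: "(real ^ 'n) set \<Rightarrow> real" where
  "iso_ratio K = det (moment2 K /\<^sub>R moment0 K - outer (moment1 K /\<^sub>R moment0 K) (moment1 K /\<^sub>R moment0 K)) / (moment0 K)\<^sup>2"

lemma isotropic_constant_le_iff:
  fixes K P :: "(real ^ 'n) set"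
  assumes "convex_body K" "convex_body P"
  shows "isotropic_constant K \<le> isotropic_constant P \<longleftrightarrow> iso_ratio K \<le> iso_ratio P"
  using assms
  by (simp add: isotropic_constant_def iso_ratio_def covariance_matrix_eq_moments moment0_eq_measure)

lemma compact_set_integrable:
  fixes h :: "real ^ 'n \<Rightarrow> real"
  assumes "compact K" "continuous_on UNIV h"
  shows "set_integrable lborel K h"
  by (rule set_integrable_compact_continuous[OF assms(1) continuous_on_subset[OF assms(2)]]) auto

lemma set_integral_sum:
  fixes f :: "'b \<Rightarrow> 'a \<Rightarrow> real"
  assumes "\<And>i. i \<in> I \<Longrightarrow> set_integrable M A (f i)"
  shows "(LINT x:A|M. (\<Sum>i\<in>I. f i x)) = (\<Sum>i\<in>I. LINT x:A|M. f i x)"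
  using assms unfolding set_lebesgue_integral_def set_integrable_def
  by (simp add: scaleR_sum_right sum_distrib_left Bochner_Integration.integral_sum)

lemma moment1_inner:
  fixes K :: "(real ^ 'n) set"
  assumes "compact K"
  shows "y \<bullet> moment1 K = (LINT x:K|lborel. y \<bullet> x)"
  unfolding moment1_def inner_vec_def
  by (subst set_integral_sum) (auto intro!: compact_set_integrable assms continuous_intros)

lemma moment2_bilinear:
  fixes K :: "(real ^ 'n) set"
  assumes "compact K"
  shows "y \<bullet> (moment2 K *v z) = (LINT x:K|lborel. (y \<bullet> x) * (z \<bullet> x))"
proof -
  have *: "(y \<bullet> x) * (z \<bullet> x) = (\<Sum>i\<in>UNIV. \<Sum>j\<in>UNIV. (y $ i * z $ j) * (x $ i * x $ j))" for x
    by (simp add: inner_vec_def sum_product mult_ac)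
  have "(LINT x:K|lborel. (y \<bullet> x) * (z \<bullet> x)) = (\<Sum>i\<in>UNIV. \<Sum>j\<in>UNIV. (y $ i * z $ j) * moment2 K $ i $ j)"
    unfolding * 
    apply (subst set_integral_sum)
     apply (auto intro!: compact_set_integrable assms continuous_intros)
    apply (subst set_integral_sum)
     apply (auto intro!: compact_set_integrable assms continuous_intros simp: moment2_def)
    done
  then show ?thesis
    by (simp add: inner_vec_def matrix_vector_mult_def sum_distrib_left mult_ac)
qed

lemma set_integral_nonneg_zero_imp:
  fixes h :: "real ^ 'n \<Rightarrow> real"
  assumes K: "compact K" "continuous_on UNIV h" and "\<And>x. x \<in> K \<Longrightarrow> 0 \<le> h x"
    and "(LINT x:K|lborel. h x) \<le> 0" and "x \<in> interior K"
  shows "h x = 0"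
proof (rule ccontr)
  assume "h x \<noteq> 0"
  note int = compact_set_integrable[OF K]
  have nn: "0 \<le> indicator K x *\<^sub>R h x" for x using assms(3) by (auto simp: indicator_def)
  have "(LINT x|lborel. indicator K x *\<^sub>R h x) = 0"
    using assms(4) integral_nonneg_AE[of "\<lambda>x. indicator K x *\<^sub>R h x" lborel] nn
    by (simp add: set_lebesgue_integral_def)
  then have "AE x in lborel. indicator K x *\<^sub>R h x = 0"
    using int nn by (subst integral_nonneg_eq_0_iff_AE[symmetric]) (auto simp: set_integrable_def)
  then have "AE x\<in>interior K in lborel. h x = 0"
    by eventually_elim (use interior_subset in \<open>auto simp: indicator_def split: if_splits\<close>)
  then have "AE x\<in>interior K in lebesgue. x \<in> {x. h x = 0}"
    by (intro AE_completion) simp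
  moreover have "closed {x. h x = 0}"
    using K(2) by (intro closed_Collect_eq) auto
  ultimately have "x \<in> {x. h x = 0}"
    using assms(5) mem_closed_if_AE_lebesgue_open[OF open_interior[of K], of "{x. h x = 0}" x] by blast
  with \<open>h x \<noteq> 0\<close> show False by simp
qed

section \<open>Bodies cut out by linear inequalities\<close>

lemma hausdorff_dist_less:
  fixes A B :: "'a::metric_space set"
  assumes "A \<noteq> {}" "B \<noteq> {}" "d < e"
    and A: "\<And>x. x \<in> A \<Longrightarrow> \<exists>y\<in>B. dist x y \<le> d"
    and B: "\<And>y. y \<in> B \<Longrightarrow> \<exists>x\<in>A. dist x y \<le> d"
  shows "hausdorff_dist A B < e"
proof -
  have "(SUP x\<in>A. infdist x B) \<le> d"
    using A by (intro cSUP_least assms(1)) (meson infdist_le order_trans)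
  moreover have "(SUP y\<in>B. infdist y A) \<le> d"
    using B by (intro cSUP_least assms(2)) (metis infdist_le dist_commute order_trans)
  ultimately show ?thesis using \<open>d < e\<close> by (simp add: hausdorff_dist_def)
qed

lemma AE_lborel_not_on_hyperplane:
  fixes a :: "'a::euclidean_space"
  assumes "a \<noteq> 0"
  shows "AE x in lborel. a \<bullet> x \<noteq> c"
proof -
  have "{x. a \<bullet> x = c} \<in> null_sets lebesgue"
    using negligible_hyperplane[of a c] assms by (simp add: negligible_iff_null_sets)
  then have "{x. a \<bullet> x = c} \<in> null_sets lborel"
    by (subst (asm) null_sets_completion_iff) (auto simp: closed_hyperplane)
  from AE_not_in[OF this] show ?thesis by simp
qed

text \<open>
Differentiation under the integral sign at a single parameter value, for integrands that are
differentiable there almost everywhere and Lipschitz in the parameter.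
\<close>
lemma has_real_derivative_integral:
  fixes f :: "real \<Rightarrow> 'a \<Rightarrow> real"
  assumes "\<delta> > 0"
    and int: "\<And>t. \<bar>t\<bar> < \<delta> \<Longrightarrow> integrable M (f t)" and g: "integrable M g"
    and lip: "\<And>t x. \<bar>t\<bar> < \<delta> \<Longrightarrow> \<bar>f t x - f 0 x\<bar> \<le> \<bar>t\<bar> * g x"
    and D: "AE x in M. ((\<lambda>t. f t x) has_real_derivative D x) (at 0)"
    and [measurable]: "D \<in> borel_measurable M"
  shows "((\<lambda>t. LINT x|M. f t x) has_real_derivative (LINT x|M. D x)) (at 0)"
  unfolding DERIV_def
proof (subst tendsto_at_iff_sequentially, intro allI impI)
  fix X :: "nat \<Rightarrow> real" assume X: "\<forall>i. X i \<in> UNIV - {0}" "X \<longlonglongrightarrow> 0"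
  obtain n0 where n0: "\<And>n. n \<ge> n0 \<Longrightarrow> \<bar>X n\<bar> < \<delta>"
    using X(2) \<open>\<delta> > 0\<close> by (auto simp: lim_sequentially dist_real_def)
  define Y where "Y = (\<lambda>n. X (n + n0))"
  have Y: "Y n \<noteq> 0" "\<bar>Y n\<bar> < \<delta>" for n using X n0 by (auto simp: Y_def)
  have Y0: "Y \<longlonglongrightarrow> 0" unfolding Y_def using X(2) by (rule LIMSEQ_ignore_initial_segment)
  note [measurable] = borel_measurable_integrable[OF int[OF Y(2)]] borel_measurable_integrable[OF int[of 0]]
  have [simp]: "\<bar>0\<bar> < \<delta>" using \<open>\<delta> > 0\<close> by simp
  have lim: "(\<lambda>n. LINT x|M. (f (Y n) x - f 0 x) / Y n) \<longlonglongrightarrow> (LINT x|M. D x)"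
  proof (rule integral_dominated_convergence[where w=g])
    show "AE x in M. (\<lambda>n. (f (Y n) x - f 0 x) / Y n) \<longlonglongrightarrow> D x"
      using D
    proof eventually_elim
      case (elim x)
      then have "((\<lambda>h. (f h x - f 0 x) / h) \<longlongrightarrow> D x) (at 0)"
        by (simp add: DERIV_def)
      moreover have "filterlim Y (at 0) sequentially"
        using Y Y0 by (auto simp: filterlim_at)
      ultimately show ?case
        by (rule filterlim_compose)
    qed
    show "AE x in M. norm ((f (Y n) x - f 0 x) / Y n) \<le> g x" for n
      using lip[OF Y(2)[of n]] Y(1)[of n] by (auto simp: abs_divide divide_le_eq mult.commute)
  qed (use g \<open>\<delta> > 0\<close> in auto)
  have eq: "(LINT x|M. (f (Y n) x - f 0 x) / Y n) = ((LINT x|M. f (0 + Y n) x) - (LINT x|M. f 0 x)) / Y n" for n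
    using int[OF Y(2)[of n]] int[of 0] \<open>\<delta> > 0\<close> by (simp add: Bochner_Integration.integral_diff)
  from lim[unfolded eq] have "(\<lambda>n. ((LINT x|M. f (0 + X (n + n0)) x) - (LINT x|M. f 0 x)) / X (n + n0)) \<longlonglongrightarrow> (LINT x|M. D x)"
    unfolding Y_def .
  then show "((\<lambda>h. ((LINT x|M. f (0 + h) x) - (LINT x|M. f 0 x)) / h) \<circ> X) \<longlonglongrightarrow> (LINT x|M. D x)"
    unfolding o_def by (rule LIMSEQ_offset)
qed

text \<open>
The polar of the set of the vectors \<open>b i\<close>. For a finite set with bounded polar, \<open>max_functional I b\<close> is its
gauge.
\<close>
definition polar_body :: "'i set \<Rightarrow> ('i \<Rightarrow> 'a::euclidean_space) \<Rightarrow> 'a set" where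
  "polar_body I b = {x. \<forall>i\<in>I. b i \<bullet> x \<le> 1}"

definition max_functional :: "'i set \<Rightarrow> ('i \<Rightarrow> 'a::euclidean_space) \<Rightarrow> 'a \<Rightarrow> real" where
  "max_functional I b x = Max ((\<lambda>i. b i \<bullet> x) ` I)"

lemma max_functional_le_iff:
  "finite I \<Longrightarrow> I \<noteq> {} \<Longrightarrow> max_functional I b x \<le> c \<longleftrightarrow> (\<forall>i\<in>I. b i \<bullet> x \<le> c)"
  by (simp add: max_functional_def)

lemma max_functional_eqI:
  "finite I \<Longrightarrow> i \<in> I \<Longrightarrow> (\<And>j. j \<in> I \<Longrightarrow> b j \<bullet> x \<le> b i \<bullet> x) \<Longrightarrow> max_functional I b x = b i \<bullet> x"
  unfolding max_functional_def by (intro Max_eqI) auto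

lemma max_functional_attained:
  assumes "finite I" "I \<noteq> {}"
  obtains i where "i \<in> I" "max_functional I b x = b i \<bullet> x"
proof -
  have "max_functional I b x \<in> (\<lambda>i. b i \<bullet> x) ` I"
    unfolding max_functional_def using assms by (intro Max_in) auto
  then show ?thesis using that by auto
qed

lemma max_functional_scaleR:
  assumes "finite I" "I \<noteq> {}" "c \<ge> 0"
  shows "max_functional I b (c *\<^sub>R x) = c * max_functional I b x"
proof -
  obtain i where i: "i \<in> I" "max_functional I b x = b i \<bullet> x"
    using max_functional_attained[OF assms(1,2)] .
  have "max_functional I b (c *\<^sub>R x) = b i \<bullet> (c *\<^sub>R x)"
    using assms i max_functional_le_iff[OF assms(1,2), of b x "b i \<bullet> x"]
    by (intro max_functional_eqI) (auto intro: mult_left_mono)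
  then show ?thesis using i by simp
qed

lemma max_functional_diff_le:
  assumes I: "finite I" "I \<noteq> {}" and d: "\<And>i. i \<in> I \<Longrightarrow> \<bar>b i \<bullet> x - c i \<bullet> x\<bar> \<le> e"
  shows "\<bar>max_functional I b x - max_functional I c x\<bar> \<le> e"
proof -
  have *: "max_functional I b x \<le> max_functional I c x + e" if "\<And>i. i \<in> I \<Longrightarrow> \<bar>b i \<bullet> x - c i \<bullet> x\<bar> \<le> e" for b c
  proof -
    have "c i \<bullet> x \<le> max_functional I c x" if "i \<in> I" for i
      using max_functional_le_iff[OF I] that by blast
    with that show ?thesis
      by (subst max_functional_le_iff[OF I]) (smt (verit))
  qed
  from *[of b c] *[of c b] d show ?thesis by (smt (verit))
qed

lemma continuous_max_functional:
  assumes "finite I" "I \<noteq> {}"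
  shows "continuous_on UNIV (max_functional I b)"
proof -
  have "continuous_on UNIV (\<lambda>x. Max ((\<lambda>i. b i \<bullet> x) ` J))" if "finite J" "J \<noteq> {}" for J
    using that
  proof (induction J rule: finite_ne_induct)
    case (insert j J)
    then show ?case by (auto intro!: continuous_intros)
  qed (auto intro!: continuous_intros)
  from this[OF assms] show ?thesis unfolding max_functional_def .
qed

lemma polar_body_eq: "finite I \<Longrightarrow> I \<noteq> {} \<Longrightarrow> polar_body I b = {x. max_functional I b x \<le> 1}"
  by (simp add: polar_body_def max_functional_le_iff)

lemma closed_polar_body: "closed (polar_body I b)"
proof -
  have "polar_body I b = (\<Inter>i\<in>I. {x. b i \<bullet> x \<le> 1})" by (auto simp: polar_body_def)
  then show ?thesis by (auto intro: closed_halfspace_le)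
qed

lemma convex_polar_body: "convex (polar_body I b)"
proof -
  have "polar_body I b = (\<Inter>i\<in>I. {x. b i \<bullet> x \<le> 1})" by (auto simp: polar_body_def)
  then show ?thesis by (auto intro!: convex_INT convex_halfspace_le)
qed

text \<open>
A point at which all the functionals are nonpositive would span a ray inside the body; so boundedness
makes the maximum positive away from the origin, and rescaling to level one gives the first bound.
\<close>
lemma bounded_by_max_functional:
  assumes I: "finite I" "I \<noteq> {}" and R: "polar_body I b \<subseteq> cball 0 R"
  shows "norm x \<le> R * max_functional I b x" and "0 \<le> max_functional I b x"
proof -
  have pos: "max_functional I b x > 0" if "x \<noteq> 0"
  proof (rule ccontr)
    assume "\<not> ?thesis"
    then have "b i \<bullet> x \<le> 0" if "i \<in> I" for i
      using max_functional_le_iff[OF I, of b x 0] that by auto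
    then have "c *\<^sub>R x \<in> polar_body I b" if "c \<ge> 0" for c
      using that mult_nonneg_nonpos[OF that] by (force simp: polar_body_def)
    then have "c * norm x \<le> R" if "c \<ge> 0" for c using R that by fastforce
    from this[of "(\<bar>R\<bar> + 1) / norm x"] show False using \<open>x \<noteq> 0\<close> by simp
  qed
  have zero: "max_functional I b 0 = 0"
    using max_functional_scaleR[OF I, of 0 b 0] by simp
  show "0 \<le> max_functional I b x" using pos zero by (cases "x = 0") (auto intro: less_imp_le)
  show "norm x \<le> R * max_functional I b x"
  proof (cases "x = 0")
    case False
    let ?N = "max_functional I b x"
    have "inverse ?N *\<^sub>R x \<in> polar_body I b"
      using pos[OF False] by (simp add: polar_body_eq[OF I] max_functional_scaleR[OF I])
    then have "norm (inverse ?N *\<^sub>R x) \<le> R" using R by (auto simp del: norm_scaleR)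
    then show ?thesis using pos[OF False] by (simp add: field_simps)
  qed (simp add: zero)
qed

text \<open>
The layers of the gauge are dilates of the body, so integrals of homogeneous functions over the body can
be expressed with the weight \<open>(1 - gauge)\<^sub>+\<close>. Unlike the indicator function, this weight is
Lipschitz in the vectors \<open>b i\<close>, so the integral can be differentiated in them.
\<close>
lemma set_integral_polar_body_homogeneous:
  fixes h :: "'a::euclidean_space \<Rightarrow> real"
  assumes I: "finite I" "I \<noteq> {}" and R: "polar_body I b \<subseteq> cball 0 R"
    and h: "continuous_on UNIV h" and hom: "\<And>c x. c > 0 \<Longrightarrow> h (c *\<^sub>R x) = c ^ k * h x"
  shows "(LINT x:polar_body I b|lborel. h x) =
    real (DIM('a) + k + 1) * (LINT x|lborel. h x * max 0 (1 - max_functional I b x))"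
proof -
  let ?Q = "polar_body I b" and ?N = "max_functional I b"
  have [measurable]: "h \<in> borel_measurable borel" "?N \<in> borel_measurable borel"
    using h continuous_max_functional[OF I] by (auto intro: borel_measurable_continuous_onI)
  have [measurable]: "?Q \<in> sets borel" by (simp add: closed_polar_body)
  have cpt: "compact ?Q"
    using R closed_polar_body by (auto simp: compact_eq_bounded_closed intro: bounded_subset[OF bounded_cball])
  have "(LINT x:?Q|lborel. h x * (1 - ?N x ^ 1)) = real 1 / real (1 + (DIM('a) + k)) * (LINT x:?Q|lborel. h x)"
  proof (rule layer_integral)
    show "set_integrable lborel ?Q h"
      by (rule set_integrable_compact_continuous[OF cpt continuous_on_subset[OF h]]) auto
    fix l :: real assume l: "0 < l" "l < 1"
    have "(LINT x:?Q \<inter> {x. ?N x \<le> l}|lborel. h x) = l ^ DIM('a) * (LINT x:?Q|lborel. h (l *\<^sub>R x))"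
      using l bounded_by_max_functional(2)[OF I R]
      by (intro set_integral_scaleR_image)
         (auto simp: polar_body_eq[OF I] max_functional_scaleR[OF I] intro: mult_le_one)
    also have "\<dots> = l ^ (DIM('a) + k) * (LINT x:?Q|lborel. h x)"
      using l by (simp add: hom power_add mult.assoc)
    finally show "(LINT x:?Q \<inter> {x. ?N x \<le> l}|lborel. h x) = l ^ (DIM('a) + k) * (LINT x:?Q|lborel. h x)" .
  qed (use bounded_by_max_functional(2)[OF I R] in \<open>auto simp: polar_body_eq[OF I]\<close>)
  moreover have "(LINT x:?Q|lborel. h x * (1 - ?N x ^ 1)) = (LINT x|lborel. h x * max 0 (1 - ?N x))"
    unfolding set_lebesgue_integral_def
    by (intro Bochner_Integration.integral_cong) (auto simp: polar_body_eq[OF I] indicator_def max_def)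
  ultimately show ?thesis by (simp add: field_simps)
qed

section \<open>Tilting one inequality\<close>

text \<open>
Moves the \<open>i0\<close>-th bounding hyperplane. The parameter \<open>\<phi>\<close> is an arbitrary vector, so the hyperplane may be rotated
and shifted at the same time.
\<close>
definition tilt :: "('i \<Rightarrow> 'a::real_vector) \<Rightarrow> 'i \<Rightarrow> 'a \<Rightarrow> real \<Rightarrow> 'i \<Rightarrow> 'a" where
  "tilt b i0 \<phi> t i = b i + (if i = i0 then t *\<^sub>R \<phi> else 0)"

lemma tilt_0 [simp]: "tilt b i0 \<phi> 0 = b"
  by (auto simp: tilt_def fun_eq_iff)

text \<open>
The part of the body on which the \<open>i0\<close>-th functional is the gauge. For the normals of a polytope this is
the convex hull of the origin and the \<open>i0\<close>-th facet (\<open>cone_over_eq\<close>).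
\<close>
definition facet_cone :: "'i set \<Rightarrow> ('i \<Rightarrow> 'a::euclidean_space) \<Rightarrow> 'i \<Rightarrow> 'a set" where
  "facet_cone I b i0 = {x \<in> polar_body I b. \<forall>i\<in>I. b i \<bullet> x \<le> b i0 \<bullet> x}"

lemma facet_cone_closed: "closed (facet_cone I b i0)"
proof -
  have "facet_cone I b i0 = polar_body I b \<inter> (\<Inter>i\<in>I. {x. (b i - b i0) \<bullet> x \<le> 0})"
    by (auto simp: facet_cone_def inner_diff_left)
  then show ?thesis by (auto intro!: closed_Int closed_polar_body closed_INT closed_halfspace_le)
qed

context
  fixes I :: "'i set" and b :: "'i \<Rightarrow> 'a::euclidean_space" and R :: real
  assumes I: "finite I" "I \<noteq> {}" and R: "polar_body I b \<subseteq> cball 0 R"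
begin

lemma polar_body_radius_nonneg: "0 \<le> R"
proof -
  have "0 \<in> polar_body I b" by (simp add: polar_body_def)
  then show ?thesis using R by force
qed

lemma max_functional_tilt_diff:
  "\<bar>max_functional I (tilt b i0 \<phi> t) x - max_functional I b x\<bar> \<le> \<bar>t\<bar> * norm \<phi> * norm x"
proof (rule max_functional_diff_le[OF I])
  fix i
  have "\<bar>\<phi> \<bullet> x\<bar> \<le> norm \<phi> * norm x" by (rule Cauchy_Schwarz_ineq2)
  then have "\<bar>t\<bar> * \<bar>\<phi> \<bullet> x\<bar> \<le> \<bar>t\<bar> * (norm \<phi> * norm x)" by (rule mult_left_mono) simp
  then show "\<bar>tilt b i0 \<phi> t i \<bullet> x - b i \<bullet> x\<bar> \<le> \<bar>t\<bar> * norm \<phi> * norm x"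
    by (auto simp: tilt_def inner_add_left abs_mult mult.assoc)
qed

lemma tilt_gauge_bound:
  "\<bar>max_functional I (tilt b i0 \<phi> t) x - max_functional I b x\<bar> \<le> (\<bar>t\<bar> * norm \<phi> * R) * max_functional I b x"
proof -
  have "\<bar>t\<bar> * norm \<phi> * norm x \<le> \<bar>t\<bar> * norm \<phi> * (R * max_functional I b x)"
    using bounded_by_max_functional(1)[OF I R] by (intro mult_left_mono) auto
  then show ?thesis using max_functional_tilt_diff[of i0 \<phi> t x] by (simp add: mult_ac)
qed

lemma tilt_polar_body_norm_le:
  assumes "\<bar>t\<bar> * norm \<phi> * R \<le> 1/2" and x: "x \<in> polar_body I (tilt b i0 \<phi> t)"
  shows "norm x \<le> 2 * R"
proof -
  let ?N = "max_functional I b x"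
  have N0: "0 \<le> ?N" by (rule bounded_by_max_functional(2)[OF I R])
  have "(\<bar>t\<bar> * norm \<phi> * R) * ?N \<le> 1/2 * ?N" by (rule mult_right_mono[OF assms(1) N0])
  then have "?N \<le> 2"
    using tilt_gauge_bound[of i0 \<phi> t x] x by (auto simp: polar_body_eq[OF I])
  then have "R * ?N \<le> R * 2" using polar_body_radius_nonneg by (rule mult_left_mono)
  then show ?thesis using bounded_by_max_functional(1)[OF I R, of x] by simp
qed

text \<open>
Both bodies contain the copy of the other one that is shrunk by the factor \<open>1 - \<bar>t\<bar> norm \<phi> R\<close>.
\<close>
lemma tilt_polar_body_close:
  assumes e: "\<bar>t\<bar> * norm \<phi> * R \<le> 1/2"
  shows "x \<in> polar_body I (tilt b i0 \<phi> t) \<Longrightarrow>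
      \<exists>y\<in>polar_body I b. dist x y \<le> \<bar>t\<bar> * norm \<phi> * R * (2 * R)"
    and "y \<in> polar_body I b \<Longrightarrow>
      \<exists>x\<in>polar_body I (tilt b i0 \<phi> t). dist x y \<le> \<bar>t\<bar> * norm \<phi> * R * (2 * R)"
proof -
  define \<eta> where "\<eta> = \<bar>t\<bar> * norm \<phi> * R"
  have \<eta>: "0 \<le> \<eta>" "\<eta> \<le> 1/2" using e polar_body_radius_nonneg by (auto simp: \<eta>_def)
  let ?N = "max_functional I b" and ?Nt = "max_functional I (tilt b i0 \<phi> t)"
  note N0 = bounded_by_max_functional(2)[OF I R]
  note bound = tilt_gauge_bound[of i0 \<phi> t, folded \<eta>_def]
  show "\<exists>y\<in>polar_body I b. dist x y \<le> \<bar>t\<bar> * norm \<phi> * R * (2 * R)" if x: "x \<in> polar_body I (tilt b i0 \<phi> t)"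
  proof
    have "?Nt x \<le> 1" using x by (simp add: polar_body_eq[OF I])
    then have "?N x - \<eta> * ?N x \<le> 1" using bound[of x] by (simp add: abs_le_iff)
    then have "(1 - \<eta>) * ?N x \<le> 1" by (simp add: algebra_simps)
    then show "(1 - \<eta>) *\<^sub>R x \<in> polar_body I b"
      using \<eta> by (simp add: polar_body_eq[OF I] max_functional_scaleR[OF I])
    have "dist x ((1 - \<eta>) *\<^sub>R x) = \<eta> * norm x"
      using \<eta> by (simp add: dist_norm algebra_simps)
    also have "\<dots> \<le> \<eta> * (2 * R)"
      using \<eta> tilt_polar_body_norm_le[OF e x] by (intro mult_left_mono) auto
    finally show "dist x ((1 - \<eta>) *\<^sub>R x) \<le> \<bar>t\<bar> * norm \<phi> * R * (2 * R)" by (simp add: \<eta>_def)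
  qed
  show "\<exists>x\<in>polar_body I (tilt b i0 \<phi> t). dist x y \<le> \<bar>t\<bar> * norm \<phi> * R * (2 * R)" if y: "y \<in> polar_body I b"
  proof
    have Ny: "?N y \<le> 1" using y by (simp add: polar_body_eq[OF I])
    then have "\<eta> * ?N y \<le> \<eta> * 1" using \<eta> by (intro mult_left_mono) auto
    with bound[of y] Ny have *: "?Nt y \<le> 1 + \<eta>" by (simp add: abs_le_iff)
    have "(1 - \<eta>) * ?Nt y \<le> (1 - \<eta>) * (1 + \<eta>)" using * \<eta> by (intro mult_left_mono) auto
    also have "\<dots> \<le> 1" by (simp add: algebra_simps)
    finally show "(1 - \<eta>) *\<^sub>R y \<in> polar_body I (tilt b i0 \<phi> t)"
      using \<eta> by (simp add: polar_body_eq[OF I] max_functional_scaleR[OF I])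
    have "dist ((1 - \<eta>) *\<^sub>R y) y = \<eta> * norm y"
      using \<eta> by (simp add: dist_norm algebra_simps)
    also have "\<dots> \<le> \<eta> * (2 * R)"
      using \<eta> R y polar_body_radius_nonneg by (intro mult_left_mono) force+
    finally show "dist ((1 - \<eta>) *\<^sub>R y) y \<le> \<bar>t\<bar> * norm \<phi> * R * (2 * R)" by (simp add: \<eta>_def)
  qed
qed

text \<open>
At a point where one functional \<open>i1\<close> is strictly largest, the maximum follows that functional for small \<open>t\<close>,
so it moves exactly when \<open>i1 = i0\<close>, that is, when the point lies over the tilted facet.
\<close>
lemma has_real_derivative_max_functional_tilt:
  assumes i1: "i1 \<in> I" and strict: "\<And>i. i \<in> I \<Longrightarrow> i \<noteq> i1 \<Longrightarrow> b i \<bullet> x < b i1 \<bullet> x"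
    and ne1: "b i1 \<bullet> x \<noteq> 1" and i0: "i0 \<in> I"
    and sep: "\<And>i. i \<in> I \<Longrightarrow> i \<noteq> i0 \<Longrightarrow> b i \<bullet> x \<noteq> b i0 \<bullet> x"
  shows "((\<lambda>t. max 0 (1 - max_functional I (tilt b i0 \<phi> t) x)) has_real_derivative
    - indicator (facet_cone I b i0) x * (\<phi> \<bullet> x)) (at 0)"
proof -
  define c where "c = (if i1 = i0 then \<phi> \<bullet> x else 0)"
  have tilt_c: "tilt b i0 \<phi> t i1 \<bullet> x = b i1 \<bullet> x + t * c" for t
    by (simp add: tilt_def c_def inner_add_left)
  have lim: "((\<lambda>t. tilt b i0 \<phi> t i \<bullet> x) \<longlongrightarrow> b i \<bullet> x) (at 0)" for i
  proof -
    have "((\<lambda>t. tilt b i0 \<phi> t i \<bullet> x) \<longlongrightarrow> tilt b i0 \<phi> 0 i \<bullet> x) (at 0)"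
      unfolding tilt_def by (intro tendsto_intros) (auto intro!: tendsto_eq_intros)
    then show ?thesis by simp
  qed
  have "\<forall>\<^sub>F t in at 0. \<forall>i\<in>I. i \<noteq> i1 \<longrightarrow> tilt b i0 \<phi> t i \<bullet> x < tilt b i0 \<phi> t i1 \<bullet> x"
  proof (subst eventually_ball_finite_distrib[OF I(1)], intro ballI)
    fix i assume "i \<in> I"
    show "\<forall>\<^sub>F t in at 0. i \<noteq> i1 \<longrightarrow> tilt b i0 \<phi> t i \<bullet> x < tilt b i0 \<phi> t i1 \<bullet> x"
    proof (cases "i = i1")
      case False
      have "((\<lambda>t. tilt b i0 \<phi> t i1 \<bullet> x - tilt b i0 \<phi> t i \<bullet> x) \<longlongrightarrow> b i1 \<bullet> x - b i \<bullet> x) (at 0)"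
        by (intro tendsto_diff lim)
      then have "\<forall>\<^sub>F t in at 0. 0 < tilt b i0 \<phi> t i1 \<bullet> x - tilt b i0 \<phi> t i \<bullet> x"
        by (rule order_tendstoD) (use strict[OF \<open>i \<in> I\<close> False] in simp)
      then show ?thesis by eventually_elim simp
    qed simp
  qed
  then have ev: "\<forall>\<^sub>F t in at 0. max_functional I (tilt b i0 \<phi> t) x = b i1 \<bullet> x + t * c"
  proof eventually_elim
    case (elim t)
    then have "max_functional I (tilt b i0 \<phi> t) x = tilt b i0 \<phi> t i1 \<bullet> x"
      using i1 by (intro max_functional_eqI[OF I(1)]) force+
    then show ?case by (simp add: tilt_c)
  qed
  have at0: "max_functional I b x = b i1 \<bullet> x"
    using i1 strict by (intro max_functional_eqI[OF I(1)]) force+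
  have cone: "x \<in> facet_cone I b i0 \<longleftrightarrow> b i1 \<bullet> x \<le> 1 \<and> i1 = i0"
  proof (cases "i1 = i0")
    case True
    then show ?thesis using strict at0 i0
      by (auto simp: facet_cone_def polar_body_eq[OF I] less_imp_le)
         (metis less_imp_le order_refl strict)
  next
    case False
    then show ?thesis using strict[of i0] i0 i1 by (force simp: facet_cone_def)
  qed
  have limc: "((\<lambda>t. b i1 \<bullet> x + t * c) \<longlongrightarrow> b i1 \<bullet> x) (at 0)"
    by (auto intro!: tendsto_eq_intros)
  have nhds: "(\<forall>\<^sub>F t in nhds 0. Q t) \<longleftrightarrow> (\<forall>\<^sub>F t in at 0. Q t) \<and> Q 0" for Q :: "real \<Rightarrow> bool"
    by (simp add: eventually_nhds_conv_at)
  show ?thesis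
  proof (cases "b i1 \<bullet> x < 1")
    case True
    have "\<forall>\<^sub>F t in at 0. b i1 \<bullet> x + t * c < 1" using limc True by (rule order_tendstoD)
    with ev have "\<forall>\<^sub>F t in at 0. max 0 (1 - max_functional I (tilt b i0 \<phi> t) x) = 1 - b i1 \<bullet> x - t * c"
      by eventually_elim simp
    then have E: "\<forall>\<^sub>F t in nhds 0. max 0 (1 - max_functional I (tilt b i0 \<phi> t) x) = 1 - b i1 \<bullet> x - t * c"
      unfolding nhds using at0 True by simp
    have "((\<lambda>t. 1 - b i1 \<bullet> x - t * c) has_real_derivative - c) (at 0)"
      by (auto intro!: derivative_eq_intros)
    also have "- c = - indicator (facet_cone I b i0) x * (\<phi> \<bullet> x)"
      using True cone by (auto simp: c_def indicator_def)
    finally show ?thesis by (subst DERIV_cong_ev[OF refl E refl])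
  next
    case False
    then have gt: "1 < b i1 \<bullet> x" using ne1 by simp
    have "\<forall>\<^sub>F t in at 0. 1 < b i1 \<bullet> x + t * c" using limc gt by (rule order_tendstoD)
    with ev have "\<forall>\<^sub>F t in at 0. max 0 (1 - max_functional I (tilt b i0 \<phi> t) x) = 0"
      by eventually_elim simp
    then have E: "\<forall>\<^sub>F t in nhds 0. max 0 (1 - max_functional I (tilt b i0 \<phi> t) x) = 0"
      unfolding nhds using at0 gt by simp
    have "((\<lambda>t. 0) has_real_derivative - indicator (facet_cone I b i0) x * (\<phi> \<bullet> x)) (at (0::real))"
      using gt cone by (auto simp: indicator_def)
    then show ?thesis by (subst DERIV_cong_ev[OF refl E refl])
  qed
qed

text \<open>
The derivative is an integral over the solid cone of the tilted facet rather than over the facet itself;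
for homogeneous integrands the two carry the same information.
\<close>
lemma has_real_derivative_tilt_integral:
  fixes h :: "'a \<Rightarrow> real"
  assumes inj: "inj_on b I" and nz: "\<And>i. i \<in> I \<Longrightarrow> b i \<noteq> 0" and i0: "i0 \<in> I"
    and h: "continuous_on UNIV h" and hom: "\<And>c x. c > 0 \<Longrightarrow> h (c *\<^sub>R x) = c ^ k * h x"
  shows "((\<lambda>t. LINT x:polar_body I (tilt b i0 \<phi> t)|lborel. h x) has_real_derivative
    - real (DIM('a) + k + 1) * (LINT x:facet_cone I b i0|lborel. h x * (\<phi> \<bullet> x))) (at 0)"
proof -
  let ?f = "\<lambda>t x. h x * max 0 (1 - max_functional I (tilt b i0 \<phi> t) x)"
  let ?D = "\<lambda>x. - indicator (facet_cone I b i0) x * (h x * (\<phi> \<bullet> x))"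
  \<comment> \<open>small enough for all tilted bodies to stay in the ball of radius \<open>2 * R\<close>\<close>
  define \<delta> where "\<delta> = inverse (2 * (norm \<phi> * R + 1))"
  have pos: "0 < norm \<phi> * R + 1" using polar_body_radius_nonneg by (simp add: add_nonneg_pos)
  then have "\<delta> > 0" by (simp add: \<delta>_def)
  have small: "\<bar>t\<bar> * norm \<phi> * R \<le> 1/2" if "\<bar>t\<bar> < \<delta>" for t
  proof -
    have "\<bar>t\<bar> * (norm \<phi> * R) \<le> \<bar>t\<bar> * (norm \<phi> * R + 1)" by (intro mult_left_mono) auto
    also have "\<dots> \<le> \<delta> * (norm \<phi> * R + 1)" using that pos by (intro mult_right_mono) auto
    also have "\<dots> = 1/2" using pos by (simp add: \<delta>_def divide_simps)
    finally show ?thesis by (simp add: mult.assoc)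
  qed
  have [measurable]: "h \<in> borel_measurable borel"
    using h by (rule borel_measurable_continuous_onI)
  have cont: "continuous_on UNIV (max_functional I (tilt b i0 \<phi> t))" for t
    by (rule continuous_max_functional[OF I])
  have f_eq: "?f t x = indicator (cball 0 (2 * R)) x *\<^sub>R ?f t x" if "\<bar>t\<bar> < \<delta>" for t x
  proof (cases "x \<in> polar_body I (tilt b i0 \<phi> t)")
    case True
    then have "x \<in> cball 0 (2 * R)" using tilt_polar_body_norm_le[OF small[OF that]] by simp
    then show ?thesis by simp
  qed (auto simp: polar_body_eq[OF I] max_def)
  have fint: "integrable lborel (?f t)" if "\<bar>t\<bar> < \<delta>" for t
  proof -
    have "integrable lborel (\<lambda>x. indicator (cball 0 (2 * R)) x *\<^sub>R ?f t x)"
      by (rule borel_integrable_compact)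
         (auto intro!: continuous_intros continuous_on_subset[OF h] continuous_on_subset[OF cont])
    then show ?thesis by (simp only: f_eq[OF that, symmetric])
  qed
  define g where "g = (\<lambda>x. indicator (cball 0 (2 * R)) x *\<^sub>R (\<bar>h x\<bar> * (norm \<phi> * norm x)))"
  have "((\<lambda>t. LINT x|lborel. ?f t x) has_real_derivative (LINT x|lborel. ?D x)) (at 0)"
  proof (rule has_real_derivative_integral[OF \<open>\<delta> > 0\<close> fint])
    show "integrable lborel g"
      unfolding g_def by (rule borel_integrable_compact)
         (auto intro!: continuous_intros continuous_on_subset[OF h])
    show "\<bar>?f t x - ?f 0 x\<bar> \<le> \<bar>t\<bar> * g x" if t: "\<bar>t\<bar> < \<delta>" for t x
    proof -
      have "\<bar>?f t x - ?f 0 x\<bar> = indicator (cball 0 (2 * R)) x *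
          (\<bar>h x\<bar> * \<bar>max 0 (1 - max_functional I (tilt b i0 \<phi> t) x) - max 0 (1 - max_functional I b x)\<bar>)"
        using f_eq[OF t, of x] f_eq[of 0 x] \<open>\<delta> > 0\<close>
        by (auto simp: indicator_def abs_mult simp flip: right_diff_distrib)
      also have "\<dots> \<le> indicator (cball 0 (2 * R)) x * (\<bar>h x\<bar> * (\<bar>t\<bar> * norm \<phi> * norm x))"
        using max_functional_tilt_diff[of i0 \<phi> t x]
        by (intro mult_left_mono) (auto simp: max_def)
      finally show ?thesis by (simp add: g_def mult_ac)
    qed
    have distinct: "AE x in lborel. \<forall>i\<in>I. \<forall>j\<in>I. i \<noteq> j \<longrightarrow> b i \<bullet> x \<noteq> b j \<bullet> x"
    proof (intro AE_finite_allI I(1))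
      fix i j assume "i \<in> I" "j \<in> I"
      show "AE x in lborel. i \<noteq> j \<longrightarrow> b i \<bullet> x \<noteq> b j \<bullet> x"
      proof (cases "i = j")
        case False
        then have "b i - b j \<noteq> 0" using inj \<open>i \<in> I\<close> \<open>j \<in> I\<close> by (auto dest: inj_onD)
        from AE_lborel_not_on_hyperplane[OF this, of 0] show ?thesis
          by eventually_elim (simp add: inner_diff_left)
      qed simp
    qed
    have "AE x in lborel. \<forall>i\<in>I. b i \<bullet> x \<noteq> 1"
      by (intro AE_finite_allI I(1) AE_lborel_not_on_hyperplane nz)
    with distinct show "AE x in lborel. ((\<lambda>t. ?f t x) has_real_derivative ?D x) (at 0)"
    proof eventually_elim
      case (elim x)
      obtain i1 where i1: "i1 \<in> I" "max_functional I b x = b i1 \<bullet> x"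
        using max_functional_attained[OF I] .
      have "b i \<bullet> x \<le> b i1 \<bullet> x" if "i \<in> I" for i
        using max_functional_le_iff[OF I, of b x "b i1 \<bullet> x"] i1 that by simp
      then have strict: "b i \<bullet> x < b i1 \<bullet> x" if "i \<in> I" "i \<noteq> i1" for i
        using that elim i1 by force
      have "((\<lambda>t. h x * max 0 (1 - max_functional I (tilt b i0 \<phi> t) x)) has_real_derivative
          h x * (- indicator (facet_cone I b i0) x * (\<phi> \<bullet> x))) (at 0)"
        by (intro DERIV_cmult has_real_derivative_max_functional_tilt[OF i1(1) strict])
           (use elim i1 i0 in auto)
      then show ?case by (simp add: mult_ac)
    qed
    show "?D \<in> borel_measurable lborel"
      using facet_cone_closed[of I b i0] by (auto intro!: borel_measurable_times borel_measurable_uminus borel_measurable_indicator)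
  qed
  then have "((\<lambda>t. real (DIM('a) + k + 1) * (LINT x|lborel. ?f t x)) has_real_derivative
      real (DIM('a) + k + 1) * (LINT x|lborel. ?D x)) (at 0)"
    by (rule DERIV_cmult)
  moreover have "\<forall>\<^sub>F t in nhds 0. (LINT x:polar_body I (tilt b i0 \<phi> t)|lborel. h x) =
      real (DIM('a) + k + 1) * (LINT x|lborel. ?f t x)"
  proof (rule eventually_nhds_metric[THEN iffD2], intro exI conjI allI impI)
    show "0 < \<delta>" by fact
    fix t :: real assume "dist t 0 < \<delta>"
    then have t: "\<bar>t\<bar> < \<delta>" by simp
    show "(LINT x:polar_body I (tilt b i0 \<phi> t)|lborel. h x) = real (DIM('a) + k + 1) * (LINT x|lborel. ?f t x)"
      by (rule set_integral_polar_body_homogeneous[OF I _ h hom])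
       (use tilt_polar_body_norm_le[OF small[OF t]] in auto)
  qed
  ultimately have "((\<lambda>t. LINT x:polar_body I (tilt b i0 \<phi> t)|lborel. h x) has_real_derivative
      real (DIM('a) + k + 1) * (LINT x|lborel. ?D x)) (at 0)"
    by (subst DERIV_cong_ev[OF refl _ refl])
  moreover have "(LINT x|lborel. ?D x) = - (LINT x:facet_cone I b i0|lborel. h x * (\<phi> \<bullet> x))"
    by (simp add: set_lebesgue_integral_def)
  ultimately show ?thesis by (simp only: mult_minus_left mult_minus_right)
qed

end

section \<open>The first-order condition at a centred maximizer\<close>

lemma zero_in_interior_polar_body:
  assumes "finite I"
  shows "0 \<in> interior (polar_body I b)"
proof (rule interiorI)
  show "open (\<Inter>i\<in>I. {x. b i \<bullet> x < 1})"
    using assms by (intro open_INT) (auto intro: open_halfspace_lt)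
qed (auto simp: polar_body_def intro: less_imp_le)

locale origin_polytope =
  fixes P :: "(real ^ 'n) set"
  assumes poly: "polytope P" and zero_int: "0 \<in> interior P"
begin

definition facets :: "(real ^ 'n) set set" where
  "facets = {F. F facet_of P}"

text \<open>
The outer normal of a facet, scaled such that the facet lies at level one. This is possible because the
origin is an interior point.
\<close>
definition normal :: "(real ^ 'n) set \<Rightarrow> real ^ 'n" where
  "normal F = (SOME a. P \<subseteq> {x. a \<bullet> x \<le> 1} \<and> F = P \<inter> {x. a \<bullet> x = 1})"

definition cone_over :: "(real ^ 'n) set \<Rightarrow> (real ^ 'n) set" where
  "cone_over F = facet_cone facets normal F"

lemma compact: "compact P" using poly by (rule polytope_imp_compact)
lemma convex: "convex P" using poly by (rule polytope_imp_convex)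
lemma zero_mem: "0 \<in> P" using zero_int interior_subset by blast

lemma convex_body: "convex_body P"
  using compact convex zero_int by (auto simp: convex_body_def)

lemma aff_dim_P: "aff_dim P = int CARD('n)"
  using zero_int by (subst aff_dim_nonempty_interior) auto

lemma finite_facets: "finite facets"
  unfolding facets_def using poly by (rule finite_polytope_facets)

lemma facets_nonempty: "facets \<noteq> {}"
  using polytope_facet_exists[OF poly] aff_dim_P by (auto simp: facets_def)

lemma normal:
  assumes "F \<in> facets"
  shows "P \<subseteq> {x. normal F \<bullet> x \<le> 1} \<and> F = P \<inter> {x. normal F \<bullet> x = 1}"
proof -
  obtain a c where ac: "a \<noteq> 0" "P \<subseteq> {x. a \<bullet> x \<le> c}" "F = P \<inter> {x. a \<bullet> x = c}"
    using facet_of_polyhedron[OF polytope_imp_polyhedron[OF poly], of F] assms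
    by (auto simp: facets_def)
  have "0 \<in> interior {x. a \<bullet> x \<le> c}" using zero_int ac(2) interior_mono by blast
  then have "c > 0" using ac(1) by (simp add: interior_halfspace_le)
  then have "P \<subseteq> {x. (a /\<^sub>R c) \<bullet> x \<le> 1} \<and> F = P \<inter> {x. (a /\<^sub>R c) \<bullet> x = 1}"
    using ac by (auto simp: field_simps)
  then show ?thesis unfolding normal_def by (rule someI)
qed

lemma normal_le: "F \<in> facets \<Longrightarrow> x \<in> P \<Longrightarrow> normal F \<bullet> x \<le> 1"
  using normal by blast

lemma mem_facet_iff: "F \<in> facets \<Longrightarrow> x \<in> F \<longleftrightarrow> x \<in> P \<and> normal F \<bullet> x = 1"
  using normal by blast

lemma facet_nonempty: "F \<in> facets \<Longrightarrow> F \<noteq> {}"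
  by (simp add: facets_def facet_of_def)

lemma normal_nonzero: "F \<in> facets \<Longrightarrow> normal F \<noteq> 0"
  using facet_nonempty mem_facet_iff[of F] by fastforce

lemma inj_normal: "inj_on normal facets"
  by (intro inj_onI set_eqI) (simp add: mem_facet_iff)

lemma frontier_in_facet:
  assumes "x \<in> frontier P"
  obtains F where "F \<in> facets" "x \<in> F"
proof -
  have "rel_frontier P = frontier P"
    using zero_int by (intro rel_frontier_nonempty_interior) auto
  then show ?thesis
    using assms that rel_frontier_of_polyhedron[OF polytope_imp_polyhedron[OF poly]]
    by (auto simp: facets_def)
qed

text \<open>
The segment from the origin to a point that satisfies all the inequalities can leave \<open>P\<close> only through a
facet, where one of the inequalities is already sharp.
\<close>
lemma P_eq_polar_body: "P = polar_body facets normal"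
proof
  show "P \<subseteq> polar_body facets normal" using normal_le by (auto simp: polar_body_def)
  show "polar_body facets normal \<subseteq> P"
  proof
    fix x assume x: "x \<in> polar_body facets normal"
    show "x \<in> P"
    proof (rule ccontr)
      assume "x \<notin> P"
      have "closed_segment 0 x \<inter> frontier P \<noteq> {}"
        by (rule connected_Int_frontier) (use zero_mem \<open>x \<notin> P\<close> in auto)
      then obtain c where c: "0 \<le> c" "c \<le> 1" "c *\<^sub>R x \<in> frontier P"
        by (auto simp: in_segment)
      obtain F where F: "F \<in> facets" "c *\<^sub>R x \<in> F" using frontier_in_facet[OF c(3)] .
      then have "c * (normal F \<bullet> x) = 1" "c *\<^sub>R x \<in> P" by (auto simp: mem_facet_iff)
      moreover have "c \<noteq> 1" using \<open>x \<notin> P\<close> \<open>c *\<^sub>R x \<in> P\<close> by auto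
      moreover have "normal F \<bullet> x \<le> 1" using x F by (auto simp: polar_body_def)
      then have "c * (normal F \<bullet> x) \<le> c * 1" using c by (intro mult_left_mono) auto
      ultimately show False using c by simp
    qed
  qed
qed

lemma mem_P_iff: "x \<in> P \<longleftrightarrow> (\<forall>F\<in>facets. normal F \<bullet> x \<le> 1)"
  by (subst P_eq_polar_body) (simp add: polar_body_def)

lemma radius: obtains R where "P \<subseteq> cball 0 R" "R > 0"
  using compact_imp_bounded[OF compact] that by (auto simp: bounded_pos subset_iff)

text \<open>
The bounded set \<open>P\<close> contains no ray, so the gauge is positive away from the origin.
\<close>
lemma level_pos:
  assumes "x \<noteq> 0" and le: "\<And>F. F \<in> facets \<Longrightarrow> normal F \<bullet> x \<le> t"
  shows "t > 0"
proof -
  obtain R where "P \<subseteq> cball 0 R" by (rule radius)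
  then have R: "polar_body facets normal \<subseteq> cball 0 R" using P_eq_polar_body by simp
  let ?N = "max_functional facets normal x"
  have "norm x \<le> R * ?N" "0 \<le> ?N"
    using bounded_by_max_functional[OF finite_facets facets_nonempty R, of x] by auto
  then have "?N > 0" using assms(1) by (cases "?N = 0") auto
  moreover have "?N \<le> t" using le by (simp add: max_functional_le_iff[OF finite_facets facets_nonempty])
  ultimately show ?thesis by simp
qed

end

locale centered_maximizer = origin_polytope P for P :: "(real ^ 'n) set" +
  assumes centered: "moment1 P = 0"
    and maximal: "\<exists>\<epsilon>>0. \<forall>K. convex_body K \<longrightarrow> hausdorff_dist K P < \<epsilon> \<longrightarrow> iso_ratio K \<le> iso_ratio P"
begin

definition cov :: "real ^ 'n ^ 'n" where
  "cov = moment2 P /\<^sub>R moment0 P"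

text \<open>
The inner product in which the covariance matrix of \<open>P\<close> is the identity. Working with it replaces the
transformation of \<open>P\<close> into isotropic position.
\<close>
definition form :: "real ^ 'n \<Rightarrow> real ^ 'n \<Rightarrow> real" where
  "form x y = x \<bullet> (matrix_inv cov *v y)"

lemma moment0_pos: "moment0 P > 0"
  using convex_body_measure_pos[OF convex_body] by (simp add: moment0_eq_measure)

lemma moment2_pos: "y \<noteq> 0 \<Longrightarrow> y \<bullet> (moment2 P *v y) > 0"
proof (rule ccontr)
  assume y: "y \<noteq> 0" and "\<not> y \<bullet> (moment2 P *v y) > 0"
  then have *: "(LINT x:P|lborel. (y \<bullet> x) * (y \<bullet> x)) \<le> 0"
    by (simp add: moment2_bilinear[OF compact])
  obtain e where e: "e > 0" "ball 0 e \<subseteq> P" using zero_int by (auto simp: mem_interior)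
  define z where "z = (e / 2 / norm y) *\<^sub>R y"
  have "z \<in> interior P"
    using e y by (intro subsetD[OF interior_maximal[OF e(2) open_ball]]) (auto simp: z_def)
  then have "(y \<bullet> z) * (y \<bullet> z) = 0"
    by (intro set_integral_nonneg_zero_imp[OF compact _ _ *]) (auto intro!: continuous_intros)
  then show False using y e by (simp add: z_def)
qed

lemma cov_pos: "y \<noteq> 0 \<Longrightarrow> y \<bullet> (cov *v y) > 0"
  using moment2_pos[of y] moment0_pos
  by (simp add: cov_def scaleR_matrix_vector_assoc[symmetric])

lemma cov_symmetric: "transpose cov = cov"
  by (simp add: cov_def vec_eq_iff transpose_def moment2_def mult.commute)

lemma cov_inverse: "cov ** matrix_inv cov = mat 1" "matrix_inv cov ** cov = mat 1"
proof -
  have "invertible cov"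
    using det_pos_of_positive_definite[of cov] cov_pos by (auto simp: invertible_det_nz)
  then have "cov ** matrix_inv cov = mat 1 \<and> matrix_inv cov ** cov = mat 1"
    unfolding invertible_def matrix_inv_def by (rule someI_ex)
  then show "cov ** matrix_inv cov = mat 1" "matrix_inv cov ** cov = mat 1" by auto
qed

lemma cov_mult_inverse: "cov *v (matrix_inv cov *v x) = x" "matrix_inv cov *v (cov *v x) = x"
  by (simp_all add: matrix_vector_mul_assoc cov_inverse)

lemma cov_inner: "x \<bullet> (cov *v y) = (cov *v x) \<bullet> y"
  by (metis cov_symmetric dot_lmul_matrix vector_transpose_matrix)

lemma form_sym: "form x y = form y x"
proof -
  have "x \<bullet> (matrix_inv cov *v y) = (cov *v (matrix_inv cov *v x)) \<bullet> (matrix_inv cov *v y)"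
    by (simp add: cov_mult_inverse)
  also have "\<dots> = (matrix_inv cov *v x) \<bullet> (cov *v (matrix_inv cov *v y))"
    by (simp add: cov_inner)
  finally show ?thesis by (simp add: form_def cov_mult_inverse inner_commute)
qed

lemma form_pos: "x \<noteq> 0 \<Longrightarrow> form x x > 0"
proof -
  assume "x \<noteq> 0"
  then have "matrix_inv cov *v x \<noteq> 0" by (metis cov_mult_inverse(1) matrix_vector_mult_0_right)
  from cov_pos[OF this] show ?thesis by (simp add: form_def cov_mult_inverse inner_commute)
qed

lemma form_linear:
  "form (x + y) z = form x z + form y z" "form (c *\<^sub>R x) z = c * form x z"
  "form z (x + y) = form z x + form z y" "form z (c *\<^sub>R x) = c * form z x"
  "form (x - y) z = form x z - form y z" "form z (x - y) = form z x - form z y"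
  by (simp_all add: form_def inner_add_left inner_add_right inner_diff_left inner_diff_right
      matrix_vector_right_distrib matrix_vector_mult_scaleR matrix_vector_mult_diff_distrib)

lemma form_as_inner: "form w x = (matrix_inv cov *v w) \<bullet> x"
  using form_sym[of w x] by (simp add: form_def inner_commute)

lemma form_continuous: "continuous_on UNIV (\<lambda>x. form x x)"
  unfolding form_def by (intro continuous_intros matrix_vector_mult_linear_continuous_on)

lemma form_sum: "form x x = (\<Sum>i\<in>UNIV. \<Sum>k\<in>UNIV. matrix_inv cov $ i $ k * (x $ k * x $ i))"
  by (simp add: form_def inner_vec_def matrix_vector_mult_def sum_distrib_left mult_ac)

text \<open>
Stationarity under tilting the facet \<open>F\<close>. The logarithmic derivative of \<open>iso_ratio\<close> at a centred body is
the trace of \<open>A\<^bsup>-1\<^esup> M' / V\<close> minus \<open>(n + 2) V' / V\<close>, where \<open>V\<close> and \<open>M\<close> are the volume and the matrix of second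
moments; the first moments enter only quadratically. The numbers \<open>n + 1\<close> and \<open>n + 3\<close> come from the
degrees of homogeneity zero and two.
\<close>
lemma first_order_condition:
  assumes F: "F \<in> facets"
  shows "real (CARD('n) + 3) * (LINT x:cone_over F|lborel. form x x * (\<phi> \<bullet> x)) =
    real ((CARD('n) + 1) * (CARD('n) + 2)) * (LINT x:cone_over F|lborel. \<phi> \<bullet> x)"
proof -
  let ?n = "CARD('n)"
  let ?K = "\<lambda>t. polar_body facets (tilt normal F \<phi> t)"
  let ?C = "cone_over F"
  note I = finite_facets facets_nonempty
  obtain R where R: "P \<subseteq> cball 0 R" "R > 0" by (rule radius)
  have R': "polar_body facets normal \<subseteq> cball 0 R" using R P_eq_polar_body by simp
  have K0: "?K 0 = P" using P_eq_polar_body by simp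
  have Ccpt: "compact ?C"
  proof -
    have "?C \<subseteq> P" using P_eq_polar_body by (auto simp: cone_over_def facet_cone_def)
    then show ?thesis using facet_cone_closed[of facets normal F] compact
      by (metis cone_over_def bounded_subset compact_eq_bounded_closed)
  qed
  note deriv = has_real_derivative_tilt_integral[OF I R' inj_normal normal_nonzero F, folded cone_over_def]
  define V where "V = (\<lambda>t. moment0 (?K t))"
  define m where "m = (\<lambda>t. moment1 (?K t))"
  define M where "M = (\<lambda>t. moment2 (?K t))"
  define V' where "V' = - real (?n + 1) * (LINT x:?C|lborel. \<phi> \<bullet> x)"
  define M' where "M' = (\<lambda>i j. - real (?n + 3) * (LINT x:?C|lborel. x $ i * x $ j * (\<phi> \<bullet> x)))"
  obtain m' where m': "((\<lambda>t. m t $ i) has_real_derivative m' i) (at 0)" for i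
  proof -
    have "((\<lambda>t. m t $ i) has_real_derivative - real (?n + 1 + 1) * (LINT x:?C|lborel. x $ i * (\<phi> \<bullet> x))) (at 0)" for i
      using deriv[of "\<lambda>x. x $ i" 1] by (simp add: m_def moment1_def continuous_intros)
    then show ?thesis by (rule that)
  qed
  have V'D: "(V has_real_derivative V') (at 0)"
    using deriv[of "\<lambda>x. 1" 0 \<phi>] by (simp add: V_def V'_def moment0_def)
  have M'D: "((\<lambda>t. M t $ i $ j) has_real_derivative M' i j) (at 0)" for i j
    using deriv[of "\<lambda>x. x $ i * x $ j" 2 \<phi>]
    by (simp add: M_def M'_def moment2_def continuous_intros power2_eq_square mult_ac numeral_3_eq_3)
  have V0: "V 0 = moment0 P" and m0: "m 0 = 0" and M0: "M 0 = moment2 P"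
    using K0 centered by (simp_all add: V_def m_def M_def)
  have Vpos: "V 0 > 0" using V0 moment0_pos by simp
  define A where "A = (\<lambda>t. M t /\<^sub>R V t - outer (m t /\<^sub>R V t) (m t /\<^sub>R V t))"
  define A' where "A' = (\<lambda>i j. (M' i j - cov $ i $ j * V') / V 0)"
  have A0: "A 0 = cov"
    by (simp add: A_def m0 M0 V0 cov_def vec_eq_iff)
  have AD: "((\<lambda>t. A t $ i $ j) has_real_derivative A' i j) (at 0)" for i j
  proof -
    have "((\<lambda>t. M t $ i $ j / V t - (m t $ i / V t) * (m t $ j / V t)) has_real_derivative A' i j) (at 0)"
      using Vpos
      by (auto intro!: derivative_eq_intros m' V'D M'D simp: m0 M0 V0 A'_def cov_def field_simps)
    then show ?thesis by (simp add: A_def divide_inverse mult_ac)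
  qed
  define S where "S = matrix_inv cov"
  define C where "C = (\<lambda>t. S ** A t)"
  define D where "D = (\<chi> i j. \<Sum>k\<in>UNIV. S $ i $ k * A' k j)"
  have CD: "((\<lambda>t. C t $ i $ j) has_real_derivative D $ i $ j) (at 0)" for i j
    unfolding C_def D_def matrix_matrix_mult_def
    by (simp, intro DERIV_sum DERIV_cmult AD)
  have C0: "C 0 = mat 1" by (simp add: C_def A0 S_def cov_inverse)
  have "((\<lambda>t. det (C t)) has_real_derivative (\<Sum>i\<in>UNIV. D $ i $ i)) (at 0)"
    by (rule has_real_derivative_det_at_mat_1[OF CD C0])
  then have ratio: "((\<lambda>t. det (C t) / (V t)\<^sup>2) has_real_derivative
      ((\<Sum>i\<in>UNIV. D $ i $ i) * V 0 - 2 * V') / V 0 ^ 3) (at 0)"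
    using Vpos by (auto intro!: derivative_eq_intros V'D simp: C0 det_I field_simps power2_eq_square power3_eq_cube)
  have Spos: "det S > 0"
  proof -
    have "det S * det cov = 1" unfolding S_def by (metis cov_inverse(2) det_I det_mul)
    then show ?thesis using det_pos_of_positive_definite[OF cov_pos] zero_less_mult_pos2
      by (metis less_numeral_extra(1))
  qed
  have iso: "det (C t) / (V t)\<^sup>2 = det S * iso_ratio (?K t)" for t
    by (simp add: C_def det_mul A_def iso_ratio_def M_def V_def m_def)
  obtain \<epsilon> where \<epsilon>: "\<epsilon> > 0" "\<And>K. convex_body K \<Longrightarrow> hausdorff_dist K P < \<epsilon> \<Longrightarrow> iso_ratio K \<le> iso_ratio P"
    using maximal by blast
  define B where "B = norm \<phi> * R + 1"
  have B: "B > 0" using R by (simp add: B_def add_nonneg_pos)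
  define \<delta> where "\<delta> = min (1 / (2 * B)) (\<epsilon> / (2 * R * B))"
  have "\<delta> > 0" using B R \<epsilon> by (simp add: \<delta>_def)
  have le: "det (C t) / (V t)\<^sup>2 \<le> det (C 0) / (V 0)\<^sup>2" if t: "\<bar>0 - t\<bar> < \<delta>" for t
  proof -
    have t1: "\<bar>t\<bar> * B < 1/2" and t2: "\<bar>t\<bar> * B * (2 * R) < \<epsilon>"
      using t B R by (auto simp: \<delta>_def field_simps)
    have le: "\<bar>t\<bar> * norm \<phi> * R \<le> \<bar>t\<bar> * B" by (simp add: B_def algebra_simps)
    with t1 have sm: "\<bar>t\<bar> * norm \<phi> * R \<le> 1/2" by linarith
    have "?K t \<subseteq> cball 0 (2 * R)"
      using tilt_polar_body_norm_le[OF I R' sm] by auto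
    then have "compact (?K t)"
      using closed_polar_body bounded_subset[OF bounded_cball] by (auto simp: compact_eq_bounded_closed)
    then have cb: "convex_body (?K t)"
      using zero_in_interior_polar_body[OF I(1)] convex_polar_body by (auto simp: convex_body_def)
    have "hausdorff_dist (?K t) P < \<epsilon>"
    proof (rule hausdorff_dist_less[where d="\<bar>t\<bar> * norm \<phi> * R * (2 * R)"])
      show "?K t \<noteq> {}" using cb by (auto simp: convex_body_def)
      show "P \<noteq> {}" using zero_mem by auto
      have "\<bar>t\<bar> * norm \<phi> * R * (2 * R) \<le> \<bar>t\<bar> * B * (2 * R)" using le R by (intro mult_right_mono) auto
      then show "\<bar>t\<bar> * norm \<phi> * R * (2 * R) < \<epsilon>" using t2 by (rule le_less_trans)
    qed (use tilt_polar_body_close[OF I R' sm] P_eq_polar_body in auto)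
    then have "iso_ratio (?K t) \<le> iso_ratio P" using \<epsilon> cb by blast
    then show ?thesis unfolding iso K0 using Spos by (simp add: mult_left_mono)
  qed
  have "((\<Sum>i\<in>UNIV. D $ i $ i) * V 0 - 2 * V') / V 0 ^ 3 = 0"
    by (rule DERIV_local_max[OF ratio \<open>\<delta> > 0\<close>]) (use le in blast)
  then have tr: "(\<Sum>i\<in>UNIV. D $ i $ i) * V 0 = 2 * V'" using Vpos by simp
  have "(\<Sum>i\<in>UNIV. D $ i $ i) * V 0 = (\<Sum>i\<in>UNIV. \<Sum>k\<in>UNIV. S $ i $ k * (M' k i - cov $ k $ i * V'))"
    using Vpos by (simp add: D_def A'_def sum_distrib_right)
  also have "\<dots> = (\<Sum>i\<in>UNIV. \<Sum>k\<in>UNIV. S $ i $ k * M' k i) - (\<Sum>i\<in>UNIV. (S ** cov) $ i $ i) * V'"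
    by (simp add: right_diff_distrib sum_subtractf matrix_matrix_mult_def sum_distrib_right sum_distrib_left mult_ac)
  also have "(\<Sum>i\<in>UNIV. (S ** cov) $ i $ i) = real ?n"
    by (simp add: S_def cov_inverse mat_def)
  also have "(\<Sum>i\<in>UNIV. \<Sum>k\<in>UNIV. S $ i $ k * M' k i) = - real (?n + 3) * (LINT x:?C|lborel. form x x * (\<phi> \<bullet> x))"
  proof -
    have int: "set_integrable lborel ?C (\<lambda>x. S $ i $ k * (x $ k * x $ i * (\<phi> \<bullet> x)))"
      "set_integrable lborel ?C (\<lambda>x. \<Sum>k\<in>UNIV. S $ i $ k * (x $ k * x $ i * (\<phi> \<bullet> x)))" for i k
      by (intro compact_set_integrable Ccpt continuous_intros)+
    have "(LINT x:?C|lborel. form x x * (\<phi> \<bullet> x)) =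
        (LINT x:?C|lborel. \<Sum>i\<in>UNIV. \<Sum>k\<in>UNIV. S $ i $ k * (x $ k * x $ i * (\<phi> \<bullet> x)))"
      by (simp add: form_sum S_def sum_distrib_right mult.assoc)
    also have "\<dots> = (\<Sum>i\<in>UNIV. \<Sum>k\<in>UNIV. S $ i $ k * (LINT x:?C|lborel. x $ k * x $ i * (\<phi> \<bullet> x)))"
      using int by (simp add: set_integral_sum)
    finally show ?thesis
      by (simp add: M'_def sum_distrib_left sum_negf mult_ac)
  qed
  finally have "- real (?n + 3) * (LINT x:?C|lborel. form x x * (\<phi> \<bullet> x)) = real (?n + 2) * V'"
    using tr by (simp add: algebra_simps)
  then have "real (?n + 3) * (LINT x:?C|lborel. form x x * (\<phi> \<bullet> x)) = real (?n + 2) * (- V')"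
    by (simp only: mult_minus_left mult_minus_right minus_equation_iff)
  then show ?thesis by (simp add: V'_def algebra_simps)
qed

end

section \<open>Facets, ridges and their adjacency\<close>

context origin_polytope
begin

definition adjacent :: "(real ^ 'n) set \<Rightarrow> (real ^ 'n) set \<Rightarrow> bool" where
  "adjacent F F' \<longleftrightarrow> F \<in> facets \<and> F' \<in> facets \<and> F \<noteq> F' \<and> aff_dim (F \<inter> F') = int CARD('n) - 2"

lemma adjacent_sym: "adjacent F F' \<Longrightarrow> adjacent F' F"
  by (auto simp: adjacent_def Int_commute)

lemma facet_face: "F \<in> facets \<Longrightarrow> F face_of P"
  by (simp add: facets_def facet_of_def)

lemma facet_aff_dim: "F \<in> facets \<Longrightarrow> aff_dim F = int CARD('n) - 1"
  by (simp add: facets_def facet_of_def aff_dim_P)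

lemma facet_subset_eq:
  assumes "F \<in> facets" "F' \<in> facets" "F \<subseteq> F'"
  shows "F = F'"
proof (rule ccontr)
  assume "F \<noteq> F'"
  have "F face_of F'" using assms facet_face by (meson face_of_face)
  then have "aff_dim F < aff_dim F'"
    using \<open>F \<noteq> F'\<close> facet_face[OF assms(2)] face_of_imp_convex by (intro face_of_aff_dim_lt) auto
  then show False using assms facet_aff_dim by simp
qed

lemma dim_of_affine_level:
  assumes "S \<subseteq> {x. a \<bullet> x = 1}"
  shows "int (dim S) = aff_dim S + 1"
proof -
  have "affine hull S \<subseteq> {x. a \<bullet> x = 1}"
    using assms by (intro hull_minimal) (auto simp: affine_hyperplane)
  then have "aff_dim (insert 0 S) = aff_dim S + 1"
    by (subst aff_dim_insert) auto
  moreover have "aff_dim (insert 0 S) = int (dim (insert 0 S))"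
    by (intro aff_dim_zero hull_inc) auto
  moreover have "dim (insert 0 S) = dim S" by (metis dim_span span_insert_0)
  ultimately show ?thesis by simp
qed

lemma span_facet:
  assumes "F \<in> facets"
  shows "span F = UNIV"
proof -
  have "int (dim F) = aff_dim F + 1"
    using assms by (intro dim_of_affine_level[of _ "normal F"]) (auto simp: mem_facet_iff)
  then show ?thesis using facet_aff_dim[OF assms] by (simp flip: dim_eq_full)
qed

lemma span_ridge:
  assumes "adjacent F1 F2"
  shows "span (F1 \<inter> F2) = {x. (normal F1 - normal F2) \<bullet> x = 0}"
proof (rule subspace_dim_equal)
  note F = assms[unfolded adjacent_def]
  let ?u = "normal F1 - normal F2"
  have u: "?u \<noteq> 0" using inj_normal F by (auto dest: inj_onD)
  have "int (dim (F1 \<inter> F2)) = aff_dim (F1 \<inter> F2) + 1"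
    using F by (intro dim_of_affine_level[of _ "normal F1"]) (auto simp: mem_facet_iff)
  then show "dim {x. ?u \<bullet> x = 0} \<le> dim (span (F1 \<inter> F2))"
    using F dim_hyperplane[OF u] by simp
  show "span (F1 \<inter> F2) \<subseteq> {x. ?u \<bullet> x = 0}"
    using F by (intro span_minimal[OF _ subspace_hyperplane]) (auto simp: mem_facet_iff inner_diff_left)
qed (auto simp: subspace_hyperplane)

text \<open>
A ridge spans a linear hyperplane, since it has dimension \<open>n - 2\<close> and its affine hull avoids the origin.
\<close>
lemma orthogonal_to_ridge:
  assumes adj: "adjacent F1 F2" and v: "\<And>x. x \<in> F1 \<inter> F2 \<Longrightarrow> v \<bullet> x = 0"
  obtains c where "v = c *\<^sub>R (normal F1 - normal F2)"
proof -
  let ?u = "normal F1 - normal F2"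
  have u: "?u \<noteq> 0" using inj_normal adj by (auto simp: adjacent_def dest: inj_onD)
  define c where "c = (v \<bullet> ?u) / (?u \<bullet> ?u)"
  define r where "r = v - c *\<^sub>R ?u"
  have ur: "?u \<bullet> r = 0"
  proof -
    have "?u \<bullet> ?u \<noteq> 0" using u by (simp only: inner_eq_zero_iff not_False_eq_True)
    then have "c * (?u \<bullet> ?u) = v \<bullet> ?u" unfolding c_def by (metis nonzero_divide_eq_eq)
    then show ?thesis by (simp only: r_def inner_diff_right inner_scaleR_right inner_commute[of ?u v])
  qed
  then have "r \<in> span (F1 \<inter> F2)" using span_ridge[OF adj] by simp
  moreover have "F1 \<inter> F2 \<subseteq> {x. v \<bullet> x = 0}" using v by auto
  then have "span (F1 \<inter> F2) \<subseteq> {x. v \<bullet> x = 0}" by (rule span_minimal[OF _ subspace_hyperplane])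
  ultimately have "v \<bullet> r = 0" by auto
  then have "r \<bullet> r = 0" using ur by (simp add: r_def inner_diff_left)
  then have "v = c *\<^sub>R ?u" by (simp add: r_def)
  then show ?thesis by (rule that)
qed

lemma facet_between:
  assumes F: "F \<in> facets" "F1 \<in> facets" "F2 \<in> facets" and c: "0 < c" "c < 1"
    and n: "normal F = c *\<^sub>R normal F1 + (1 - c) *\<^sub>R normal F2"
  shows "F = F1"
proof (rule facet_subset_eq[OF F(1,2)], rule subsetI)
  fix x assume x: "x \<in> F"
  then have P: "x \<in> P" and "normal F \<bullet> x = 1" using mem_facet_iff F(1) by auto
  then have "c * (normal F1 \<bullet> x) + (1 - c) * (normal F2 \<bullet> x) = 1"
    by (simp add: n inner_add_left)
  moreover have "(1 - c) * (normal F2 \<bullet> x) \<le> (1 - c) * 1"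
    using c normal_le[OF F(3) P] by (intro mult_left_mono) auto
  ultimately have "c * 1 \<le> c * (normal F1 \<bullet> x)" by simp
  then have "normal F1 \<bullet> x \<ge> 1" using c by simp
  then show "x \<in> F1" using normal_le[OF F(2) P] P by (simp add: mem_facet_iff[OF F(2)])
qed

text \<open>
The normals that have level one on the ridge form a line. Among three of them, one would be a proper convex
combination of the other two, and its facet would be contained in theirs.
\<close>
lemma ridge_in_two_facets:
  assumes adj: "adjacent F1 F2" and F: "F \<in> facets" "F1 \<inter> F2 \<subseteq> F"
  shows "F = F1 \<or> F = F2"
proof -
  note A = adj[unfolded adjacent_def]
  have "(normal F - normal F2) \<bullet> x = 0" if "x \<in> F1 \<inter> F2" for x
  proof -
    have "x \<in> F" using that F by blast
    then show ?thesis using that A F(1) by (simp add: mem_facet_iff inner_diff_left)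
  qed
  then obtain c where c: "normal F - normal F2 = c *\<^sub>R (normal F1 - normal F2)"
    using orthogonal_to_ridge[OF adj] by metis
  then have n: "normal F = c *\<^sub>R normal F1 + (1 - c) *\<^sub>R normal F2"
    by (simp add: algebra_simps diff_eq_eq)
  consider "c < 0" | "c = 0" | "0 < c \<and> c < 1" | "c = 1" | "c > 1" by linarith
  then show ?thesis
  proof cases
    case 1
    \<comment> \<open>now \<open>normal F2\<close> lies strictly between the other two\<close>
    let ?d = "1 / (1 - c)"
    have "(1 - c) *\<^sub>R normal F2 = normal F + (- c) *\<^sub>R normal F1" using n by simp
    then have "?d *\<^sub>R ((1 - c) *\<^sub>R normal F2) = ?d *\<^sub>R normal F + (?d * (- c)) *\<^sub>R normal F1"
      by (simp only: scaleR_add_right scaleR_scaleR)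
    moreover have "?d * (1 - c) = 1" "?d * (- c) = 1 - ?d" using 1 by (auto simp: field_simps)
    ultimately have "normal F2 = ?d *\<^sub>R normal F + (1 - ?d) *\<^sub>R normal F1"
      by (metis scaleR_one scaleR_scaleR)
    from facet_between[OF _ F(1) _ _ _ this] show ?thesis using A 1 by (auto simp: field_simps)
  next
    case 2
    then show ?thesis using n inj_normal F A by (auto dest: inj_onD)
  next
    case 3
    then show ?thesis using facet_between[OF F(1) _ _ _ _ n] A by auto
  next
    case 4
    then show ?thesis using n inj_normal F A by (auto dest: inj_onD)
  next
    case 5
    \<comment> \<open>now \<open>normal F1\<close> lies strictly between the other two\<close>
    let ?d = "1 / c"
    have "c *\<^sub>R normal F1 = normal F + (c - 1) *\<^sub>R normal F2" using n by (simp add: algebra_simps)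
    then have "?d *\<^sub>R (c *\<^sub>R normal F1) = ?d *\<^sub>R normal F + (?d * (c - 1)) *\<^sub>R normal F2"
      by (simp add: scaleR_add_right)
    moreover have "?d * c = 1" "?d * (c - 1) = 1 - ?d" using 5 by (auto simp: field_simps)
    ultimately have "normal F1 = ?d *\<^sub>R normal F + (1 - ?d) *\<^sub>R normal F2"
      by (metis scaleR_one scaleR_scaleR)
    from facet_between[OF _ F(1) _ _ _ this] show ?thesis using A 5 by (auto simp: field_simps)
  qed
qed

text \<open>
Any point of the relative interior of the facet serves.
\<close>
lemma facet_private_point:
  assumes F: "F \<in> facets"
  obtains y where "y \<in> F" "\<And>F'. F' \<in> facets \<Longrightarrow> F' \<noteq> F \<Longrightarrow> normal F' \<bullet> y < 1"
proof -
  have "convex F" using facet_face[OF F] by (rule face_of_imp_convex)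
  then obtain y where y: "y \<in> rel_interior F"
    using facet_nonempty[OF F] rel_interior_eq_empty by blast
  then have yF: "y \<in> F" using rel_interior_subset by blast
  have "normal F' \<bullet> y < 1" if F': "F' \<in> facets" "F' \<noteq> F" for F'
  proof (rule ccontr)
    have yP: "y \<in> P" using yF F by (simp add: mem_facet_iff)
    assume "\<not> ?thesis"
    then have "y \<in> F'" using F' yP normal_le[OF F'(1) yP] by (simp add: mem_facet_iff)
    then have "F \<subseteq> F'"
      using y F by (intro subset_of_face_of[OF facet_face[OF F'(1)]]) (auto simp: mem_facet_iff)
    then show False using facet_subset_eq[OF F F'(1)] F' by auto
  qed
  with yF show ?thesis by (rule that)
qed

lemma cone_over_eq: 
  assumes F: "F \<in> facets"
  shows "cone_over F = {c *\<^sub>R y | c y. 0 \<le> c \<and> c \<le> 1 \<and> y \<in> F}"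
proof
  show "{c *\<^sub>R y | c y. 0 \<le> c \<and> c \<le> 1 \<and> y \<in> F} \<subseteq> cone_over F"
  proof clarify
    fix c y assume c: "0 \<le> (c::real)" "c \<le> 1" and y: "y \<in> F"
    have "normal F' \<bullet> (c *\<^sub>R y) \<le> normal F \<bullet> (c *\<^sub>R y)" "normal F' \<bullet> (c *\<^sub>R y) \<le> 1" if "F' \<in> facets" for F'
    proof -
      have "c * (normal F' \<bullet> y) \<le> c * 1"
        using c y F normal_le[OF that] by (intro mult_left_mono) (auto simp: mem_facet_iff)
      then show "normal F' \<bullet> (c *\<^sub>R y) \<le> normal F \<bullet> (c *\<^sub>R y)" "normal F' \<bullet> (c *\<^sub>R y) \<le> 1"
        using y F c by (auto simp: mem_facet_iff)
    qed
    then show "c *\<^sub>R y \<in> cone_over F"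
      by (auto simp: cone_over_def facet_cone_def polar_body_def)
  qed
  show "cone_over F \<subseteq> {c *\<^sub>R y | c y. 0 \<le> c \<and> c \<le> 1 \<and> y \<in> F}"
  proof
    fix x assume x: "x \<in> cone_over F"
    show "x \<in> {c *\<^sub>R y | c y. 0 \<le> c \<and> c \<le> 1 \<and> y \<in> F}"
    proof (cases "x = 0")
      case True
      obtain y where "y \<in> F" using facet_nonempty[OF F] by blast
      then show ?thesis using True by (auto intro!: exI[of _ "0::real"])
    next
      case False
      let ?t = "normal F \<bullet> x"
      have xP: "x \<in> P" and max: "\<And>F'. F' \<in> facets \<Longrightarrow> normal F' \<bullet> x \<le> ?t"
        using x P_eq_polar_body by (auto simp: cone_over_def facet_cone_def)
      have t: "?t > 0" using False max by (rule level_pos)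
      have "x /\<^sub>R ?t \<in> P" unfolding mem_P_iff using max t by (auto simp: field_simps)
      then have "x /\<^sub>R ?t \<in> F" using t F by (simp add: mem_facet_iff)
      moreover have "x = ?t *\<^sub>R (x /\<^sub>R ?t)" using t by simp
      ultimately show ?thesis using t normal_le[OF F xP] by (metis (mono_tags, lifting) less_imp_le mem_Collect_eq)
    qed
  qed
qed

lemma cone_over_subset: "cone_over F \<subseteq> P"
  using P_eq_polar_body by (auto simp: cone_over_def facet_cone_def)

lemma compact_cone_over: "compact (cone_over F)"
  using facet_cone_closed[of facets normal F] compact cone_over_subset[of F]
  by (metis cone_over_def bounded_subset compact_eq_bounded_closed)

text \<open>
Take a generic segment from a point over a facet of \<open>\<G>\<close> to a point over another facet. It crosses from the closed cones
over the facets in \<open>\<G>\<close> to those over the remaining facets at some point, and this point lies over the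
intersection of a facet of each kind. The segment can be chosen to avoid the cones over all faces of
dimension at most \<open>n - 3\<close>, as together with the starting point they span only finitely many proper
subspaces. Hence the intersection is a ridge.
\<close>
lemma facets_connected:
  assumes dim2: "CARD('n) \<ge> 2"
    and sub: "\<G> \<subseteq> facets" and F1: "F1 \<in> \<G>"
    and step: "\<And>F F'. F \<in> \<G> \<Longrightarrow> adjacent F F' \<Longrightarrow> F' \<in> \<G>"
  shows "\<G> = facets"
proof (rule ccontr)
  assume "\<G> \<noteq> facets"
  then obtain F2 where F2: "F2 \<in> facets" "F2 \<notin> \<G>" using sub by blast
  have F1f: "F1 \<in> facets" using F1 sub by blast
  define K where "K = (\<lambda>F. {x. \<forall>F'\<in>facets. normal F' \<bullet> x \<le> normal F \<bullet> x})"
  have K_closed: "closed (K F)" for F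
  proof -
    have "K F = (\<Inter>F'\<in>facets. {x. (normal F' - normal F) \<bullet> x \<le> 0})"
      by (auto simp: K_def inner_diff_left)
    then show ?thesis by (auto intro!: closed_INT closed_halfspace_le)
  qed
  define U where "U = (\<lambda>F. \<Inter>F'\<in>facets - {F}. {x. (normal F' - normal F) \<bullet> x < 0})"
  have U_open: "open (U F)" for F
    unfolding U_def using finite_facets by (intro open_INT) (auto intro: open_halfspace_lt)
  have mem_U: "x \<in> U F \<longleftrightarrow> (\<forall>F'\<in>facets. F' \<noteq> F \<longrightarrow> normal F' \<bullet> x < normal F \<bullet> x)" for x F
    by (auto simp: U_def inner_diff_left)
  obtain p where p: "p \<in> F1" "\<And>F'. F' \<in> facets \<Longrightarrow> F' \<noteq> F1 \<Longrightarrow> normal F' \<bullet> p < 1"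
    using facet_private_point[OF F1f] by blast
  obtain q0 where q0: "q0 \<in> F2" "\<And>F'. F' \<in> facets \<Longrightarrow> F' \<noteq> F2 \<Longrightarrow> normal F' \<bullet> q0 < 1"
    using facet_private_point[OF F2(1)] by blast
  have pU: "p \<in> U F1" using p F1f by (auto simp: mem_U mem_facet_iff)
  have "q0 \<in> U F2" using q0 F2 by (auto simp: mem_U mem_facet_iff)
  have p0: "p \<noteq> 0" using p(1) F1f by (auto simp: mem_facet_iff)
  \<comment> \<open>the faces that the segment has to avoid; the empty face is among them since \<open>n \<ge> 2\<close>, so the segment also avoids the origin\<close>
  define \<T> where "\<T> = {T. T face_of P \<and> aff_dim T \<le> int CARD('n) - 3}"
  have "finite \<T>" unfolding \<T>_def by (rule finite_subset[OF _ finite_polytope_faces[OF poly]]) auto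
  have "negligible (span (insert p T))" if T: "T \<in> \<T>" for T
  proof (rule negligible_lowdim)
    have "\<exists>a. T \<subseteq> {x. a \<bullet> x = 1}"
    proof (cases "T = {}")
      case False
      have "T \<noteq> P" using T aff_dim_P by (auto simp: \<T>_def)
      with False obtain F where F: "F facet_of P" "T \<subseteq> F"
        using face_of_polyhedron_subset_facet[OF polytope_imp_polyhedron[OF poly], of T] T
        by (auto simp: \<T>_def)
      then have "F \<in> facets" by (simp add: facets_def)
      then show ?thesis using F(2) by (intro exI[of _ "normal F"]) (auto simp: mem_facet_iff)
    qed auto
    then obtain a where "T \<subseteq> {x. a \<bullet> x = 1}" by blast
    then have "int (dim T) = aff_dim T + 1" by (rule dim_of_affine_level)
    then have "int (dim T) \<le> int CARD('n) - 2" using T by (simp add: \<T>_def)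
    moreover have "dim (insert p T) \<le> dim T + 1" by (simp add: dim_insert)
    ultimately show "dim (span (insert p T)) < DIM(real ^ 'n)" by simp
  qed
  then have "negligible (\<Union>T\<in>\<T>. span (insert p T))"
    using \<open>finite \<T>\<close> by (intro negligible_Union) auto
  moreover have "\<not> negligible (U F2)"
    using \<open>q0 \<in> U F2\<close> U_open by (intro open_not_negligible) auto
  ultimately have "\<not> U F2 \<subseteq> (\<Union>T\<in>\<T>. span (insert p T))"
    using negligible_subset by blast
  then obtain q where q: "q \<in> U F2" "\<And>T. T \<in> \<T> \<Longrightarrow> q \<notin> span (insert p T)"
    by blast
  have "{} \<in> \<T>" using dim2 by (simp add: \<T>_def)
  have off: "x \<notin> span T" if T: "T \<in> \<T>" and x: "x \<in> closed_segment p q" "x \<noteq> p" for x T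
  proof
    assume "x \<in> span T"
    obtain t where t: "x = (1 - t) *\<^sub>R p + t *\<^sub>R q" using x(1) by (auto simp: in_segment)
    have "t \<noteq> 0" using t x(2) by auto
    have "x \<in> span (insert p T)" "p \<in> span (insert p T)"
      using \<open>x \<in> span T\<close> span_mono[of T "insert p T"] by (auto intro: span_base)
    then have "(1 / t) *\<^sub>R (x - (1 - t) *\<^sub>R p) \<in> span (insert p T)"
      by (intro span_scale span_diff)
    moreover have "(1 / t) *\<^sub>R (x - (1 - t) *\<^sub>R p) = q" using t \<open>t \<noteq> 0\<close> by simp
    ultimately show False using q(2)[OF T] by simp
  qed
  define A where "A = (\<Union>F\<in>\<G>. K F)"
  define B where "B = (\<Union>F\<in>facets - \<G>. K F)"
  have AB: "closed A" "closed B"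
    unfolding A_def B_def using finite_facets finite_subset[OF sub] by (auto intro!: closed_UN K_closed)
  have cover: "closed_segment p q \<subseteq> A \<union> B"
  proof
    fix x
    obtain F where F: "F \<in> facets" "max_functional facets normal x = normal F \<bullet> x"
      using max_functional_attained[OF finite_facets facets_nonempty] .
    then have "x \<in> K F"
      using max_functional_le_iff[OF finite_facets facets_nonempty, of normal x "normal F \<bullet> x"]
      by (simp add: K_def)
    then show "x \<in> A \<union> B" using F by (auto simp: A_def B_def)
  qed
  have "p \<in> A" using pU F1 by (force simp: A_def K_def mem_U intro: less_imp_le)
  moreover have "q \<in> B" using q(1) F2 by (force simp: B_def K_def mem_U intro: less_imp_le)
  ultimately have "A \<inter> B \<inter> closed_segment p q \<noteq> {}"
    using connected_closedD[OF connected_segment(1) _ cover AB] by (auto simp: disjoint_iff)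
  then obtain x F F' where x: "x \<in> closed_segment p q" "x \<in> K F" "x \<in> K F'"
    and FF: "F \<in> \<G>" "F' \<in> facets" "F' \<notin> \<G>"
    by (auto simp: A_def B_def)
  have Ff: "F \<in> facets" using FF sub by auto
  have xp: "x \<noteq> p"
  proof
    assume "x = p"
    have "\<not> normal F' \<bullet> p < normal F1 \<bullet> p"
      using x(3) \<open>x = p\<close> F1f by (force simp: K_def)
    then have "F' = F1" using pU FF(2) unfolding mem_U by blast
    then show False using FF F1 by simp
  qed
  have "x \<noteq> 0" using off[OF \<open>{} \<in> \<T>\<close> x(1) xp] by auto
  have eq: "normal F \<bullet> x = normal F' \<bullet> x" using x Ff FF by (auto simp: K_def intro: antisym)
  let ?t = "normal F \<bullet> x"
  have max: "\<And>F'. F' \<in> facets \<Longrightarrow> normal F' \<bullet> x \<le> ?t" using x(2) by (simp add: K_def)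
  have t: "?t > 0" using \<open>x \<noteq> 0\<close> max by (rule level_pos)
  define y where "y = x /\<^sub>R ?t"
  have "y \<in> P" unfolding mem_P_iff y_def using max t by (auto simp: field_simps)
  then have y: "y \<in> F \<inter> F'" using t Ff FF eq by (simp add: mem_facet_iff y_def)
  have xy: "x = ?t *\<^sub>R y" using t by (simp add: y_def)
  have face: "F \<inter> F' face_of P" using Ff FF by (intro face_of_Int facet_face)
  have "F \<inter> F' \<noteq> F" using facet_subset_eq[OF Ff FF(2)] FF by auto
  moreover have "F \<inter> F' face_of F" using face facet_face[OF Ff] by (auto simp: face_of_face)
  ultimately have "aff_dim (F \<inter> F') < aff_dim F"
    using facet_face[OF Ff] face_of_imp_convex by (intro face_of_aff_dim_lt) auto
  then have "aff_dim (F \<inter> F') \<le> int CARD('n) - 2" using facet_aff_dim[OF Ff] by simp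
  moreover have "aff_dim (F \<inter> F') \<noteq> int CARD('n) - 2"
    using step[of F F'] FF Ff by (auto simp: adjacent_def)
  ultimately have "F \<inter> F' \<in> \<T>" using face by (simp add: \<T>_def)
  moreover have "x \<in> span (F \<inter> F')" by (subst xy) (intro span_scale span_base y)
  ultimately show False using off x xp by blast
qed

end

section \<open>Affine reflectors are reflections that preserve the polytope\<close>

context centered_maximizer
begin

definition reflection :: "real ^ 'n \<Rightarrow> real ^ 'n \<Rightarrow> real ^ 'n" where
  "reflection w x = x - (2 * form w x / form w w) *\<^sub>R w"

lemma linear_reflection: "linear (reflection w)"
  by (rule linearI) (simp_all add: reflection_def form_linear algebra_simps add_divide_distrib)

lemma reflection_involutive [simp]: "w \<noteq> 0 \<Longrightarrow> reflection w (reflection w x) = x"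
proof -
  assume "w \<noteq> 0"
  then have "form w (reflection w x) = - form w x"
    using form_pos[of w] by (simp add: reflection_def form_linear)
  then show ?thesis by (simp add: reflection_def)
qed

lemma inj_reflection: "w \<noteq> 0 \<Longrightarrow> inj (reflection w)"
  by (metis injI reflection_involutive)

lemma form_reflection: "w \<noteq> 0 \<Longrightarrow> form (reflection w x) (reflection w y) = form x y"
  using form_pos[of w] by (simp add: reflection_def form_linear form_sym[of x w] form_sym[of y w] field_simps)

text \<open>
Conjugating the reflection along \<open>v\<close> by an isometry gives the reflection along the image of \<open>v\<close>.
\<close>
lemma reflection_conjugate:
  assumes "w \<noteq> 0" "v \<noteq> 0"
  shows "reflection (reflection w v) x = reflection w (reflection v (reflection w x))"
proof -
  have "form (reflection w v) x = form v (reflection w x)"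
    using form_reflection[OF assms(1), of v "reflection w x"] assms by simp
  moreover have "reflection w (reflection v (reflection w x)) = x - (2 * form v (reflection w x) / form v v) *\<^sub>R reflection w v"
    using assms by (simp add: reflection_def[of v] linear_diff[OF linear_reflection] linear_scale[OF linear_reflection])
  ultimately show ?thesis using assms by (simp add: reflection_def[of "reflection w v"] form_reflection)
qed

lemma reflection_scaleR: "c \<noteq> 0 \<Longrightarrow> reflection (c *\<^sub>R w) = reflection w"
  by (simp add: reflection_def form_linear fun_eq_iff)

lemma reflection_fixes_iff: "w \<noteq> 0 \<Longrightarrow> reflection w x = x \<longleftrightarrow> form w x = 0"
  using form_pos[of w] by (simp add: reflection_def)

text \<open>
The direction of a reflection that fixes a ridge is orthogonal, for \<open>form\<close>, to the hyperplane spanned by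
the ridge, which determines it up to a factor.
\<close>
lemma reflection_unique:
  assumes adj: "adjacent F1 F2" and w: "w \<noteq> 0" "w' \<noteq> 0"
    and fix_w: "\<And>x. x \<in> F1 \<inter> F2 \<Longrightarrow> reflection w x = x" and fix_w': "\<And>x. x \<in> F1 \<inter> F2 \<Longrightarrow> reflection w' x = x"
  shows "reflection w = reflection w'"
proof -
  let ?S = "matrix_inv cov"
  have *: "\<exists>c. v = c *\<^sub>R (cov *v (normal F1 - normal F2))" if "v \<noteq> 0" "\<And>x. x \<in> F1 \<inter> F2 \<Longrightarrow> reflection v x = x" for v
  proof -
    have "(?S *v v) \<bullet> x = 0" if x: "x \<in> F1 \<inter> F2" for x
      using that(1)[THEN \<open>\<And>x. x \<in> F1 \<inter> F2 \<Longrightarrow> reflection v x = x\<close>] \<open>v \<noteq> 0\<close>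
      by (simp add: reflection_fixes_iff form_as_inner)
    then obtain c where "?S *v v = c *\<^sub>R (normal F1 - normal F2)"
      using orthogonal_to_ridge[OF adj] by metis
    then have "cov *v (?S *v v) = c *\<^sub>R (cov *v (normal F1 - normal F2))"
      by (simp add: matrix_vector_mult_scaleR)
    then show ?thesis by (auto simp: cov_mult_inverse)
  qed
  obtain c c' where cc: "w = c *\<^sub>R (cov *v (normal F1 - normal F2))" "w' = c' *\<^sub>R (cov *v (normal F1 - normal F2))"
    using *[OF w(1) fix_w] *[OF w(2) fix_w'] by blast
  then have "c \<noteq> 0" "c' \<noteq> 0" using w by auto
  then show ?thesis using cc by (simp add: reflection_scaleR)
qed

text \<open>
Since \<open>f\<close> fixes the hyperplane spanned by the ridge, it is the identity plus a rank-one map with kernel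
\<open>u \<bullet> x = 0\<close>, where \<open>u = normal F1 - normal F2\<close>; this choice makes \<open>u\<close> nonnegative on the cone over
\<open>F1\<close>. Comparing the first-order conditions of both facets shows that \<open>f\<close> preserves \<open>form\<close>.
\<close>
lemma reflector_is_reflection:
  assumes adj: "adjacent F1 F2" and f: "linear f" "f ` F1 = F2" "\<And>x. x \<in> F1 \<inter> F2 \<Longrightarrow> f x = x"
  obtains w where "w \<noteq> 0" "f = reflection w"
proof -
  note A = adj[unfolded adjacent_def]
  define u where "u = normal F1 - normal F2"
  have u: "u \<noteq> 0" using inj_normal A by (auto simp: u_def dest: inj_onD)
  then have uu: "u \<bullet> u > 0" by simp
  define w where "w = (f u - u) /\<^sub>R (u \<bullet> u)"
  have fx: "f x = x + (u \<bullet> x) *\<^sub>R w" for x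
  proof -
    let ?c = "(u \<bullet> x) / (u \<bullet> u)"
    define y where "y = x - ?c *\<^sub>R u"
    have "u \<bullet> y = 0" using uu by (simp add: y_def inner_diff_right)
    then have "y \<in> span (F1 \<inter> F2)" using span_ridge[OF adj] by (simp add: u_def)
    then have "f y = y"
      using linear_eq_on_span[OF f(1) linear_id, of "F1 \<inter> F2" y] f(3) by simp
    have x: "x = y + ?c *\<^sub>R u" by (simp add: y_def)
    have "f x = y + ?c *\<^sub>R f u"
      by (subst x) (simp add: linear_add[OF f(1)] linear_scale[OF f(1)] \<open>f y = y\<close>)
    also have "\<dots> = x + ?c *\<^sub>R (f u - u)" by (simp add: y_def algebra_simps)
    finally show ?thesis by (simp add: w_def divide_inverse)
  qed
  have "surj f"
  proof -
    have "span F2 = f ` span F1" using f by (metis linear_span_image)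
    then show ?thesis using span_facet A by simp
  qed
  then have "inj f" using f(1) by (simp add: linear_surjective_imp_injective)
  define l where "l = 1 + u \<bullet> w"
  have l: "l \<noteq> 0"
  proof
    assume "l = 0"
    then have "f w = 0" by (simp add: fx l_def add_eq_0_iff)
    then have "w = 0" using \<open>inj f\<close> f(1) by (metis injD linear_0)
    then show False using \<open>l = 0\<close> by (simp add: l_def)
  qed
  let ?C1 = "cone_over F1" and ?C2 = "cone_over F2"
  have cone: "f x \<in> ?C2 \<longleftrightarrow> x \<in> ?C1" for x
  proof -
    have "?C2 = f ` ?C1"
      using A f(2) by (auto simp: cone_over_eq linear_scale[OF f(1)] image_iff) (metis linear_scale[OF f(1)] imageI)+
    then show ?thesis using \<open>inj f\<close> by (simp add: inj_image_mem_iff)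
  qed
  have cov_form: "form (f x) (f x) - form x x = (u \<bullet> x) * (z \<bullet> x)"
    if "z = 2 *\<^sub>R (matrix_inv cov *v w) + form w w *\<^sub>R u" for x z
    by (simp add: that fx form_linear form_sym[of x w] inner_add_left form_as_inner[of w x] algebra_simps)
  \<comment> \<open>the defect of \<open>f\<close> as an isometry: \<open>z = 0\<close> exactly when \<open>f\<close> preserves \<open>form\<close>\<close>
  define z where "z = 2 *\<^sub>R (matrix_inv cov *v w) + form w w *\<^sub>R u"
  have int: "set_integrable lborel ?C1 h" if "continuous_on UNIV h" for h :: "real ^ 'n \<Rightarrow> real"
    by (rule compact_set_integrable[OF compact_cone_over that])
  have [measurable]: "?C2 \<in> sets borel" using compact_cone_over by (rule borel_compact)
  note form_meas = borel_measurable_continuous_onI[OF form_continuous]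
  have key: "(LINT x:?C1|lborel. (u \<bullet> x) * (z \<bullet> x) * (\<psi> \<bullet> x)) = 0" for \<psi>
  proof -
    \<comment> \<open>chosen such that composing it with \<open>f\<close> gives \<open>\<psi>\<close>\<close>
    define \<phi> where "\<phi> = \<psi> - ((\<psi> \<bullet> w) / l) *\<^sub>R u"
    have \<phi>f: "\<phi> \<bullet> f x = \<psi> \<bullet> x" for x
    proof -
      have "\<phi> \<bullet> f x = \<psi> \<bullet> x + (u \<bullet> x) * ((\<psi> \<bullet> w) - (\<psi> \<bullet> w) / l * l)"
        by (simp add: \<phi>_def fx l_def inner_diff_left inner_add_right algebra_simps add_divide_distrib)
      then show ?thesis using l by simp
    qed
    have "(LINT x:?C2|lborel. form x x * (\<phi> \<bullet> x)) = \<bar>l\<bar> * (LINT x:?C1|lborel. form (f x) (f x) * (\<phi> \<bullet> f x))"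
      unfolding l_def using form_meas l cone
      by (intro set_integral_rank_one_update fx) (auto simp: l_def)
    moreover have "(LINT x:?C2|lborel. \<phi> \<bullet> x) = \<bar>l\<bar> * (LINT x:?C1|lborel. \<phi> \<bullet> f x)"
      unfolding l_def using l cone
      by (intro set_integral_rank_one_update fx) (auto simp: l_def)
    ultimately have "\<bar>l\<bar> * (real (CARD('n) + 3) * (LINT x:?C1|lborel. form (f x) (f x) * (\<psi> \<bullet> x)))
        = \<bar>l\<bar> * (real ((CARD('n) + 1) * (CARD('n) + 2)) * (LINT x:?C1|lborel. \<psi> \<bullet> x))"
      using first_order_condition[of F2 \<phi>] A by (simp only: \<phi>f mult.left_commute)
    then have "real (CARD('n) + 3) * (LINT x:?C1|lborel. form (f x) (f x) * (\<psi> \<bullet> x))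
        = real (CARD('n) + 3) * (LINT x:?C1|lborel. form x x * (\<psi> \<bullet> x))"
      using first_order_condition[of F1 \<psi>] A l by simp
    then have "(LINT x:?C1|lborel. form (f x) (f x) * (\<psi> \<bullet> x)) = (LINT x:?C1|lborel. form x x * (\<psi> \<bullet> x))"
      by simp
    moreover have "(LINT x:?C1|lborel. form (f x) (f x) * (\<psi> \<bullet> x) - form x x * (\<psi> \<bullet> x)) =
        (LINT x:?C1|lborel. form (f x) (f x) * (\<psi> \<bullet> x)) - (LINT x:?C1|lborel. form x x * (\<psi> \<bullet> x))"
      using linear_continuous_on[OF linear_conv_bounded_linear[THEN iffD1, OF f(1)]]
      by (intro set_integral_diff int continuous_intros form_continuous continuous_on_compose2[OF form_continuous])  auto
    moreover have "form (f x) (f x) * (\<psi> \<bullet> x) - form x x * (\<psi> \<bullet> x) = (u \<bullet> x) * (z \<bullet> x) * (\<psi> \<bullet> x)" for x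
      using cov_form[OF z_def, of x] by (simp add: left_diff_distrib[symmetric])
    ultimately show ?thesis by simp
  qed
  obtain y where y: "y \<in> F1" "\<And>F'. F' \<in> facets \<Longrightarrow> F' \<noteq> F1 \<Longrightarrow> normal F' \<bullet> y < 1"
    using facet_private_point[of F1] A by blast
  define U where "U = (\<Inter>F'\<in>facets - {F1}. {x. (normal F' - normal F1) \<bullet> x < 0}) \<inter> {x. normal F1 \<bullet> x < 1}"
  have mem_U: "x \<in> U \<longleftrightarrow> (\<forall>F'\<in>facets. F' \<noteq> F1 \<longrightarrow> normal F' \<bullet> x < normal F1 \<bullet> x) \<and> normal F1 \<bullet> x < 1" for x
    by (auto simp: U_def inner_diff_left)
  have "open U"
    unfolding U_def using finite_facets by (intro open_Int open_INT) (auto intro: open_halfspace_lt)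
  have "U \<subseteq> ?C1"
    by (force simp: mem_U cone_over_def facet_cone_def polar_body_def intro: less_imp_le less_trans)
  have yU: "(1/2) *\<^sub>R y \<in> U" using y A by (auto simp: mem_U mem_facet_iff)
  have on_U: "z \<bullet> x = 0" if x: "x \<in> U" for x
  proof -
    have "u \<bullet> x * (z \<bullet> x) * (z \<bullet> x) = 0"
    proof (rule set_integral_nonneg_zero_imp[OF compact_cone_over])
      show "continuous_on UNIV (\<lambda>x. u \<bullet> x * (z \<bullet> x) * (z \<bullet> x))" by (intro continuous_intros)
      show "(LINT x:?C1|lborel. u \<bullet> x * (z \<bullet> x) * (z \<bullet> x)) \<le> 0" using key[of z] by simp
      show "x \<in> interior ?C1" using x \<open>U \<subseteq> ?C1\<close> \<open>open U\<close> by (meson interior_maximal subsetD)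
      show "0 \<le> u \<bullet> x * (z \<bullet> x) * (z \<bullet> x)" if "x \<in> ?C1" for x
        using that A by (simp add: cone_over_def facet_cone_def u_def inner_diff_left mult.assoc)
    qed
    moreover have "u \<bullet> x > 0" using x A by (auto simp: mem_U u_def inner_diff_left)
    ultimately show ?thesis by simp
  qed
  have "z = 0"
  proof -
    obtain e where e: "e > 0" "ball ((1/2) *\<^sub>R y) e \<subseteq> U"
      using \<open>open U\<close> yU open_contains_ball by blast
    define d where "d = e / (2 * (norm z + 1))"
    have d: "d > 0" "d * norm z < e"
    proof -
      have "norm z + 1 > 0" by (simp add: add_nonneg_pos)
      then show "d > 0" using e by (simp add: d_def)
      have "d * norm z \<le> d * (norm z + 1)" using \<open>d > 0\<close> by (intro mult_left_mono) auto
      also have "\<dots> = e / 2" using \<open>norm z + 1 > 0\<close> by (simp add: d_def field_simps)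
      finally show "d * norm z < e" using e by simp
    qed
    have "(1/2) *\<^sub>R y + d *\<^sub>R z \<in> U"
      using d e by (intro subsetD[OF e(2)]) (simp add: dist_norm)
    then have "z \<bullet> ((1/2) *\<^sub>R y + d *\<^sub>R z) = 0" by (rule on_U)
    then have "d * (z \<bullet> z) = 0" using on_U[OF yU] by (simp add: inner_add_right)
    then show ?thesis using d by simp
  qed
  have w: "w \<noteq> 0"
  proof
    assume "w = 0"
    then have "f ` F1 = F1" by (auto simp: fx)
    then show False using f A by simp
  qed
  have "form w w *\<^sub>R u = - (2 *\<^sub>R (matrix_inv cov *v w))"
    using \<open>z = 0\<close> unfolding z_def by (simp add: add_eq_0_iff2)
  then have "form w w * (u \<bullet> x) = - 2 * form w x" for x
    by (metis form_as_inner inner_minus_left inner_scaleR_left mult_minus_left)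
  then have "u \<bullet> x = - (2 * form w x / form w w)" for x
    using form_pos[OF w] by (simp add: field_simps)
  then have "f = reflection w" by (auto simp: fx reflection_def fun_eq_iff)
  with w show ?thesis by (rule that)
qed

end

locale reflector_maximizer = centered_maximizer P for P :: "(real ^ 'n) set" +
  assumes dim2: "CARD('n) \<ge> 2" and centroid0: "centroid P = 0"
    and reflector: "\<And>G. G ridge_of P \<Longrightarrow> affine_reflector P G"
begin

lemma adjacent_reflection:
  assumes G: "G face_of P" "aff_dim G = int CARD('n) - 2" and F: "F \<in> facets" "G \<subseteq> F"
  obtains F' w where "adjacent F F'" "F \<inter> F' = G" "w \<noteq> 0" "reflection w ` F = F'" "\<And>x. x \<in> G \<Longrightarrow> reflection w x = x"
proof -
  have "G ridge_of P" using G by (simp add: ridge_of_def aff_dim_P)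
  from reflector[OF this] obtain F1 F2 f where f: "F1 facet_of P" "F2 facet_of P" "F1 \<noteq> F2" "G = F1 \<inter> F2"
    "affine_map f" "f 0 = 0" "f ` F1 = F2" "\<forall>x\<in>G. f x = x"
    unfolding affine_reflector_def centroid0 by blast
  obtain g b where gb: "linear g" "f = (\<lambda>x. g x + b)" using f(5) by (auto simp: affine_map_def)
  have "linear f" using gb f(6) linear_0[OF gb(1)] by simp
  have adj: "adjacent F1 F2" using f G by (auto simp: adjacent_def facets_def)
  obtain w where w: "w \<noteq> 0" "f = reflection w"
    using reflector_is_reflection[OF adj \<open>linear f\<close> f(7)] f by blast
  have swap: "reflection w ` F2 = F1"
    using f(7) w by (auto simp: image_image image_iff)
  from ridge_in_two_facets[OF adj F(1)] F f have "F = F1 \<or> F = F2" by simp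
  then show ?thesis
  proof
    assume "F = F1"
    then show ?thesis using that[of F2 w] adj f w by auto
  next
    assume "F = F2"
    then show ?thesis using that[of F1 w] adjacent_sym[OF adj] f w swap by auto
  qed
qed

text \<open>
If \<open>E\<close> is the image of \<open>F\<close>, the image of a ridge of \<open>F\<close> is a ridge of \<open>E\<close>. The reflection in the image
ridge is the conjugate of the reflection in the original one, so the neighbour of \<open>E\<close> is the image of the
neighbour of \<open>F\<close>. Thus the property spreads from facet to facet.
\<close>
lemma reflection_preserves_facets:
  assumes F1: "F1 \<in> facets" and w: "w \<noteq> 0" and img: "reflection w ` F1 \<in> facets"
    and F: "F \<in> facets"
  shows "reflection w ` F \<in> facets"
proof -
  define \<G> where "\<G> = {F \<in> facets. reflection w ` F \<in> facets}"
  have "\<G> = facets"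
  proof (rule facets_connected[OF dim2])
    show "\<G> \<subseteq> facets" "F1 \<in> \<G>" using F1 img by (auto simp: \<G>_def)
    fix F F' assume F: "F \<in> \<G>" and adj: "adjacent F F'"
    note A = adj[unfolded adjacent_def]
    define E where "E = reflection w ` F"
    have E: "E \<in> facets" using F by (simp add: \<G>_def E_def)
    have face: "F \<inter> F' face_of P" using A by (intro face_of_Int facet_face) auto
    then have "F \<inter> F' face_of F" using face_of_face[OF facet_face, of F "F \<inter> F'"] A by blast
    obtain F'' v where v: "adjacent F F''" "F \<inter> F'' = F \<inter> F'" "v \<noteq> 0" "reflection v ` F = F''"
      "\<And>x. x \<in> F \<inter> F' \<Longrightarrow> reflection v x = x"
      by (rule adjacent_reflection[OF face]) (use A in auto)
    have "F'' = F'"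
      using ridge_in_two_facets[OF v(1), of F'] v(2) A by auto
    let ?G = "reflection w ` (F \<inter> F')"
    have G: "?G face_of P" "aff_dim ?G = int CARD('n) - 2" "?G \<subseteq> E"
    proof -
      have "?G face_of E"
        unfolding E_def using \<open>F \<inter> F' face_of F\<close> face_of_linear_image[OF linear_reflection inj_reflection[OF w]] by blast
      then show "?G face_of P" using facet_face[OF E] by (rule face_of_trans)
      show "aff_dim ?G = int CARD('n) - 2" using A linear_reflection inj_reflection[OF w] by simp
    qed (auto simp: E_def)
    obtain E2 v2 where v2: "adjacent E E2" "E \<inter> E2 = ?G" "v2 \<noteq> 0" "reflection v2 ` E = E2"
      "\<And>x. x \<in> ?G \<Longrightarrow> reflection v2 x = x"
      by (rule adjacent_reflection[OF G(1,2) E G(3)]) (rule that; assumption)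
    have "reflection w v \<noteq> 0" using v(3) w by (metis linear_0[OF linear_reflection] reflection_involutive)
    have "reflection (reflection w v) x = x" if "x \<in> ?G" for x
      using that v(5) w by (auto simp: reflection_conjugate v(3))
    then have "reflection v2 = reflection (reflection w v)"
      using reflection_unique[OF v2(1) v2(3) \<open>reflection w v \<noteq> 0\<close>] v2(2,5) by simp
    then have "E2 = reflection w ` F'"
      using v2(4) v(4) w unfolding E_def \<open>F'' = F'\<close>[symmetric]
      by (auto simp: image_image reflection_conjugate v(3))
    then show "F' \<in> \<G>" using v2(1) A by (simp add: \<G>_def adjacent_def)
  qed
  then show ?thesis using F by (auto simp: \<G>_def)
qed

lemma reflection_preserves_P:
  assumes F1: "F1 \<in> facets" and w: "w \<noteq> 0" and img: "reflection w ` F1 \<in> facets"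
  shows "reflection w ` P = P"
proof -
  have sub: "reflection w ` P \<subseteq> P"
  proof -
    have "reflection w ` frontier P \<subseteq> P"
    proof clarify
      fix x assume "x \<in> frontier P"
      then obtain F where F: "F \<in> facets" "x \<in> F" by (rule frontier_in_facet)
      then have "reflection w x \<in> reflection w ` F" "reflection w ` F \<in> facets"
        using reflection_preserves_facets[OF assms F(1)] by auto
      then show "reflection w x \<in> P" by (simp add: mem_facet_iff)
    qed
    moreover have "reflection w ` P = convex hull (reflection w ` frontier P)"
      using Krein_Milman_frontier[OF convex compact] convex_hull_linear_image[OF linear_reflection] by metis
    ultimately show ?thesis using convex by (simp add: hull_minimal)
  qed
  moreover have "P \<subseteq> reflection w ` P"
  proof
    fix x assume "x \<in> P"
    then have "reflection w x \<in> P" using sub by auto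
    then show "x \<in> reflection w ` P" using w by (metis imageI reflection_involutive)
  qed
  ultimately show ?thesis by blast
qed

end

section \<open>Skewing a polytope that is symmetric about a ridge\<close>

lemma compact_set_integral_linear_combo:
  fixes f g :: "real ^ 'n \<Rightarrow> real"
  assumes "compact K" "continuous_on UNIV f" "continuous_on UNIV g"
  shows "(LINT x:K|lborel. c * f x + d * g x) = c * (LINT x:K|lborel. f x) + d * (LINT x:K|lborel. g x)"
  using assms by (subst set_integral_add(2)) (auto intro!: compact_set_integrable continuous_intros)

text \<open>
A ridge, given by its two facets, and the direction of the reflection that exchanges them. Since \<open>w\<close> and
\<open>- w\<close> define the same reflection, the last assumption only selects one of them.
\<close>
locale reflecting_ridge = reflector_maximizer P for P :: "(real ^ 'n) set" +
  fixes F1 F2 :: "(real ^ 'n) set" and w :: "real ^ 'n"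
  assumes adj: "adjacent F1 F2" and w0: "w \<noteq> 0" and swap: "reflection w ` F1 = F2"
    and symm: "reflection w ` P = P" and up: "normal F1 \<bullet> w > 0"
begin

definition u :: "real ^ 'n" where
  "u = (matrix_inv cov *v w) /\<^sub>R form w w"

text \<open>
Multiplies the \<open>w\<close>-component of \<open>x\<close> by \<open>l\<close> and keeps the hyperplane \<open>u \<bullet> x = 0\<close>. The factor \<open>0\<close> is the
projection onto that hyperplane and the factor \<open>- 1\<close> is the reflection. The form of the definition
fits \<open>set_integral_rank_one_update\<close>.
\<close>
definition stretch :: "real \<Rightarrow> real ^ 'n \<Rightarrow> real ^ 'n" where
  "stretch l x = x + (((l - 1) *\<^sub>R u) \<bullet> x) *\<^sub>R w"

definition upper :: "(real ^ 'n) set" where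
  "upper = {x \<in> P. 0 \<le> u \<bullet> x}"

lemma uw: "u \<bullet> w = 1"
  using form_pos[OF w0] by (simp add: u_def form_as_inner[symmetric])

lemma u_stretch [simp]: "u \<bullet> stretch l x = l * (u \<bullet> x)"
  by (simp add: stretch_def inner_add_right uw algebra_simps)

lemma stretch_stretch: "stretch k (stretch l x) = stretch (k * l) x"
  by (simp add: stretch_def inner_add_right uw algebra_simps)

lemma stretch_1 [simp]: "stretch 1 x = x"
  by (simp add: stretch_def)

lemma stretch_eq: "stretch l x = stretch 0 x + (l * (u \<bullet> x)) *\<^sub>R w"
  by (simp add: stretch_def algebra_simps)

lemma linear_stretch: "linear (stretch l)"
  by (rule linearI) (simp_all add: stretch_def inner_add_right algebra_simps)

lemma stretch_w: "stretch l w = l *\<^sub>R w"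
  by (simp add: stretch_def uw inner_diff_left algebra_simps)

lemma continuous_stretch: "continuous_on A (stretch l)"
  unfolding stretch_def by (intro continuous_intros)

lemma stretch_minus_1: "stretch (- 1) x = reflection w x"
proof -
  have "u \<bullet> x = form w x / form w w" by (simp add: u_def form_as_inner divide_inverse)
  then show ?thesis by (simp add: stretch_def reflection_def)
qed

lemma reflect_mem: "stretch (- 1) x \<in> P \<longleftrightarrow> x \<in> P"
  using symm inj_reflection[OF w0] unfolding stretch_minus_1 by (metis inj_image_mem_iff)

lemma flatten_mem: "x \<in> P \<Longrightarrow> stretch 0 x \<in> P"
proof -
  assume x: "x \<in> P"
  have "stretch 0 x = (1/2) *\<^sub>R x + (1/2) *\<^sub>R stretch (- 1) x"
    by (simp add: stretch_def algebra_simps flip: scaleR_add_left)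
  then show ?thesis using convexD[OF convex x, of "stretch (- 1) x" "1/2" "1/2"] x reflect_mem by simp
qed

lemma shrink_mem: "x \<in> P \<Longrightarrow> 0 \<le> l \<Longrightarrow> l \<le> 1 \<Longrightarrow> stretch l x \<in> P"
proof -
  assume x: "x \<in> P" "0 \<le> l" "l \<le> 1"
  have "stretch l x = l *\<^sub>R x + (1 - l) *\<^sub>R stretch 0 x"
    by (simp add: stretch_def algebra_simps)
  then show ?thesis using convexD[OF convex x(1) flatten_mem[OF x(1)], of l "1 - l"] x by simp
qed

lemma compact_upper: "compact upper"
proof -
  have "upper = P \<inter> {x. 0 \<le> u \<bullet> x}" by (auto simp: upper_def)
  then show ?thesis using compact closed_halfspace_ge[of 0 u] by (simp add: compact_Int_closed)
qed

text \<open>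
The upper half of \<open>P\<close> is stretched by \<open>1 + t\<close> and the lower half by \<open>1 - t\<close>. As the lower half is the mirror
image of the upper half, the factor \<open>t - 1\<close> produces it from \<open>upper\<close>. Every chord in direction \<open>w\<close> is
shifted without changing its length.
\<close>
definition skewed :: "real \<Rightarrow> (real ^ 'n) set" where
  "skewed t = stretch (1 + t) ` upper \<union> stretch (t - 1) ` upper"

lemma stretch_image_iff: "l \<noteq> 0 \<Longrightarrow> y \<in> stretch l ` A \<longleftrightarrow> stretch (1 / l) y \<in> A"
  by (auto simp: stretch_stretch image_iff intro!: bexI[of _ "stretch (1 / l) y"])

lemma mem_skewed_iff:
  assumes "\<bar>t\<bar> < 1"
  shows "y \<in> skewed t \<longleftrightarrow> (0 \<le> u \<bullet> y \<and> stretch (1 / (1 + t)) y \<in> P) \<or> (u \<bullet> y \<le> 0 \<and> stretch (1 / (1 - t)) y \<in> P)"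
proof -
  have *: "stretch (1 / (t - 1)) y = stretch (- 1) (stretch (1 / (1 - t)) y)"
  proof -
    have "- 1 * (1 / (1 - t)) = 1 / (t - 1)" using assms by (simp add: field_simps)
    then show ?thesis by (simp only: stretch_stretch)
  qed
  have "y \<in> stretch (t - 1) ` upper \<longleftrightarrow> u \<bullet> y \<le> 0 \<and> stretch (1 / (1 - t)) y \<in> P"
    using assms
    by (subst stretch_image_iff) (auto simp: upper_def * reflect_mem zero_le_mult_iff mult_le_0_iff divide_le_0_iff)
  moreover have "y \<in> stretch (1 + t) ` upper \<longleftrightarrow> 0 \<le> u \<bullet> y \<and> stretch (1 / (1 + t)) y \<in> P"
    using assms by (subst stretch_image_iff) (auto simp: upper_def zero_le_divide_iff)
  ultimately show ?thesis by (auto simp: skewed_def)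
qed

lemma skewed_0: "skewed 0 = P"
  by (auto simp: mem_skewed_iff)

lemma convex_rays:
  "convex ((\<lambda>p. fst p + snd p *\<^sub>R v) ` (P \<times> {0::real..}))"
proof (rule convex_linear_image)
  show "linear (\<lambda>p::(real ^ 'n) \<times> real. fst p + snd p *\<^sub>R v)"
    by (rule linearI) (simp_all add: algebra_simps)
  show "convex (P \<times> {0::real..})"
    using convex by (intro convex_Times) auto
qed

text \<open>
\<open>P\<close> is the intersection of the region below its upper boundary and the region above its lower boundary,
both of which are convex. The skewed body is the intersection of the first region stretched by \<open>1 + t\<close>
and the second one stretched by \<open>1 - t\<close>.
\<close>
lemma convex_skewed:
  assumes t: "\<bar>t\<bar> < 1"
  shows "convex (skewed t)"
proof -
  define below where "below = (\<lambda>p. fst p + snd p *\<^sub>R (- w)) ` (P \<times> {0::real..})"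
  define above where "above = (\<lambda>p. fst p + snd p *\<^sub>R w) ` (P \<times> {0::real..})"
  have belowI: "x - r *\<^sub>R w \<in> below" if "x \<in> P" "r \<ge> 0" for x r
    unfolding below_def using that by (auto intro!: image_eqI[of _ _ "(x, r)"])
  have aboveI: "x + r *\<^sub>R w \<in> above" if "x \<in> P" "r \<ge> 0" for x r
    unfolding above_def using that by (auto intro!: image_eqI[of _ _ "(x, r)"])
  have below_P: "q \<in> P" if qb: "q \<in> below" "0 \<le> u \<bullet> q" for q
  proof -
    obtain p where "p \<in> P \<times> {0::real..}" "q = fst p + snd p *\<^sub>R (- w)"
      using qb(1) unfolding below_def by blast
    then obtain x r where q: "q = x - r *\<^sub>R w" "x \<in> P" "r \<ge> 0" by (cases p) auto
    then have uq: "u \<bullet> q = u \<bullet> x - r" by (simp add: inner_diff_right uw)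
    show ?thesis
    proof (cases "u \<bullet> x = 0")
      case False
      then have "u \<bullet> x > 0" using uq that q by simp
      then have "q = stretch ((u \<bullet> q) / (u \<bullet> x)) x"
        by (simp add: stretch_def q(1) inner_diff_right uw field_simps)
      moreover have "0 \<le> (u \<bullet> q) / (u \<bullet> x)" "(u \<bullet> q) / (u \<bullet> x) \<le> 1"
        using uq qb q \<open>u \<bullet> x > 0\<close> by (auto simp: divide_le_eq)
      ultimately show ?thesis using shrink_mem[OF q(2)] by metis
    qed (use uq that q in auto)
  qed
  have above_P: "q \<in> P" if qa: "q \<in> above" "u \<bullet> q \<le> 0" for q
  proof -
    obtain x r where q: "q = x + r *\<^sub>R w" "x \<in> P" "r \<ge> 0" using qa by (auto simp: above_def)
    have "stretch (- 1) q = stretch (- 1) x - r *\<^sub>R w"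
      by (simp add: q(1) linear_add[OF linear_stretch] linear_scale[OF linear_stretch] stretch_w)
    then have "stretch (- 1) q \<in> below" using q reflect_mem by (auto intro: belowI)
    then show ?thesis using below_P[of "stretch (- 1) q"] that reflect_mem by simp
  qed
  have cross: "p \<in> P \<Longrightarrow> u \<bullet> p \<le> 0 \<Longrightarrow> stretch l p \<in> below" "p \<in> P \<Longrightarrow> 0 \<le> u \<bullet> p \<Longrightarrow> stretch l p \<in> above"
    if "l > 0" for p l
  proof -
    have "stretch l p = stretch 0 p - (- l * (u \<bullet> p)) *\<^sub>R w" "stretch l p = stretch 0 p + (l * (u \<bullet> p)) *\<^sub>R w"
      using stretch_eq[of l p] by simp_all
    then show "p \<in> P \<Longrightarrow> u \<bullet> p \<le> 0 \<Longrightarrow> stretch l p \<in> below" "p \<in> P \<Longrightarrow> 0 \<le> u \<bullet> p \<Longrightarrow> stretch l p \<in> above"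
      using belowI[OF flatten_mem, of p "- l * (u \<bullet> p)"] aboveI[OF flatten_mem, of p "l * (u \<bullet> p)"] that
      by (auto simp: mult_le_0_iff)
  qed
  have "y \<in> skewed t \<longleftrightarrow> stretch (1 / (1 + t)) y \<in> below \<and> stretch (1 / (1 - t)) y \<in> above" for y
  proof (cases "0 \<le> u \<bullet> y")
    case True
    let ?q = "stretch (1 / (1 + t)) y"
    have q: "0 \<le> u \<bullet> ?q" using True t by simp
    have "stretch (1 / (1 - t)) y = stretch ((1 + t) / (1 - t)) ?q"
      using t by (simp add: stretch_stretch)
    moreover have "?q \<in> P \<Longrightarrow> ?q \<in> below" using belowI[of ?q 0] by simp
    ultimately have "?q \<in> below \<and> stretch (1 / (1 - t)) y \<in> above \<longleftrightarrow> ?q \<in> P"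
      using below_P[OF _ q] cross(2)[of "(1 + t) / (1 - t)" ?q] q t by auto
    moreover have "y \<in> skewed t \<longleftrightarrow> ?q \<in> P"
    proof (cases "u \<bullet> y = 0")
      case eq: True
      then have "stretch l y = y" for l by (simp add: stretch_def)
      then show ?thesis using eq by (simp add: mem_skewed_iff[OF t])
    qed (use True in \<open>simp add: mem_skewed_iff[OF t]\<close>)
    ultimately show ?thesis by simp
  next
    case False
    let ?q = "stretch (1 / (1 - t)) y"
    have q: "u \<bullet> ?q \<le> 0" using False t by (simp add: divide_le_0_iff)
    have "stretch (1 / (1 + t)) y = stretch ((1 - t) / (1 + t)) ?q"
      using t by (simp add: stretch_stretch)
    moreover have "?q \<in> P \<Longrightarrow> ?q \<in> above" using aboveI[of ?q 0] by simp
    ultimately have "stretch (1 / (1 + t)) y \<in> below \<and> ?q \<in> above \<longleftrightarrow> ?q \<in> P"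
      using above_P[OF _ q] cross(1)[of "(1 - t) / (1 + t)" ?q] q t by auto
    then show ?thesis using False by (simp add: mem_skewed_iff[OF t])
  qed
  then have "skewed t = stretch (1 / (1 + t)) -` below \<inter> stretch (1 / (1 - t)) -` above" by auto
  moreover have "convex below" "convex above"
    unfolding below_def above_def by (rule convex_rays)+
  ultimately show ?thesis
    by (simp add: convex_Int convex_linear_vimage linear_stretch)
qed

lemma compact_skewed: "compact (skewed t)"
  unfolding skewed_def
  by (intro compact_Un compact_continuous_image continuous_stretch compact_upper)

lemma convex_body_skewed:
  assumes t: "\<bar>t\<bar> < 1"
  shows "convex_body (skewed t)"
proof -
  have "0 \<in> interior (skewed t)"
  proof (rule interiorI)
    show "open (stretch (1 / (1 + t)) -` interior P \<inter> stretch (1 / (1 - t)) -` interior P)"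
      by (intro open_Int open_vimage continuous_stretch) auto
    show "0 \<in> stretch (1 / (1 + t)) -` interior P \<inter> stretch (1 / (1 - t)) -` interior P"
      using zero_int by (simp add: stretch_def)
    show "stretch (1 / (1 + t)) -` interior P \<inter> stretch (1 / (1 - t)) -` interior P \<subseteq> skewed t"
      using interior_subset[of P] linear[of 0] by (auto simp: mem_skewed_iff[OF t])
  qed
  then show ?thesis using compact_skewed convex_skewed[OF t] by (auto simp: convex_body_def)
qed

lemma skewed_close:
  assumes t: "\<bar>t\<bar> < 1" and R: "P \<subseteq> cball 0 R"
  shows "y \<in> skewed t \<Longrightarrow> \<exists>x\<in>P. dist y x \<le> \<bar>t\<bar> * (norm u * R * norm w)"
    and "x \<in> P \<Longrightarrow> \<exists>y\<in>skewed t. dist y x \<le> \<bar>t\<bar> * (norm u * R * norm w)"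
proof -
  have d: "dist (stretch (1 + c) x) x \<le> \<bar>t\<bar> * (norm u * R * norm w)" if "x \<in> P" "\<bar>c\<bar> = \<bar>t\<bar>" for x c
  proof -
    have "dist (stretch (1 + c) x) x = \<bar>t\<bar> * (\<bar>u \<bullet> x\<bar> * norm w)"
      using that by (simp add: stretch_def dist_norm abs_mult)
    also have "\<dots> \<le> \<bar>t\<bar> * (norm u * R * norm w)"
    proof (intro mult_left_mono mult_right_mono)
      have "\<bar>u \<bullet> x\<bar> \<le> norm u * norm x" by (rule Cauchy_Schwarz_ineq2)
      also have "\<dots> \<le> norm u * R" using that R by (intro mult_left_mono) auto
      finally show "\<bar>u \<bullet> x\<bar> \<le> norm u * R" .
    qed auto
    finally show ?thesis .
  qed
  have e: "stretch (1 + c) (stretch (1 / (1 + c)) y) = y" if "\<bar>c\<bar> < 1" for c y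
  proof -
    have "1 + c \<noteq> 0" using that by auto
    then show ?thesis by (simp add: stretch_stretch)
  qed
  show "\<exists>x\<in>P. dist y x \<le> \<bar>t\<bar> * (norm u * R * norm w)" if y: "y \<in> skewed t"
    using y d[of "stretch (1 / (1 + t)) y" t] d[of "stretch (1 / (1 - t)) y" "- t"] e[of t y] e[of "- t" y] t
    unfolding mem_skewed_iff[OF t] by auto
  show "\<exists>y\<in>skewed t. dist y x \<le> \<bar>t\<bar> * (norm u * R * norm w)" if x: "x \<in> P"
  proof (cases "0 \<le> u \<bullet> x")
    case True
    then have "stretch (1 + t) x \<in> skewed t" using x by (auto simp: skewed_def upper_def)
    then show ?thesis using d[OF x, of t] by blast
  next
    case False
    then have "stretch (1 + - t) x \<in> skewed t"
      using x t by (auto simp: mem_skewed_iff[OF t] stretch_stretch mult_le_0_iff)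
    then show ?thesis using d[OF x, of "- t"] by force
  qed
qed

lemma skewed_integral:
  fixes h :: "real ^ 'n \<Rightarrow> real"
  assumes t: "\<bar>t\<bar> < 1" and h: "continuous_on UNIV h"
  shows "(LINT x:skewed t|lborel. h x) =
    (LINT x:upper|lborel. (1 + t) * h (stretch (1 + t) x) + (1 - t) * h (stretch (t - 1) x))"
proof -
  have [measurable]: "h \<in> borel_measurable borel" by (rule borel_measurable_continuous_onI[OF h])
  let ?U = "stretch (1 + t) ` upper" and ?L = "stretch (t - 1) ` upper"
  have cpt: "compact ?U" "compact ?L"
    by (intro compact_continuous_image continuous_stretch compact_upper)+
  have [measurable]: "?U \<in> sets borel" "?L \<in> sets borel" "skewed t \<in> sets borel"
    using cpt compact_skewed by (auto intro: borel_compact)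
  have u0: "u \<noteq> 0" using uw by auto
  have img: "stretch l x \<in> stretch l ` upper \<longleftrightarrow> x \<in> upper" if "l \<noteq> 0" for l x
    using that by (simp add: stretch_image_iff stretch_stretch)
  have sgn_U: "0 \<le> u \<bullet> x" if "x \<in> ?U" for x using that t by (auto simp: upper_def)
  have sgn_L: "u \<bullet> x \<le> 0" if "x \<in> ?L" for x using that t by (auto simp: upper_def mult_le_0_iff)
  have "(LINT x:skewed t|lborel. h x) = (LINT x|lborel. indicator ?U x *\<^sub>R h x + indicator ?L x *\<^sub>R h x)"
    unfolding set_lebesgue_integral_def
  proof (rule integral_cong_AE)
    show "AE x in lborel. indicator (skewed t) x *\<^sub>R h x = indicator ?U x *\<^sub>R h x + indicator ?L x *\<^sub>R h x"
      using AE_lborel_not_on_hyperplane[OF u0, of 0]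
    proof eventually_elim
      case (elim x)
      then have "\<not> (x \<in> ?U \<and> x \<in> ?L)" by (metis antisym sgn_U sgn_L)
      then show ?case by (auto simp: skewed_def indicator_def)
    qed
  qed measurable
  also have "\<dots> = (LINT x:?U|lborel. h x) + (LINT x:?L|lborel. h x)"
    using compact_set_integrable[OF cpt(1) h] compact_set_integrable[OF cpt(2) h]
    unfolding set_lebesgue_integral_def set_integrable_def by (rule Bochner_Integration.integral_add)
  also have "(LINT x:?U|lborel. h x) = \<bar>1 + (t *\<^sub>R u) \<bullet> w\<bar> * (LINT x:upper|lborel. h (stretch (1 + t) x))"
    using t by (intro set_integral_rank_one_update) (auto simp: uw img, simp add: stretch_def)
  also have "(LINT x:?L|lborel. h x) = \<bar>1 + ((t - 2) *\<^sub>R u) \<bullet> w\<bar> * (LINT x:upper|lborel. h (stretch (t - 1) x))"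
    using t by (intro set_integral_rank_one_update) (auto simp: uw img, simp add: stretch_def)
  also have "\<bar>1 + (t *\<^sub>R u) \<bullet> w\<bar> * (LINT x:upper|lborel. h (stretch (1 + t) x)) + \<bar>1 + ((t - 2) *\<^sub>R u) \<bullet> w\<bar> * (LINT x:upper|lborel. h (stretch (t - 1) x))
    = (1 + t) * (LINT x:upper|lborel. h (stretch (1 + t) x)) + (1 - t) * (LINT x:upper|lborel. h (stretch (t - 1) x))"
    using t by (simp add: uw)
  also have "\<dots> = (LINT x:upper|lborel. (1 + t) * h (stretch (1 + t) x) + (1 - t) * h (stretch (t - 1) x))"
    by (rule compact_set_integral_linear_combo[symmetric, OF compact_upper])
       (auto intro!: continuous_on_compose2[OF h] continuous_stretch)
  finally show ?thesis .
qed

end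

section \<open>The second-order condition\<close>

context reflecting_ridge
begin

definition upper_mean :: real where "upper_mean = (LINT x:upper|lborel. u \<bullet> x)"
definition upper_square :: real where "upper_square = (LINT x:upper|lborel. (u \<bullet> x)\<^sup>2)"
definition upper_cross :: "real ^ 'n" where
  "upper_cross = (\<chi> i. LINT x:upper|lborel. (u \<bullet> x) * stretch 0 x $ i)"

lemma continuous_stretch_nth: "continuous_on A (\<lambda>x. stretch l x $ i)"
  by (intro continuous_intros continuous_stretch)

lemma skewed_moment0:
  assumes "\<bar>t\<bar> < 1"
  shows "moment0 (skewed t) = moment0 P"
  using skewed_integral[OF assms, of "\<lambda>x. 1"] skewed_integral[of 0 "\<lambda>x. 1"]
  by (simp add: moment0_def skewed_0)

text \<open>
The subtracted terms are the ones for \<open>t = 0\<close>, so only the change of the integrand has to be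
computed.
\<close>
lemma skewed_integral_diff:
  fixes h g :: "real ^ 'n \<Rightarrow> real"
  assumes t: "\<bar>t\<bar> < 1" and h: "continuous_on UNIV h"
    and g: "\<And>x. (1 + t) * h (stretch (1 + t) x) + (1 - t) * h (stretch (t - 1) x) - (h (stretch 1 x) + h (stretch (- 1) x)) = g x"
  shows "(LINT x:skewed t|lborel. h x) = (LINT x:P|lborel. h x) + (LINT x:upper|lborel. g x)"
proof -
  have c: "continuous_on UNIV (\<lambda>x. h (stretch l x))" for l
    by (auto intro!: continuous_on_compose2[OF h] continuous_stretch)
  have "(LINT x:skewed t|lborel. h x) - (LINT x:P|lborel. h x) =
      (LINT x:upper|lborel. ((1 + t) * h (stretch (1 + t) x) + (1 - t) * h (stretch (t - 1) x)) - (h (stretch 1 x) + h (stretch (- 1) x)))"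
    using skewed_integral[OF t h] skewed_integral[of 0, OF _ h]
    by (subst set_integral_diff(2))
       (auto simp: skewed_0 intro!: compact_set_integrable compact_upper continuous_intros c h)
  from this[unfolded g] show ?thesis by simp
qed

lemma skewed_moment1:
  assumes t: "\<bar>t\<bar> < 1"
  shows "moment1 (skewed t) = (4 * t * upper_mean) *\<^sub>R w"
proof -
  have "(LINT x:skewed t|lborel. x $ i) = (LINT x:P|lborel. x $ i) + (LINT x:upper|lborel. (4 * t * w $ i) * (u \<bullet> x))" for i
    by (rule skewed_integral_diff[OF t])
       (auto intro!: continuous_intros simp: stretch_eq[of "1 + t"] stretch_eq[of "t - 1"] stretch_eq[of "- 1"] stretch_eq[of 1] simp del: stretch_1, simp add: algebra_simps)
  then have "moment1 (skewed t) = moment1 P + (4 * t * upper_mean) *\<^sub>R w"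
    by (simp add: moment1_def vec_eq_iff upper_mean_def mult_ac)
  then show ?thesis by (simp add: centered)
qed

lemma skewed_moment2:
  assumes t: "\<bar>t\<bar> < 1"
  shows "moment2 (skewed t) = moment2 P + (4 * t) *\<^sub>R (outer upper_cross w + outer w upper_cross) + (6 * t\<^sup>2 * upper_square) *\<^sub>R outer w w"
proof -
  have "(LINT x:skewed t|lborel. x $ i * x $ j) = (LINT x:P|lborel. x $ i * x $ j) +
      (((4 * t * w $ j) * upper_cross $ i + (4 * t * w $ i) * upper_cross $ j) + (6 * t\<^sup>2 * (w $ i * w $ j)) * upper_square)" for i j
  proof -
    let ?g = "\<lambda>x. (4 * t * w $ j) * ((u \<bullet> x) * stretch 0 x $ i) + (4 * t * w $ i) * ((u \<bullet> x) * stretch 0 x $ j)"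
    have "(LINT x:skewed t|lborel. x $ i * x $ j) = (LINT x:P|lborel. x $ i * x $ j) +
       (LINT x:upper|lborel. 1 * ?g x + (6 * t\<^sup>2 * (w $ i * w $ j)) * (u \<bullet> x)\<^sup>2)"
      by (rule skewed_integral_diff[OF t])
         (auto intro!: continuous_intros simp: stretch_eq[of "1 + t"] stretch_eq[of "t - 1"] stretch_eq[of "- 1"] stretch_eq[of 1] simp del: stretch_1, simp add: algebra_simps power2_eq_square)
    also have "(LINT x:upper|lborel. 1 * ?g x + (6 * t\<^sup>2 * (w $ i * w $ j)) * (u \<bullet> x)\<^sup>2)
       = 1 * (LINT x:upper|lborel. ?g x) + (6 * t\<^sup>2 * (w $ i * w $ j)) * (LINT x:upper|lborel. (u \<bullet> x)\<^sup>2)"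
      by (rule compact_set_integral_linear_combo[OF compact_upper])
         (intro continuous_intros continuous_stretch_nth)+
    also have "(LINT x:upper|lborel. ?g x) = (4 * t * w $ j) * (LINT x:upper|lborel. (u \<bullet> x) * stretch 0 x $ i) +
        (4 * t * w $ i) * (LINT x:upper|lborel. (u \<bullet> x) * stretch 0 x $ j)"
      by (rule compact_set_integral_linear_combo[OF compact_upper])
         (intro continuous_intros continuous_stretch_nth)+
    finally show ?thesis by (simp add: upper_cross_def upper_square_def)
  qed
  then have "moment2 (skewed t) $ i $ j = moment2 P $ i $ j + (4 * t) * (upper_cross $ i * w $ j + w $ i * upper_cross $ j) + (6 * t\<^sup>2 * upper_square) * (w $ i * w $ j)" for i j
    unfolding moment2_def by (simp only: vec_lambda_beta) (simp add: ring_distribs mult_ac)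
  then show ?thesis by (simp add: vec_eq_iff)
qed

lemma inner_upper_cross: "p \<bullet> upper_cross = (LINT x:upper|lborel. (u \<bullet> x) * (p \<bullet> stretch 0 x))"
proof -
  have "(LINT x:upper|lborel. (u \<bullet> x) * (p \<bullet> stretch 0 x)) = (LINT x:upper|lborel. \<Sum>i\<in>UNIV. p $ i * ((u \<bullet> x) * stretch 0 x $ i))"
    by (simp add: inner_vec_def[of p] sum_distrib_left mult_ac)
  also have "\<dots> = (\<Sum>i\<in>UNIV. LINT x:upper|lborel. p $ i * ((u \<bullet> x) * stretch 0 x $ i))"
    by (rule set_integral_sum) (auto intro!: compact_set_integrable compact_upper continuous_intros continuous_stretch_nth)
  finally show ?thesis by (simp add: inner_vec_def upper_cross_def)
qed

lemma form_upper_cross_w: "form upper_cross w = 0"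
proof -
  have "u \<bullet> upper_cross = 0" by (simp add: inner_upper_cross)
  then show ?thesis using form_pos[OF w0] by (simp add: u_def form_as_inner[symmetric] form_sym)
qed

text \<open>
The shear \<open>mat 1 + outer w z\<close> with \<open>z\<close> orthogonal to \<open>w\<close> has determinant one and absorbs the mixed term,
leaving a rank-one perturbation in direction \<open>w\<close> to which the matrix determinant lemma applies.
\<close>
lemma det_skewed_covariance:
  fixes \<alpha> \<gamma> :: real
  shows "det (cov + \<alpha> *\<^sub>R (outer upper_cross w + outer w upper_cross) + \<gamma> *\<^sub>R outer w w) =
    det cov * (1 + (\<gamma> - \<alpha>\<^sup>2 * form upper_cross upper_cross) * form w w)"
proof -
  let ?S = "matrix_inv cov"
  define z where "z = \<alpha> *\<^sub>R (?S *v upper_cross)"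
  define \<delta> where "\<delta> = \<gamma> - \<alpha>\<^sup>2 * form upper_cross upper_cross"
  have cz: "cov *v z = \<alpha> *\<^sub>R upper_cross" by (simp add: z_def matrix_vector_mult_scaleR cov_mult_inverse)
  have zw: "z \<bullet> w = 0" using form_upper_cross_w by (simp add: z_def form_as_inner)
  then have wz: "w \<bullet> z = 0" by (simp only: inner_commute)
  have zcz: "z \<bullet> (cov *v z) = \<alpha>\<^sup>2 * form upper_cross upper_cross"
    by (subst cz) (simp add: z_def form_as_inner power2_eq_square)
  define N where "N = cov + \<delta> *\<^sub>R outer w w"
  have Nz: "N *v z = \<alpha> *\<^sub>R upper_cross"
    by (simp add: N_def matrix_vector_mult_add_rdistrib scaleR_matrix_vector_assoc[symmetric] outer_mult_vector cz wz)
  have tN: "transpose N = N"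
    using cov_symmetric by (simp add: N_def transpose_def vec_eq_iff mult.commute)
  have "(mat 1 + outer w z) ** N ** (mat 1 + outer z w) = N + outer w (N *v z) + outer (N *v z) w + (z \<bullet> (N *v z)) *\<^sub>R outer w w"
  proof -
    have "(mat 1 + outer w z) ** N = N + outer w (N *v z)"
      by (simp only: matrix_add_rdistrib matrix_mul_lid outer_matrix_mul tN)
    moreover have "outer w (N *v z) ** outer z w = (z \<bullet> (N *v z)) *\<^sub>R outer w w"
      by (simp add: matrix_mul_outer outer_mult_vector outer_scaleR_left inner_commute)
    ultimately show ?thesis
      by (simp add: matrix_add_rdistrib matrix_add_ldistrib matrix_mul_outer
          matrix_vector_mult_add_rdistrib outer_add_left)
  qed
  also have "\<dots> = cov + \<alpha> *\<^sub>R (outer upper_cross w + outer w upper_cross) + \<gamma> *\<^sub>R outer w w"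
    unfolding Nz using zcz[unfolded cz]
    by (simp add: N_def \<delta>_def outer_scaleR_left outer_scaleR_right vec_eq_iff algebra_simps)
  finally have eq: "(mat 1 + outer w z) ** N ** (mat 1 + outer z w) =
      cov + \<alpha> *\<^sub>R (outer upper_cross w + outer w upper_cross) + \<gamma> *\<^sub>R outer w w" .
  have "det (cov + \<alpha> *\<^sub>R (outer upper_cross w + outer w upper_cross) + \<gamma> *\<^sub>R outer w w) = det N"
    unfolding eq[symmetric] by (simp add: det_mul det_mat_1_plus_outer zw wz)
  also have "N = cov ** (mat 1 + outer (\<delta> *\<^sub>R (?S *v w)) w)"
    by (simp only: N_def matrix_add_ldistrib matrix_mul_outer matrix_mul_rid)
       (simp only: matrix_vector_mult_scaleR cov_mult_inverse outer_scaleR_left)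
  also have "det \<dots> = det cov * (1 + \<delta> * form w w)"
    by (simp add: det_mul det_mat_1_plus_outer form_as_inner)
  finally show ?thesis by (simp add: \<delta>_def)
qed

text \<open>
Along the family the determinant is \<open>det cov\<close> times one plus an exact multiple of \<open>t\<^sup>2\<close>, so the comparison with a
single small \<open>t\<close> already fixes the sign of that multiple.
\<close>
lemma second_order_condition:
  "6 * upper_square * moment0 P \<le> 16 * (upper_mean\<^sup>2 + form upper_cross upper_cross)"
proof -
  let ?V = "moment0 P"
  have V: "?V > 0" by (rule moment0_pos)
  obtain \<epsilon> where \<epsilon>: "\<epsilon> > 0" "\<And>K. convex_body K \<Longrightarrow> hausdorff_dist K P < \<epsilon> \<Longrightarrow> iso_ratio K \<le> iso_ratio P"
    using maximal by blast
  obtain R where R: "P \<subseteq> cball 0 R" "R > 0" by (rule radius)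
  define c where "c = norm u * R * norm w + 1"
  have c: "c > 0" using R by (simp add: c_def add_nonneg_pos)
  define t where "t = min (1/2) (\<epsilon> / (2 * c))"
  have t: "0 < t" "\<bar>t\<bar> < 1" using \<epsilon> c by (auto simp: t_def)
  have "\<bar>t\<bar> * (norm u * R * norm w) < \<epsilon>"
  proof -
    have "\<bar>t\<bar> * (norm u * R * norm w) \<le> t * c" using t by (simp add: c_def)
    also have "\<dots> \<le> (\<epsilon> / (2 * c)) * c" using c by (intro mult_right_mono) (auto simp: t_def)
    also have "\<dots> < \<epsilon>" using c \<epsilon> by simp
    finally show ?thesis .
  qed
  then have "hausdorff_dist (skewed t) P < \<epsilon>"
    using convex_body_skewed[OF t(2)] zero_mem skewed_close[OF t(2) R(1)]
    by (intro hausdorff_dist_less[where d="\<bar>t\<bar> * (norm u * R * norm w)"]) (auto simp: convex_body_def)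
  then have "iso_ratio (skewed t) \<le> iso_ratio P" using \<epsilon>(2) convex_body_skewed[OF t(2)] by blast
  then have le: "det (moment2 (skewed t) /\<^sub>R ?V - outer (moment1 (skewed t) /\<^sub>R ?V) (moment1 (skewed t) /\<^sub>R ?V)) \<le> det cov"
  proof -
    have "outer (0 :: real ^ 'n) 0 = 0" by (simp add: vec_eq_iff)
    then have P0: "iso_ratio P = det cov / ?V\<^sup>2"
      by (simp add: iso_ratio_def centered cov_def)
    show ?thesis using \<open>iso_ratio (skewed t) \<le> iso_ratio P\<close> V
      by (simp add: P0 iso_ratio_def[of "skewed t"] skewed_moment0[OF t(2)] divide_le_cancel)
  qed
  define \<alpha> where "\<alpha> = 4 * t / ?V"
  define \<gamma> where "\<gamma> = 6 * t\<^sup>2 * upper_square / ?V - (4 * t * upper_mean / ?V)\<^sup>2"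
  have "moment2 (skewed t) /\<^sub>R ?V - outer (moment1 (skewed t) /\<^sub>R ?V) (moment1 (skewed t) /\<^sub>R ?V) =
      cov + \<alpha> *\<^sub>R (outer upper_cross w + outer w upper_cross) + \<gamma> *\<^sub>R outer w w"
    using V by (simp add: skewed_moment1[OF t(2)] skewed_moment2[OF t(2)] cov_def \<alpha>_def \<gamma>_def vec_eq_iff)
      (simp add: field_simps power2_eq_square)
  with le have "det cov * (1 + (\<gamma> - \<alpha>\<^sup>2 * form upper_cross upper_cross) * form w w) \<le> det cov * 1"
    by (simp add: det_skewed_covariance)
  then have "(\<gamma> - \<alpha>\<^sup>2 * form upper_cross upper_cross) * form w w \<le> 0"
    using det_pos_of_positive_definite[OF cov_pos] by (simp add: mult_le_cancel_left_pos)
  then have "\<gamma> - \<alpha>\<^sup>2 * form upper_cross upper_cross \<le> 0"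
    using form_pos[OF w0] by (simp add: mult_le_0_iff)
  moreover have "\<gamma> - \<alpha>\<^sup>2 * form upper_cross upper_cross = (t\<^sup>2 / ?V\<^sup>2) * (6 * upper_square * ?V - 16 * (upper_mean\<^sup>2 + form upper_cross upper_cross))"
    using V by (simp add: \<alpha>_def \<gamma>_def field_simps power2_eq_square)
  ultimately have "(t\<^sup>2 / ?V\<^sup>2) * (6 * upper_square * ?V - 16 * (upper_mean\<^sup>2 + form upper_cross upper_cross)) \<le> 0" by simp
  moreover have "t\<^sup>2 / ?V\<^sup>2 > 0" using t V by simp
  ultimately have "6 * upper_square * ?V - 16 * (upper_mean\<^sup>2 + form upper_cross upper_cross) \<le> 0"
    by (metis mult_pos_pos not_le)
  then show ?thesis by simp
qed

definition rising :: "(real ^ 'n) set set" where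
  "rising = {F \<in> facets. normal F \<bullet> w > 0}"

text \<open>
For \<open>x\<close> in \<open>P\<close>, half the length of the chord of \<open>P\<close> through \<open>x\<close> in direction \<open>w\<close>, measured in multiples of \<open>w\<close>:
the facets whose normals have a positive inner product with \<open>w\<close> bound it. The formula makes the
function continuous on the whole space.
\<close>
definition height :: "real ^ 'n \<Rightarrow> real" where
  "height x = Min ((\<lambda>F. (1 - normal F \<bullet> stretch 0 x) / (normal F \<bullet> w)) ` rising)"

lemma finite_rising: "finite rising"
  using finite_facets by (simp add: rising_def)

lemma F1_rising: "F1 \<in> rising"
  using adj up by (simp add: rising_def adjacent_def)

lemma le_height_iff: "s \<le> height x \<longleftrightarrow> (\<forall>F\<in>rising. normal F \<bullet> (stretch 0 x + s *\<^sub>R w) \<le> 1)"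
  unfolding height_def using finite_rising F1_rising
  by (subst Min_ge_iff) (auto simp: rising_def inner_add_right field_simps)

lemma continuous_height: "continuous_on UNIV height"
proof -
  have "continuous_on UNIV (\<lambda>x. Min ((\<lambda>F. (1 - normal F \<bullet> stretch 0 x) / (normal F \<bullet> w)) ` J))"
    if "finite J" "J \<noteq> {}" "J \<subseteq> rising" for J
    using that
  proof (induction J rule: finite_ne_induct)
    case (singleton F)
    then show ?case by (auto intro!: continuous_intros continuous_stretch simp: rising_def)
  next
    case (insert F J)
    then show ?case by (auto intro!: continuous_intros continuous_stretch simp: rising_def)
  qed
  from this[of rising] show ?thesis using finite_rising F1_rising unfolding height_def by auto
qed

lemma height_stretch [simp]: "height (stretch l x) = height x"
  by (simp add: height_def stretch_stretch)

lemma mem_iff_height: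
  assumes "x \<in> P" "0 \<le> s"
  shows "stretch 0 x + s *\<^sub>R w \<in> P \<longleftrightarrow> s \<le> height x"
proof -
  have "normal F \<bullet> (stretch 0 x + s *\<^sub>R w) \<le> 1" if "F \<in> facets" "F \<notin> rising" for F
  proof -
    have "normal F \<bullet> w \<le> 0" using that by (auto simp: rising_def)
    then have "s * (normal F \<bullet> w) \<le> 0" using assms(2) by (simp add: mult_nonneg_nonpos)
    then show ?thesis using normal_le[OF that(1) flatten_mem[OF assms(1)]] by (simp add: inner_add_right)
  qed
  then show ?thesis unfolding mem_P_iff le_height_iff by (auto simp: rising_def)
qed

lemma upper_le_height: "x \<in> upper \<Longrightarrow> u \<bullet> x \<le> height x"
  using mem_iff_height[of x "u \<bullet> x"] stretch_eq[of 1 x] by (auto simp: upper_def)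

lemma height_nonneg: "x \<in> P \<Longrightarrow> 0 \<le> height x"
  using mem_iff_height[of x 0] flatten_mem by simp

text \<open>
The points of \<open>upper\<close> whose relative position on their half chord is at most \<open>l\<close> form the image of \<open>upper\<close>
under \<open>stretch l\<close>, which has the determinant \<open>l\<close>: the position is uniformly distributed.
\<close>
lemma upper_height_integral:
  fixes h :: "real ^ 'n \<Rightarrow> real"
  assumes h: "continuous_on UNIV h" and inv: "\<And>l x. h (stretch l x) = h x" and k: "k > 0"
  shows "(LINT x:upper|lborel. h x * (1 - ((u \<bullet> x) / height x) ^ k)) = real k / real (k + 1) * (LINT x:upper|lborel. h x)"
proof (rule layer_integral)
  show "set_integrable lborel upper h" by (rule compact_set_integrable[OF compact_upper h])
  have [measurable]: "height \<in> borel_measurable borel"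
    by (rule borel_measurable_continuous_onI[OF continuous_height])
  show "(\<lambda>x. (u \<bullet> x) / height x) \<in> borel_measurable borel" by measurable
  show hm: "h \<in> borel_measurable borel" by (rule borel_measurable_continuous_onI[OF h])
  show "upper \<in> sets borel" using compact_upper by (rule borel_compact)
  then have [measurable]: "upper \<in> sets borel" .
  show "0 \<le> u \<bullet> x / height x \<and> u \<bullet> x / height x \<le> 1" if x: "x \<in> upper" for x
    using upper_le_height[OF x] x by (auto simp: upper_def divide_le_eq zero_le_divide_iff)
  show "k > 0" by fact
  fix l :: real assume l: "0 < l" "l < 1"
  have eq: "stretch l x \<in> upper \<inter> {x. u \<bullet> x / height x \<le> l} \<longleftrightarrow> x \<in> upper" for x
  proof
    assume x: "x \<in> upper"
    have "u \<bullet> x / height x \<le> 1"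
      using upper_le_height[OF x] x by (auto simp: upper_def divide_le_eq)
    then have "l * (u \<bullet> x / height x) \<le> l * 1" using l by (intro mult_left_mono) auto
    then show "stretch l x \<in> upper \<inter> {x. u \<bullet> x / height x \<le> l}"
      using x l shrink_mem[of x l] by (auto simp: upper_def)
  next
    assume x: "stretch l x \<in> upper \<inter> {x. u \<bullet> x / height x \<le> l}"
    then have P: "stretch l x \<in> P" and s: "0 \<le> u \<bullet> x" using l by (auto simp: upper_def zero_le_mult_iff)
    have "stretch 0 (stretch l x) + (u \<bullet> x) *\<^sub>R w = x"
      using stretch_eq[of 1 x] by (simp add: stretch_stretch)
    moreover have "u \<bullet> x \<le> height x"
    proof (cases "height x = 0")
      case True
      then show ?thesis using upper_le_height[of "stretch l x"] x l by (auto simp: mult_le_0_iff)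
    next
      case False
      then have "height x > 0" using height_nonneg[OF P] by simp
      moreover have "l * (u \<bullet> x / height x) \<le> l * 1" using x by simp
      then have "u \<bullet> x / height x \<le> 1" using l(1) by (rule mult_left_le_imp_le)
      ultimately show ?thesis by (simp add: divide_le_eq)
    qed
    ultimately have "x \<in> P" using mem_iff_height[OF P s] by simp
    then show "x \<in> upper" using s by (simp add: upper_def)
  qed
  have S: "upper \<inter> {x. u \<bullet> x / height x \<le> l} \<in> sets borel" by measurable
  have "(LINT x:upper \<inter> {x. u \<bullet> x / height x \<le> l}|lborel. h x) =
      \<bar>1 + ((l - 1) *\<^sub>R u) \<bullet> w\<bar> * (LINT x:upper|lborel. h (stretch l x))"
    using l by (intro set_integral_rank_one_update[OF hm S _ _ eq]) (auto simp: uw, simp add: stretch_def)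
  then show "(LINT x:upper \<inter> {x. u \<bullet> x / height x \<le> l}|lborel. h x) = l ^ 1 * (LINT x:upper|lborel. h x)"
    using l by (simp add: uw inv)
qed

text \<open>
The least-squares approximation of \<open>height\<close> among the affine functions that are constant in direction \<open>w\<close>.
Its coefficients are twice those for \<open>u \<bullet> x\<close> over \<open>upper\<close>, because the mean of \<open>u \<bullet> x\<close> on a half
chord is half its length.
\<close>
definition profile :: "real ^ 'n \<Rightarrow> real" where
  "profile x = 4 * upper_mean / moment0 P + ((4 / moment0 P) *\<^sub>R (matrix_inv cov *v upper_cross)) \<bullet> stretch 0 x"

lemma upper_integral_height_profile:
  "(LINT x:upper|lborel. (height x - profile x)\<^sup>2) = 3 * upper_square - 8 * (upper_mean\<^sup>2 + form upper_cross upper_cross) / moment0 P"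
proof -
  let ?V = "moment0 P"
  have V: "?V > 0" by (rule moment0_pos)
  define \<kappa> where "\<kappa> = 4 * upper_mean / ?V"
  define p where "p = (4 / ?V) *\<^sub>R (matrix_inv cov *v upper_cross)"
  have profile: "profile x = \<kappa> + p \<bullet> stretch 0 x" for x by (simp add: profile_def \<kappa>_def p_def)
  have cp: "continuous_on UNIV profile" unfolding profile by (intro continuous_intros continuous_stretch)
  note cont = continuous_height cp continuous_stretch continuous_intros
  have inv: "profile (stretch l x) = profile x" for l x by (simp add: profile stretch_stretch)
  have pw: "p \<bullet> w = 0" using form_upper_cross_w by (simp add: p_def form_as_inner)
  have U: "compact upper" by (rule compact_upper)
  \<comment> \<open>along each chord the coordinate is uniformly distributed on an interval of length \<open>height\<close>\<close>
  have I1: "(LINT x:upper|lborel. height x * profile x) = 2 * (LINT x:upper|lborel. (u \<bullet> x) * profile x)"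
  proof -
    have "(LINT x:upper|lborel. (height x * profile x) * (1 - ((u \<bullet> x) / height x) ^ 1)) =
        (LINT x:upper|lborel. 1 * (height x * profile x) + (- 1) * ((u \<bullet> x) * profile x))"
    proof (rule set_lebesgue_integral_cong)
      show "upper \<in> sets lborel" using borel_compact[OF U] by simp
      show "\<forall>x. x \<in> upper \<longrightarrow> height x * profile x * (1 - (u \<bullet> x / height x) ^ 1) = 1 * (height x * profile x) + - 1 * ((u \<bullet> x) * profile x)"
        using upper_le_height by (force simp: upper_def field_simps)
    qed
    also have "\<dots> = 1 * (LINT x:upper|lborel. height x * profile x) + (- 1) * (LINT x:upper|lborel. (u \<bullet> x) * profile x)"
      by (rule compact_set_integral_linear_combo[OF U]) (intro cont)+
    finally show ?thesis
      using upper_height_integral[of "\<lambda>x. height x * profile x" 1] inv by (simp add: cont)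
  qed
  have I2: "(LINT x:upper|lborel. (height x)\<^sup>2) = 3 * upper_square"
  proof -
    have "(LINT x:upper|lborel. (height x)\<^sup>2 * (1 - ((u \<bullet> x) / height x) ^ 2)) =
        (LINT x:upper|lborel. 1 * (height x)\<^sup>2 + (- 1) * (u \<bullet> x)\<^sup>2)"
    proof (rule set_lebesgue_integral_cong)
      show "upper \<in> sets lborel" using borel_compact[OF U] by simp
      show "\<forall>x. x \<in> upper \<longrightarrow> (height x)\<^sup>2 * (1 - (u \<bullet> x / height x)\<^sup>2) = 1 * (height x)\<^sup>2 + - 1 * (u \<bullet> x)\<^sup>2"
        using upper_le_height by (force simp: upper_def field_simps power_divide)
    qed
    also have "\<dots> = 1 * (LINT x:upper|lborel. (height x)\<^sup>2) + (- 1) * (LINT x:upper|lborel. (u \<bullet> x)\<^sup>2)"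
      by (rule compact_set_integral_linear_combo[OF U]) (intro cont)+
    finally show ?thesis
      using upper_height_integral[of "\<lambda>x. (height x)\<^sup>2" 2] by (simp add: cont upper_square_def)
  qed
  have half: "(LINT x:upper|lborel. 1) = ?V / 2"
    using skewed_integral[of 0 "\<lambda>x. 1"] by (simp add: skewed_0 moment0_def)
      (simp add: set_lebesgue_integral_def)
  have I3: "(LINT x:upper|lborel. p \<bullet> stretch 0 x) = 0"
  proof -
    have "p \<bullet> moment1 P = (LINT x:upper|lborel. p \<bullet> stretch 1 x + p \<bullet> stretch (- 1) x)"
      using skewed_integral[of 0 "\<lambda>x. p \<bullet> x"] by (simp add: skewed_0 moment1_inner[OF compact] cont)
    also have "\<dots> = (LINT x:upper|lborel. 2 * (p \<bullet> stretch 0 x))"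
      using stretch_eq[of 1] stretch_eq[of "- 1"] pw by (simp add: inner_diff_right inner_add_right del: stretch_1)
    finally show ?thesis by (simp add: centered)
  qed
  have I4: "(LINT x:upper|lborel. (p \<bullet> stretch 0 x)\<^sup>2) = 8 * form upper_cross upper_cross / ?V"
  proof -
    have "p \<bullet> (moment2 P *v p) = (LINT x:upper|lborel. (p \<bullet> stretch 1 x)\<^sup>2 + (p \<bullet> stretch (- 1) x)\<^sup>2)"
      using skewed_integral[of 0 "\<lambda>x. (p \<bullet> x) * (p \<bullet> x)"]
      by (simp add: skewed_0 moment2_bilinear[OF compact] cont power2_eq_square)
    also have "\<dots> = (LINT x:upper|lborel. 2 * (p \<bullet> stretch 0 x)\<^sup>2)"
      using stretch_eq[of 1] stretch_eq[of "- 1"] pw by (simp add: inner_diff_right inner_add_right del: stretch_1)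
    finally have "2 * (LINT x:upper|lborel. (p \<bullet> stretch 0 x)\<^sup>2) = p \<bullet> (moment2 P *v p)" by simp
    also have "moment2 P = ?V *\<^sub>R cov" using V by (simp add: cov_def)
    also have "p \<bullet> ((?V *\<^sub>R cov) *v p) = 16 * form upper_cross upper_cross / ?V"
      using V by (simp add: p_def scaleR_matrix_vector_assoc[symmetric] matrix_vector_mult_scaleR cov_mult_inverse form_as_inner field_simps)
    finally show ?thesis by simp
  qed
  have I5: "(LINT x:upper|lborel. (u \<bullet> x) * profile x) = \<kappa> * upper_mean + p \<bullet> upper_cross"
  proof -
    have "(LINT x:upper|lborel. (u \<bullet> x) * profile x) = (LINT x:upper|lborel. \<kappa> * (u \<bullet> x) + 1 * ((u \<bullet> x) * (p \<bullet> stretch 0 x)))"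
      by (simp add: profile algebra_simps)
    also have "\<dots> = \<kappa> * (LINT x:upper|lborel. u \<bullet> x) + 1 * (LINT x:upper|lborel. (u \<bullet> x) * (p \<bullet> stretch 0 x))"
      by (rule compact_set_integral_linear_combo[OF U]) (intro cont)+
    finally show ?thesis by (simp add: upper_mean_def inner_upper_cross)
  qed
  have I6: "(LINT x:upper|lborel. (profile x)\<^sup>2) = \<kappa>\<^sup>2 * ?V / 2 + 8 * form upper_cross upper_cross / ?V"
  proof -
    have "(LINT x:upper|lborel. (profile x)\<^sup>2) =
        (LINT x:upper|lborel. 1 * (\<kappa>\<^sup>2 * 1 + (2 * \<kappa>) * (p \<bullet> stretch 0 x)) + 1 * (p \<bullet> stretch 0 x)\<^sup>2)"
      by (simp add: profile power2_eq_square algebra_simps)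
    also have "\<dots> = 1 * (LINT x:upper|lborel. \<kappa>\<^sup>2 * 1 + (2 * \<kappa>) * (p \<bullet> stretch 0 x)) + 1 * (LINT x:upper|lborel. (p \<bullet> stretch 0 x)\<^sup>2)"
      by (rule compact_set_integral_linear_combo[OF U]) (intro cont)+
    also have "(LINT x:upper|lborel. \<kappa>\<^sup>2 * 1 + (2 * \<kappa>) * (p \<bullet> stretch 0 x)) =
        \<kappa>\<^sup>2 * (LINT x:upper|lborel. 1) + (2 * \<kappa>) * (LINT x:upper|lborel. p \<bullet> stretch 0 x)"
      by (rule compact_set_integral_linear_combo[OF U]) (intro cont)+
    finally show ?thesis by (simp add: half I3 I4)
  qed
  have "(LINT x:upper|lborel. (height x - profile x)\<^sup>2) =
      (LINT x:upper|lborel. 1 * (1 * (height x)\<^sup>2 + (- 2) * (height x * profile x)) + 1 * (profile x)\<^sup>2)"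
    by (simp add: power2_eq_square algebra_simps)
  also have "\<dots> = 1 * (LINT x:upper|lborel. 1 * (height x)\<^sup>2 + (- 2) * (height x * profile x)) + 1 * (LINT x:upper|lborel. (profile x)\<^sup>2)"
    by (rule compact_set_integral_linear_combo[OF U]) (intro cont)+
  also have "(LINT x:upper|lborel. 1 * (height x)\<^sup>2 + (- 2) * (height x * profile x)) =
      1 * (LINT x:upper|lborel. (height x)\<^sup>2) + (- 2) * (LINT x:upper|lborel. height x * profile x)"
    by (rule compact_set_integral_linear_combo[OF U]) (intro cont)+
  finally have "(LINT x:upper|lborel. (height x - profile x)\<^sup>2) =
      3 * upper_square - 4 * (\<kappa> * upper_mean + p \<bullet> upper_cross) + \<kappa>\<^sup>2 * ?V / 2 + 8 * form upper_cross upper_cross / ?V"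
    by (simp add: I1 I2 I5 I6)
  moreover have "p \<bullet> upper_cross = 4 * form upper_cross upper_cross / ?V" by (simp add: p_def form_as_inner)
  ultimately show ?thesis using V by (simp add: \<kappa>_def power2_eq_square field_simps)
qed

text \<open>
The second-order condition leaves no room for a positive squared distance; continuity carries the
equality from almost all points to the closure.
\<close>
lemma height_eq_profile:
  assumes x: "x \<in> P"
  shows "height x = profile x"
proof -
  have le: "(LINT x:upper|lborel. (height x - profile x)\<^sup>2) \<le> 0"
    using second_order_condition moment0_pos by (simp add: upper_integral_height_profile field_simps)
  have cp: "continuous_on UNIV profile"
    unfolding profile_def by (intro continuous_intros continuous_stretch)
  have int: "interior upper \<subseteq> {x. height x = profile x}"
  proof
    fix x assume "x \<in> interior upper"
    then have "(height x - profile x)\<^sup>2 = 0"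
      by (intro set_integral_nonneg_zero_imp[OF compact_upper _ _ le]) (auto intro!: continuous_intros continuous_height cp)
    then show "x \<in> {x. height x = profile x}" by simp
  qed
  have "convex upper"
  proof -
    have "upper = P \<inter> {x. 0 \<le> u \<bullet> x}" by (auto simp: upper_def)
    then show ?thesis using convex convex_halfspace_ge[of 0 u] by (simp add: convex_Int)
  qed
  moreover have "interior upper \<noteq> {}"
  proof -
    have "open (interior P \<inter> {x. 0 < u \<bullet> x})" by (intro open_Int open_interior open_halfspace_gt[of 0 u, simplified])
    moreover have "interior P \<inter> {x. 0 < u \<bullet> x} \<subseteq> upper" using interior_subset by (auto simp: upper_def)
    ultimately have sub: "interior P \<inter> {x. 0 < u \<bullet> x} \<subseteq> interior upper" by (rule interior_maximal[rotated])
    obtain e where e: "e > 0" "ball 0 e \<subseteq> interior P"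
      using zero_int open_contains_ball[of "interior P"] by auto
    have "(e / (2 * norm w)) *\<^sub>R w \<in> interior P"
      by (rule subsetD[OF e(2)]) (use e w0 in auto)
    moreover have "0 < u \<bullet> ((e / (2 * norm w)) *\<^sub>R w)" using e w0 by (simp add: uw)
    ultimately show ?thesis using sub by blast
  qed
  ultimately have "closure (interior upper) = closure upper" by (rule convex_closure_interior)
  moreover have "closure (interior upper) \<subseteq> {x. height x = profile x}"
    using int by (rule closure_minimal) (intro closed_Collect_eq continuous_height cp)
  ultimately have up: "upper \<subseteq> {x. height x = profile x}" using closure_subset by blast
  have "stretch 0 x \<in> upper" using flatten_mem[OF x] by (simp add: upper_def)
  then show ?thesis using up by (auto simp: profile_def stretch_stretch)
qed

lemma normal_F2: "normal F2 \<bullet> x = normal F1 \<bullet> stretch (- 1) x"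
proof -
  note A = adj[unfolded adjacent_def]
  have "linear (\<lambda>x. normal F2 \<bullet> stretch (- 1) x)" "linear (\<lambda>x. normal F1 \<bullet> x)"
    using linear_compose[OF linear_stretch bounded_linear.linear[OF bounded_linear_inner_right]]
      bounded_linear.linear[OF bounded_linear_inner_right] by (auto simp: o_def)
  moreover have "normal F2 \<bullet> stretch (- 1) x = normal F1 \<bullet> x" if "x \<in> F1" for x
  proof -
    have "stretch (- 1) x \<in> F2" using that swap by (auto simp: stretch_minus_1)
    then show ?thesis using that A by (simp add: mem_facet_iff)
  qed
  ultimately have "normal F2 \<bullet> stretch (- 1) x = normal F1 \<bullet> x" for x
    using linear_eq_on_span[of _ _ F1 x] span_facet[of F1] A by auto
  from this[of "stretch (- 1) x"] show ?thesis by (simp add: stretch_stretch)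
qed

lemma normal_F2_w: "normal F2 \<bullet> w = - (normal F1 \<bullet> w)"
  by (simp add: normal_F2 stretch_w)

text \<open>
The facet \<open>F1\<close> lies on the upper boundary, and \<open>height\<close> is affine, so the upper boundary
lies entirely in the hyperplane of \<open>F1\<close>: moving along \<open>w\<close> to that hyperplane does not leave \<open>P\<close>.
\<close>
lemma push_to_F1:
  assumes x: "x \<in> P"
  shows "x + ((1 - normal F1 \<bullet> x) / (normal F1 \<bullet> w)) *\<^sub>R w \<in> P"
proof -
  note A = adj[unfolded adjacent_def]
  let ?a = "normal F1" and ?V = "moment0 P"
  define \<kappa> where "\<kappa> = 4 * upper_mean / ?V"
  define p where "p = (4 / ?V) *\<^sub>R (matrix_inv cov *v upper_cross)"
  have pw: "p \<bullet> w = 0" using form_upper_cross_w by (simp add: p_def form_as_inner)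
  have profile: "profile x = \<kappa> + p \<bullet> x" for x
    using pw by (simp add: profile_def stretch_def inner_add_right inner_diff_right flip: \<kappa>_def p_def del: inner_scaleR_left)
  have on_F1: "(\<kappa> *\<^sub>R ?a + p) \<bullet> x = u \<bullet> x" if x: "x \<in> F1" for x
  proof -
    have P: "x \<in> P" and a: "?a \<bullet> x = 1" using x A by (auto simp: mem_facet_iff)
    have "normal F2 \<bullet> x = 1 - 2 * (u \<bullet> x) * (?a \<bullet> w)"
      by (simp add: normal_F2 stretch_def inner_add_right inner_diff_right a)
    then have "0 \<le> u \<bullet> x" using normal_le[of F2, OF _ P] A up by (simp add: zero_le_mult_iff)
    then have "u \<bullet> x \<le> height x" using P by (intro upper_le_height) (simp add: upper_def)
    moreover have "height x \<le> u \<bullet> x"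
    proof -
      have "?a \<bullet> (stretch 0 x + height x *\<^sub>R w) \<le> 1"
        using le_height_iff[of "height x" x] F1_rising by simp
      then have "(height x - u \<bullet> x) * (?a \<bullet> w) \<le> 0"
        by (simp add: stretch_def inner_add_right a algebra_simps)
      then show ?thesis using up by (simp add: mult_le_0_iff)
    qed
    ultimately show ?thesis
      using height_eq_profile[OF P] a by (simp add: profile inner_add_left)
  qed
  \<comment> \<open>on \<open>F1\<close> the constant \<open>1\<close> equals \<open>normal F1 \<bullet> x\<close>, which makes the equation linear; and \<open>F1\<close> spans the space\<close>
  have lin: "(\<kappa> *\<^sub>R ?a + p) \<bullet> x = u \<bullet> x" for x
  proof -
    have "F1 \<subseteq> {x. (\<kappa> *\<^sub>R ?a + p - u) \<bullet> x = 0}" using on_F1 by (auto simp: inner_diff_left)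
    then have "span F1 \<subseteq> {x. (\<kappa> *\<^sub>R ?a + p - u) \<bullet> x = 0}" by (rule span_minimal[OF _ subspace_hyperplane])
    then have "(\<kappa> *\<^sub>R ?a + p - u) \<bullet> x = 0" using span_facet[of F1] A by auto
    then show ?thesis by (simp add: inner_diff_left)
  qed
  have \<kappa>: "\<kappa> = 1 / (?a \<bullet> w)"
    using lin[of w] pw uw up by (simp add: inner_add_left field_simps)
  have "height x = (1 - ?a \<bullet> x) / (?a \<bullet> w) + u \<bullet> x"
    using lin[of x] by (simp add: height_eq_profile[OF x] profile inner_add_left \<kappa> diff_divide_distrib)
  moreover have "stretch 0 x + height x *\<^sub>R w \<in> P"
    using mem_iff_height[OF x height_nonneg[OF x]] by simp
  ultimately show ?thesis by (simp add: stretch_def algebra_simps)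
qed

text \<open>
From a point of \<open>F\<close> in no other facet one can move inside \<open>P\<close> a positive distance along \<open>w\<close>, to \<open>F1\<close>, and along \<open>- w\<close>, to
\<open>F2\<close>; so \<open>F\<close> is parallel to \<open>w\<close>.
\<close>
lemma other_normals_orthogonal:
  assumes F: "F \<in> facets" "F \<noteq> F1" "F \<noteq> F2"
  shows "normal F \<bullet> w = 0"
proof -
  note A = adj[unfolded adjacent_def]
  obtain y where y: "y \<in> F" "\<And>F'. F' \<in> facets \<Longrightarrow> F' \<noteq> F \<Longrightarrow> normal F' \<bullet> y < 1"
    using facet_private_point[OF F(1)] by blast
  have P: "y \<in> P" and a: "normal F \<bullet> y = 1" using y(1) F by (auto simp: mem_facet_iff)
  have lt: "normal F1 \<bullet> y < 1" "normal F2 \<bullet> y < 1" using y(2) A F by auto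
  have "normal F \<bullet> (y + ((1 - normal F1 \<bullet> y) / (normal F1 \<bullet> w)) *\<^sub>R w) \<le> 1"
    using normal_le[OF F(1) push_to_F1[OF P]] .
  then have "((1 - normal F1 \<bullet> y) / (normal F1 \<bullet> w)) * (normal F \<bullet> w) \<le> 0"
    by (simp add: inner_add_right a)
  moreover have "(1 - normal F1 \<bullet> y) / (normal F1 \<bullet> w) > 0" using lt up by simp
  ultimately have "normal F \<bullet> w \<le> 0" by (metis mult_pos_pos not_le)
  let ?y = "stretch (- 1) y"
  have "?y \<in> P" using P reflect_mem by simp
  have "stretch (- 1) (?y + ((1 - normal F1 \<bullet> ?y) / (normal F1 \<bullet> w)) *\<^sub>R w) \<in> P"
    using push_to_F1[OF \<open>?y \<in> P\<close>] reflect_mem by blast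
  then have "y - ((1 - normal F2 \<bullet> y) / (normal F1 \<bullet> w)) *\<^sub>R w \<in> P"
    by (simp add: linear_add[OF linear_stretch] linear_scale[OF linear_stretch] stretch_w stretch_stretch normal_F2)
  from normal_le[OF F(1) this] have "((1 - normal F2 \<bullet> y) / (normal F1 \<bullet> w)) * (normal F \<bullet> w) \<ge> 0"
    by (simp add: inner_diff_right a)
  moreover have "(1 - normal F2 \<bullet> y) / (normal F1 \<bullet> w) > 0" using lt up by simp
  ultimately have "normal F \<bullet> w \<ge> 0" by (metis mult_pos_neg not_le)
  with \<open>normal F \<bullet> w \<le> 0\<close> show ?thesis by simp
qed

end

context reflector_maximizer
begin

lemma adjacent_direction:
  assumes adj: "adjacent F1 F2"
  obtains w where "normal F1 \<bullet> w > 0" "normal F2 \<bullet> w = - (normal F1 \<bullet> w)"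
    "\<And>F. F \<in> facets \<Longrightarrow> F \<noteq> F1 \<Longrightarrow> F \<noteq> F2 \<Longrightarrow> normal F \<bullet> w = 0"
proof -
  note A = adj[unfolded adjacent_def]
  have face: "F1 \<inter> F2 face_of P" using A by (intro face_of_Int facet_face) auto
  obtain F' w where w: "adjacent F1 F'" "F1 \<inter> F' = F1 \<inter> F2" "w \<noteq> 0" "reflection w ` F1 = F'"
    by (rule adjacent_reflection[OF face]) (use A in auto)
  have "F' = F2"
    using ridge_in_two_facets[OF w(1), of F2] w(2) A by auto
  then have sw: "reflection w ` F1 = F2" using w(4) by simp
  have symm: "reflection w ` P = P"
    by (rule reflection_preserves_P[OF _ w(3)]) (use A sw in auto)
  have "normal F1 \<bullet> w \<noteq> 0"
  proof
    assume 0: "normal F1 \<bullet> w = 0"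
    have "F1 \<subseteq> F2"
    proof
      fix x assume x: "x \<in> F1"
      have "reflection w x \<in> F2" using sw x by auto
      then have P: "reflection w x \<in> P" using A by (auto simp: mem_facet_iff)
      have "normal F1 \<bullet> reflection w x = 1" using x A 0 by (simp add: reflection_def inner_diff_right mem_facet_iff)
      then have "reflection w x \<in> F1" using P A by (simp add: mem_facet_iff)
      then have "reflection w (reflection w x) \<in> F2" using sw by blast
      then show "x \<in> F2" using w by simp
    qed
    then show False using facet_subset_eq[of F1 F2] A by auto
  qed
  then consider "normal F1 \<bullet> w > 0" | "normal F1 \<bullet> (- w) > 0" by (fastforce simp: not_less)
  then show ?thesis
  proof cases
    case 1
    interpret reflecting_ridge P F1 F2 w by unfold_locales (use adj w sw symm 1 in auto)
    show ?thesis using that[OF 1 normal_F2_w other_normals_orthogonal] .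
  next
    case 2
    have neg: "reflection (- w) = reflection w" using reflection_scaleR[of "- 1" w] by simp
    interpret reflecting_ridge P F1 F2 "- w" by unfold_locales (use adj w sw symm 2 neg in auto)
    show ?thesis using that[OF 2 normal_F2_w other_normals_orthogonal] .
  qed
qed

end

section \<open>From normals to the simplex\<close>

context reflector_maximizer
begin

text \<open>
The inner product of the relation with the direction of an adjacent pair keeps only the two terms of that
pair, with opposite factors.
\<close>
lemma relation_constant:
  assumes rel: "(\<Sum>F\<in>facets. c F *\<^sub>R normal F) = 0" and F: "F \<in> facets" "F' \<in> facets"
  shows "c F = c F'"
proof -
  have "{E \<in> facets. c E = c F} = facets"
  proof (rule facets_connected[OF dim2])
    fix F1 F2 assume F1: "F1 \<in> {E \<in> facets. c E = c F}" and adj: "adjacent F1 F2"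
    note A = adj[unfolded adjacent_def]
    obtain w where w: "normal F1 \<bullet> w > 0" "normal F2 \<bullet> w = - (normal F1 \<bullet> w)"
      "\<And>F. F \<in> facets \<Longrightarrow> F \<noteq> F1 \<Longrightarrow> F \<noteq> F2 \<Longrightarrow> normal F \<bullet> w = 0"
      using adjacent_direction[OF adj] by blast
    have "0 = (\<Sum>F\<in>facets. c F *\<^sub>R normal F) \<bullet> w" by (simp add: rel)
    also have "\<dots> = (\<Sum>F\<in>facets. c F * (normal F \<bullet> w))" by (simp add: inner_sum_left)
    also have "\<dots> = (\<Sum>F\<in>{F1, F2}. c F * (normal F \<bullet> w))"
      by (rule sum.mono_neutral_right) (use finite_facets A w(3) in auto)
    also have "\<dots> = (c F1 - c F2) * (normal F1 \<bullet> w)"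
      using A w(2) by (simp add: left_diff_distrib)
    finally have "c F1 = c F2" using w(1) by simp
    then show "F2 \<in> {E \<in> facets. c E = c F}" using F1 A by auto
  qed (use F in auto)
  then have "F' \<in> {E \<in> facets. c E = c F}" using F(2) by (simp only:)
  then show ?thesis by simp
qed

text \<open>
A relation that omits one facet has the coefficient zero there, hence everywhere.
\<close>
lemma normals_independent:
  assumes F0: "F0 \<in> facets"
  shows "independent (normal ` (facets - {F0}))"
proof (rule independent_if_scalars_zero)
  show "finite (normal ` (facets - {F0}))" using finite_facets by simp
  have inj: "inj_on normal (facets - {F0})" using inj_normal by (rule inj_on_subset) auto
  fix f x assume sum: "(\<Sum>x\<in>normal ` (facets - {F0}). f x *\<^sub>R x) = 0" and x: "x \<in> normal ` (facets - {F0})"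
  define c where "c = (\<lambda>F. if F = F0 then 0 else f (normal F))"
  have "(\<Sum>F\<in>facets. c F *\<^sub>R normal F) = (\<Sum>F\<in>facets - {F0}. f (normal F) *\<^sub>R normal F)"
    using finite_facets F0 by (subst sum.remove[of _ F0]) (auto simp: c_def intro!: sum.cong)
  also have "\<dots> = 0" using sum by (simp add: sum.reindex[OF inj])
  finally have rel: "(\<Sum>F\<in>facets. c F *\<^sub>R normal F) = 0" .
  obtain F where F: "F \<in> facets" "F \<noteq> F0" "x = normal F" using x by auto
  have "c F = c F0" by (rule relation_constant[OF rel F(1) F0])
  then show "f x = 0" using F by (simp add: c_def)
qed

lemma card_facets_le: "card facets \<le> CARD('n) + 1"
proof -
  obtain F0 where F0: "F0 \<in> facets" using facets_nonempty by blast
  have inj: "inj_on normal (facets - {F0})" using inj_normal by (rule inj_on_subset) auto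
  have "card (normal ` (facets - {F0})) \<le> DIM(real ^ 'n)"
    using independent_bound[OF normals_independent[OF F0]] by simp
  then show ?thesis using card_image[OF inj] F0 finite_facets by simp
qed

text \<open>
Otherwise the point could be moved a little along \<open>d\<close> and along \<open>- d\<close> inside \<open>P\<close>.
\<close>
lemma normals_at_extreme_point:
  assumes v: "v extreme_point_of P" and d: "\<And>F. F \<in> facets \<Longrightarrow> v \<in> F \<Longrightarrow> normal F \<bullet> d = 0"
  shows "d = 0"
proof (rule ccontr)
  assume "d \<noteq> 0"
  have vP: "v \<in> P" using v by (simp add: extreme_point_of_def)
  define U where "U = (\<Inter>F\<in>{F \<in> facets. v \<notin> F}. {x. normal F \<bullet> x < 1})"
  have "open U" unfolding U_def using finite_facets by (intro open_INT) (auto intro: open_halfspace_lt)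
  moreover have "v \<in> U" using normal_le[OF _ vP] vP by (force simp: U_def mem_facet_iff)
  ultimately obtain e where e: "e > 0" "ball v e \<subseteq> U" using open_contains_ball by blast
  define c where "c = e / (2 * norm d)"
  have c: "c > 0" using e \<open>d \<noteq> 0\<close> by (simp add: c_def)
  have mem: "v + k *\<^sub>R d \<in> P" if "\<bar>k\<bar> = c" for k
  proof -
    have "norm (k *\<^sub>R d) < e" using that e \<open>d \<noteq> 0\<close> by (simp add: c_def)
    then have U: "v + k *\<^sub>R d \<in> U" using e(2) by (auto simp: dist_norm)
    have "normal F \<bullet> (v + k *\<^sub>R d) \<le> 1" if F: "F \<in> facets" for F
    proof (cases "v \<in> F")
      case True
      then show ?thesis using d[OF F True] F by (simp add: inner_add_right mem_facet_iff)
    next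
      case False
      then show ?thesis using U F by (auto simp: U_def intro: less_imp_le)
    qed
    then show ?thesis by (simp add: mem_P_iff)
  qed
  have "v + c *\<^sub>R d \<in> P" "v + (- c) *\<^sub>R d \<in> P" using mem[of c] mem[of "- c"] c by simp_all
  moreover have "v \<in> open_segment (v + c *\<^sub>R d) (v + (- c) *\<^sub>R d)"
  proof -
    have half: "0 < (1/2 :: real)" "(1/2 :: real) < 1" by simp_all
    have "v = (1 - 1/2) *\<^sub>R (v + c *\<^sub>R d) + (1/2) *\<^sub>R (v + (- c) *\<^sub>R d)"
      by (simp add: algebra_simps flip: scaleR_add_left)
    moreover have "v + c *\<^sub>R d \<noteq> v + (- c) *\<^sub>R d"
    proof
      assume "v + c *\<^sub>R d = v + (- c) *\<^sub>R d"
      then have "c = - c \<or> d = 0" by (simp only: add_left_cancel scaleR_cancel_right)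
      then show False using c \<open>d \<noteq> 0\<close> by simp
    qed
    ultimately show ?thesis unfolding in_segment using half by blast
  qed
  ultimately show False using v by (auto simp: extreme_point_of_def)
qed

text \<open>
If two facets are missed, the normals of the others number at most \<open>n - 1\<close> and leave a direction free.
\<close>
lemma extreme_point_misses_one_facet:
  assumes v: "v extreme_point_of P"
  obtains F where "F \<in> facets" "\<And>F'. F' \<in> facets \<Longrightarrow> F' \<noteq> F \<Longrightarrow> v \<in> F'"
proof -
  obtain F0 where F0: "F0 \<in> facets" using facets_nonempty by blast
  have unique: "F = F'" if F: "F \<in> facets" "F' \<in> facets" "v \<notin> F" "v \<notin> F'" for F F'
  proof (rule ccontr)
    assume "F \<noteq> F'"
    let ?N = "normal ` (facets - {F, F'})"
    have "card ?N \<le> card (facets - {F, F'})" using finite_facets by (intro card_image_le) auto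
    also have "\<dots> = card facets - 2" using F \<open>F \<noteq> F'\<close> finite_facets by (simp add: card_Diff_subset)
    also have "\<dots> < CARD('n)" using card_facets_le dim2 by simp
    finally have "dim ?N < DIM(real ^ 'n)"
      using dim_le_card'[of ?N] finite_facets by simp
    then obtain d where d: "d \<noteq> 0" "\<And>y. y \<in> span ?N \<Longrightarrow> orthogonal d y"
      using orthogonal_to_subspace_exists by blast
    have "d = 0"
    proof (rule normals_at_extreme_point[OF v])
      fix E assume E: "E \<in> facets" "v \<in> E"
      then have "normal E \<in> ?N" using F by auto
      then have "orthogonal d (normal E)" by (intro d(2) span_base)
      then show "normal E \<bullet> d = 0" by (simp add: orthogonal_def inner_commute)
    qed
    then show False using d(1) by simp
  qed
  show ?thesis
  proof (cases "\<exists>F\<in>facets. v \<notin> F")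
    case True
    then obtain F where F: "F \<in> facets" "v \<notin> F" by blast
    show ?thesis using that[OF F(1)] unique[OF _ F(1) _ F(2)] by blast
  next
    case False
    then show ?thesis using that[OF F0] by blast
  qed
qed

text \<open>
One of the vectors \<open>d\<close> and \<open>- d\<close> has nonpositive inner product with every normal, and would span a ray in
the bounded set \<open>P\<close>.
\<close>
lemma direction_zero:
  assumes F: "F \<in> facets" and d: "\<And>F'. F' \<in> facets \<Longrightarrow> F' \<noteq> F \<Longrightarrow> normal F' \<bullet> d = 0"
  shows "d = 0"
proof -
  have *: "d = 0" if "\<And>F'. F' \<in> facets \<Longrightarrow> normal F' \<bullet> d \<le> 0" for d
    using level_pos[of d 0] that by blast
  consider "normal F \<bullet> d \<le> 0" | "normal F \<bullet> (- d) \<le> 0" by fastforce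
  then show ?thesis
  proof cases
    case 1
    then show ?thesis using d by (intro *) (metis order_refl)
  next
    case 2
    then have "- d = 0" using d by (intro *) (metis inner_minus_right neg_0_equal_iff_equal order_refl)
    then show ?thesis by simp
  qed
qed

text \<open>
Two vertices that lie in all facets but the same one differ by a vector orthogonal to all the other
normals, so they coincide.
\<close>
lemma card_extreme_points_le: "card {v. v extreme_point_of P} \<le> CARD('n) + 1"
proof -
  have "\<exists>F. \<forall>v. v extreme_point_of P \<longrightarrow> F v \<in> facets \<and> (\<forall>F'\<in>facets. F' \<noteq> F v \<longrightarrow> v \<in> F')"
    by (rule choice) (metis extreme_point_misses_one_facet)
  then obtain F where F: "\<And>v. v extreme_point_of P \<Longrightarrow> F v \<in> facets"
    "\<And>v F'. v extreme_point_of P \<Longrightarrow> F' \<in> facets \<Longrightarrow> F' \<noteq> F v \<Longrightarrow> v \<in> F'" by blast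
  have "inj_on F {v. v extreme_point_of P}"
  proof (rule inj_onI)
    fix v v' assume v: "v \<in> {v. v extreme_point_of P}" "v' \<in> {v. v extreme_point_of P}" "F v = F v'"
    have "v - v' = 0"
    proof (rule direction_zero)
      show "F v \<in> facets" using F v by simp
      fix E assume E: "E \<in> facets" "E \<noteq> F v"
      then have "v \<in> E" "v' \<in> E" using F(2) v by auto
      then show "normal E \<bullet> (v - v') = 0" using E(1) by (simp add: mem_facet_iff inner_diff_right)
    qed
    then show "v = v'" by simp
  qed
  then have "card {v. v extreme_point_of P} \<le> card facets"
    using F(1) finite_facets by (intro card_inj_on_le[of F]) auto
  then show ?thesis using card_facets_le by simp
qed

theorem is_simplex: "int CARD('n) simplex P"
proof -
  let ?E = "{v. v extreme_point_of P}"
  have P: "P = convex hull ?E" by (rule Krein_Milman_Minkowski[OF compact convex])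
  have fin: "finite ?E" using poly by (rule finite_polyhedron_extreme_points[OF polytope_imp_polyhedron])
  have dimE: "aff_dim ?E = int CARD('n)"
    using aff_dim_P by (metis P aff_dim_convex_hull)
  have "aff_dim ?E \<le> int (card ?E) - 1" using fin by (rule aff_dim_le_card)
  then have card: "int (card ?E) = int CARD('n) + 1"
    using dimE card_extreme_points_le by simp
  then have "\<not> affine_dependent ?E"
    using fin dimE by (simp add: affine_independent_iff_card)
  then have "int CARD('n) simplex (convex hull ?E)"
    using card by (intro simplex_convex_hull) simp
  then show ?thesis using P by simp
qed

end

section \<open>Reduction to a centred polytope\<close>

lemma infdist_translate: "infdist (a + x) ((+) a ` B) = infdist (x :: 'a::real_normed_vector) B"
  by (simp add: infdist_def image_image)

lemma hausdorff_dist_translate: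
  fixes A B :: "'a::real_normed_vector set"
  shows "hausdorff_dist ((+) a ` A) ((+) a ` B) = hausdorff_dist A B"
  by (simp add: hausdorff_dist_def image_image infdist_translate)

lemma convex_body_translate: "convex_body K \<Longrightarrow> convex_body ((+) a ` K)"
  by (simp add: convex_body_def compact_translation convex_translation interior_translation)

lemma set_integral_translate:
  fixes h :: "'a::euclidean_space \<Rightarrow> real"
  assumes [measurable]: "h \<in> borel_measurable borel" and "compact K"
  shows "(LINT x:(+) a ` K|lborel. h x) = (LINT x:K|lborel. h (a + x))"
proof -
  have [measurable]: "(+) a ` K \<in> sets borel"
    using assms(2) by (intro borel_compact compact_translation)
  have "(LINT x|lborel. indicator ((+) a ` K) x *\<^sub>R h x) = (LINT x|distr lborel borel ((+) a). indicator ((+) a ` K) x *\<^sub>R h x)"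
    by (simp add: lborel_distr_plus)
  also have "\<dots> = (LINT x|lborel. indicator ((+) a ` K) (a + x) *\<^sub>R h (a + x))"
    by (rule integral_distr) measurable
  also have "\<dots> = (LINT x|lborel. indicator K x *\<^sub>R h (a + x))"
    by (intro Bochner_Integration.integral_cong) (auto simp: indicator_def)
  finally show ?thesis by (simp add: set_lebesgue_integral_def)
qed

lemma moment_translate:
  fixes K :: "(real ^ 'n) set"
  assumes K: "compact K"
  shows "moment0 ((+) a ` K) = moment0 K"
    and "moment1 ((+) a ` K) = moment1 K + moment0 K *\<^sub>R a"
    and "moment2 ((+) a ` K) = moment2 K + outer a (moment1 K) + outer (moment1 K) a + moment0 K *\<^sub>R outer a a"
proof -
  show "moment0 ((+) a ` K) = moment0 K"
    unfolding moment0_def by (subst set_integral_translate[OF _ K]) auto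
  have "(LINT x:(+) a ` K|lborel. x $ i) = (LINT x:K|lborel. 1 * x $ i + a $ i * 1)" for i
    by (subst set_integral_translate[OF _ K]) (auto simp: algebra_simps)
  also have "(LINT x:K|lborel. 1 * x $ i + a $ i * 1) = 1 * (LINT x:K|lborel. x $ i) + a $ i * (LINT x:K|lborel. 1)" for i
    by (rule compact_set_integral_linear_combo[OF K]) (intro continuous_intros)+
  finally show "moment1 ((+) a ` K) = moment1 K + moment0 K *\<^sub>R a"
    by (simp add: moment1_def moment0_def vec_eq_iff)
  have "(LINT x:(+) a ` K|lborel. x $ i * x $ j) = (LINT x:K|lborel. x $ i * x $ j) +
     (a $ i * (LINT x:K|lborel. x $ j) + a $ j * (LINT x:K|lborel. x $ i)) + a $ i * a $ j * (LINT x:K|lborel. 1)" for i j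
  proof -
    have "(LINT x:(+) a ` K|lborel. x $ i * x $ j) =
        (LINT x:K|lborel. 1 * (1 * (x $ i * x $ j) + a $ i * x $ j) + 1 * (a $ j * x $ i + (a $ i * a $ j) * 1))"
      by (subst set_integral_translate[OF _ K]) (auto simp: algebra_simps)
    also have "\<dots> = 1 * (LINT x:K|lborel. 1 * (x $ i * x $ j) + a $ i * x $ j) + 1 * (LINT x:K|lborel. a $ j * x $ i + (a $ i * a $ j) * 1)"
      by (rule compact_set_integral_linear_combo[OF K]) (intro continuous_intros)+
    also have "(LINT x:K|lborel. 1 * (x $ i * x $ j) + a $ i * x $ j) = 1 * (LINT x:K|lborel. x $ i * x $ j) + a $ i * (LINT x:K|lborel. x $ j)"
      by (rule compact_set_integral_linear_combo[OF K]) (intro continuous_intros)+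
    also have "(LINT x:K|lborel. a $ j * x $ i + (a $ i * a $ j) * 1) = a $ j * (LINT x:K|lborel. x $ i) + (a $ i * a $ j) * (LINT x:K|lborel. 1)"
      by (rule compact_set_integral_linear_combo[OF K]) (intro continuous_intros)+
    finally show ?thesis by simp
  qed
  then show "moment2 ((+) a ` K) = moment2 K + outer a (moment1 K) + outer (moment1 K) a + moment0 K *\<^sub>R outer a a"
    by (simp add: moment2_def moment1_def moment0_def vec_eq_iff)
qed

lemma iso_ratio_translate:
  fixes K :: "(real ^ 'n) set"
  assumes "convex_body K"
  shows "iso_ratio ((+) a ` K) = iso_ratio K"
proof -
  have V: "moment0 K > 0" using convex_body_measure_pos[OF assms] by (simp add: moment0_eq_measure)
  have K: "compact K" using assms by (rule convex_body_compact)
  have "moment2 ((+) a ` K) /\<^sub>R moment0 K - outer (moment1 ((+) a ` K) /\<^sub>R moment0 K) (moment1 ((+) a ` K) /\<^sub>R moment0 K) =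
      moment2 K /\<^sub>R moment0 K - outer (moment1 K /\<^sub>R moment0 K) (moment1 K /\<^sub>R moment0 K)"
    using V by (simp add: moment_translate[OF K] vec_eq_iff) (simp add: field_simps)
  then show ?thesis by (simp add: iso_ratio_def moment_translate(1)[OF K])
qed

text \<open>
Otherwise a hyperplane through the centroid has the body on one side. The mean of the corresponding linear
functional is its value at the centroid, so the body would lie in the hyperplane.
\<close>
lemma centroid_in_interior:
  fixes K :: "(real ^ 'n) set"
  assumes K: "convex_body K"
  shows "centroid K \<in> interior K"
proof (rule ccontr)
  let ?c = "centroid K"
  assume "?c \<notin> interior K"
  have cvx: "convex K" and cpt: "compact K" and ne: "interior K \<noteq> {}"
    using K by (auto simp: convex_body_def)
  obtain a b where ab: "a \<noteq> 0" "\<forall>x\<in>{?c}. a \<bullet> x \<le> b" "\<forall>x\<in>interior K. b \<le> a \<bullet> x"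
    using separating_hyperplane_sets[of "{?c}" "interior K"] ne cvx \<open>?c \<notin> interior K\<close> by auto
  have "closure (interior K) \<subseteq> {x. a \<bullet> ?c \<le> a \<bullet> x}"
    using ab by (intro closure_minimal) (force simp: closed_halfspace_ge)+
  then have nn: "0 \<le> 1 * (a \<bullet> x) + (- (a \<bullet> ?c)) * 1" if "x \<in> K" for x
    using that convex_closure_interior[OF cvx ne] closure_subset by fastforce
  have V: "moment0 K > 0" using convex_body_measure_pos[OF K] by (simp add: moment0_eq_measure)
  have "(LINT x:K|lborel. 1 * (a \<bullet> x) + (- (a \<bullet> ?c)) * 1) = 1 * (LINT x:K|lborel. a \<bullet> x) + (- (a \<bullet> ?c)) * (LINT x:K|lborel. 1)"
    by (rule compact_set_integral_linear_combo[OF cpt]) (intro continuous_intros)+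
  also have "\<dots> = a \<bullet> moment1 K - (a \<bullet> ?c) * moment0 K"
    by (simp add: moment1_inner[OF cpt] moment0_def)
  also have "\<dots> = 0" using V by (simp add: centroid_eq_moment1[OF K])
  finally have zero: "1 * (a \<bullet> x) + (- (a \<bullet> ?c)) * 1 = 0" if "x \<in> interior K" for x
    using that by (intro set_integral_nonneg_zero_imp[OF cpt _ nn]) (auto intro!: continuous_intros)
  obtain x e where x: "e > 0" "ball x e \<subseteq> interior K"
    using ne by (metis ex_in_conv open_contains_ball open_interior)
  define y where "y = x + (e / (2 * norm a)) *\<^sub>R a"
  have "y \<in> ball x e" "x \<in> ball x e" using x ab(1) by (auto simp: y_def dist_norm)
  then have "a \<bullet> y = a \<bullet> x" using zero x(2) by (metis (no_types, lifting) add_left_imp_eq add.commute add_0 subsetD mult_1)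
  then show False using x(1) ab(1) by (simp add: y_def inner_add_right)
qed

lemma facet_of_translate: "(+) a ` F facet_of (+) a ` S \<longleftrightarrow> F facet_of S"
  by (simp add: facet_of_def aff_dim_translation_eq)

lemma affine_reflector_translate:
  assumes refl: "affine_reflector P G" and cent: "centroid ((+) a ` P) = a + centroid P"
  shows "affine_reflector ((+) a ` P) ((+) a ` G)"
proof -
  obtain F1 F2 f where f: "F1 facet_of P" "F2 facet_of P" "F1 \<noteq> F2" "G = F1 \<inter> F2"
    "affine_map f" "f (centroid P) = centroid P" "f ` F1 = F2" "\<forall>x\<in>G. f x = x"
    using refl unfolding affine_reflector_def by blast
  obtain g b where g: "linear g" "f = (\<lambda>x. g x + b)" using f(5) by (auto simp: affine_map_def)
  let ?f = "\<lambda>x. a + f (x - a)"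
  show ?thesis
    unfolding affine_reflector_def
  proof (intro exI conjI)
    show "(+) a ` F1 facet_of (+) a ` P" "(+) a ` F2 facet_of (+) a ` P"
      using f by (simp_all add: facet_of_translate)
    show "(+) a ` F1 \<noteq> (+) a ` F2" using f(3) by (simp add: inj_image_eq_iff)
    show "(+) a ` G = (+) a ` F1 \<inter> (+) a ` F2" by (simp add: f(4) image_Int)
    show "affine_map ?f"
      unfolding affine_map_def g(2)
      by (intro exI[of _ g] exI[of _ "a + b - g a"]) (simp add: g(1) linear_diff fun_eq_iff)
    show "?f (centroid ((+) a ` P)) = centroid ((+) a ` P)" by (simp add: cent f(6))
    show "?f ` (+) a ` F1 = (+) a ` F2" by (simp add: image_image flip: f(7))
    show "\<forall>x\<in>(+) a ` G. ?f x = x" using f(8) by auto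
  qed
qed

lemma simplex_translate: "n simplex S \<Longrightarrow> n simplex ((+) a ` S)"
  unfolding simplex_def
  by (metis affine_dependent_translation_eq card_image convex_hull_translation inj_on_add)

theorem theorem2p7:
  fixes P :: "(real ^ 'n) set"
  assumes "polytope P" and "interior P \<noteq> {}"
    and "local_maximizer_isotropic {K. convex_body K} P"
    and "\<And>G. G ridge_of P \<Longrightarrow> affine_reflector P G"
  shows "int CARD('n) simplex P"
proof (cases "CARD('n) \<ge> 2")
  case False
  have dim: "aff_dim P = int CARD('n)" using assms(2) by (subst aff_dim_nonempty_interior) auto
  then have "aff_dim P \<le> 1" using False by simp
  then obtain m where "m simplex P" using polytope_lowdim_imp_simplex[OF assms(1)] by blast
  then show ?thesis using aff_dim_simplex dim by fastforce
next
  case True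
  define c where "c = centroid P"
  define Q where "Q = (+) (- c) ` P"
  have cb: "convex_body P"
    using assms(1,2) by (simp add: convex_body_def polytope_imp_compact polytope_imp_convex)
  then have cbQ: "convex_body Q" unfolding Q_def by (rule convex_body_translate)
  have V: "moment0 P > 0" using convex_body_measure_pos[OF cb] by (simp add: moment0_eq_measure)
  have m1: "moment1 Q = 0"
    unfolding Q_def moment_translate(2)[OF convex_body_compact[OF cb]]
    using V by (simp add: c_def centroid_eq_moment1[OF cb])
  have centQ: "centroid Q = 0" by (simp add: centroid_eq_moment1[OF cbQ] m1)
  have PQ: "P = (+) c ` Q" by (simp add: Q_def image_image)
  obtain \<epsilon> where \<epsilon>: "\<epsilon> > 0"
    "\<And>K. convex_body K \<Longrightarrow> hausdorff_dist K P < \<epsilon> \<Longrightarrow> isotropic_constant K \<le> isotropic_constant P"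
    using assms(3) by (auto simp: local_maximizer_isotropic_def)
  interpret reflector_maximizer Q
  proof
    show "polytope Q" unfolding Q_def using assms(1) by (simp only: polytope_translation_eq)
    show "0 \<in> interior Q"
      using centroid_in_interior[OF cb] unfolding Q_def interior_translation c_def by force
    show "moment1 Q = 0" by fact
    show "\<exists>\<epsilon>>0. \<forall>K. convex_body K \<longrightarrow> hausdorff_dist K Q < \<epsilon> \<longrightarrow> iso_ratio K \<le> iso_ratio Q"
    proof (intro exI conjI allI impI)
      show "\<epsilon> > 0" by fact
      fix K :: "(real ^ 'n) set" assume K: "convex_body K" "hausdorff_dist K Q < \<epsilon>"
      have "hausdorff_dist ((+) c ` K) P < \<epsilon>"
        using K(2) by (simp add: PQ hausdorff_dist_translate)
      then have "iso_ratio ((+) c ` K) \<le> iso_ratio P"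
        using \<epsilon>(2) convex_body_translate[OF K(1)] cb isotropic_constant_le_iff by blast
      then show "iso_ratio K \<le> iso_ratio Q"
        using iso_ratio_translate K(1) cb by (metis Q_def)
    qed
    show "CARD('n) \<ge> 2" by fact
    show "centroid Q = 0" by fact
    fix G assume G: "G ridge_of Q"
    have "G = (+) (- c) ` ((+) c ` G)" by (simp add: image_image)
    moreover have "(+) c ` G ridge_of P"
      using G by (simp add: PQ ridge_of_def aff_dim_translation_eq)
    then have "affine_reflector P ((+) c ` G)" by (rule assms(4))
    then have "affine_reflector Q ((+) (- c) ` ((+) c ` G))"
      unfolding Q_def by (rule affine_reflector_translate) (use centQ in \<open>simp add: Q_def c_def\<close>)
    ultimately show "affine_reflector Q G" by simp
  qed
  show ?thesis using simplex_translate[OF is_simplex, of c] by (simp add: PQ)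
qed

end
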